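(* Let $G\subset\mathbb{R}^N$ be a bounded open domain and $T>0$. Let $\varphi:G\times\mathbb{R}\to[0,+\infty)$ be a measurable-convex integrand with $\varphi(x,0)=0$ for each $x\in G$, and let $\bar\beta(x,\cdot)=\partial\varphi(x,\cdot)$. Assume that for each $C>0$ the function $M_C(x)=\sup\{|u|:\ u\in\bar\beta(x,v),\ |v|\le C\}$ belongs to $L^2(G)$. Let $A:\mathrm{Dom}(A)\subset L^1(G)\to L^1(G)$ be a linear operator such that: (a) $\mathrm{Dom}(A)$ is dense in $L^1(G)$ and $(I+\lambda A)^{-1}$ is a contraction on $L^1(G)$ for each $\lambda>0$; (b) there is a $c>0$ such that $c\|v\|_{L^1}\le\|Av\|_{L^1}$ for all $v\in\mathrm{Dom}(A)$; (c) $\sup_G (I+\lambda A)^{-1}f\le(\sup_G f)^+$ for each $f\in L^1(G)$ and $\lambda>0$. Let $\mathcal{A}$ be the relation on $L^1(G)$ defined by: $f\in\mathcal{A}(u)$ iff $u,f\in L^1(G)$ and there is $\chi\in\mathrm{Dom}(A)$ with $A\chi=f$ and $u(x)\in\bar\beta(x,\chi(x))$ for a.e. $x\in G$. Then for each $u_0\in\overline{\mathrm{Dom}(\mathcal{A})}$ (closure in $L^1(G)$) and each $F\in L^1(0,T;L^1(G))$ there is a unique $C^0$-solution $u$ of $$u'(t)+\mathcal{A}u(t)\ni F(t),\quad 0<t<T,\qquad u(0)=u_0 .$$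
   Context: A function $\varphi:G\times\mathbb{R}\to(-\infty,+\infty]$ is a measurable-convex integrand if for each $x\in G$ the function $\varphi(x,\cdot)$ is proper, lower semicontinuous and convex, and for each $\xi\in\mathbb{R}$ the function $x\mapsto\varphi(x,\xi)$ is measurable. The subgradient is taken in the second variable: $u^*\in\partial\varphi(x,v)$ iff $u^*(w-v)\le\varphi(x,w)-\varphi(x,v)$ for all $w\in\mathbb{R}$. "Contraction" means nonexpansive, and in (a) the inverse $(I+\lambda A)^{-1}$ is defined on all of $L^1(G)$. $\sup_G$ is the essential supremum; $r^+=\max(r,0)$. $\mathrm{Dom}(\mathcal{A})=\{u:\mathcal{A}(u)\neq\emptyset\}$. With $X=L^1(G)$: an $\varepsilon$-solution of $u'+\mathcal{A}u\ni F$ on $[0,T]$ consists of a discretization $\mathcal{D}=\{0=t_0<t_1<\dots<t_n=T;\ F_1,\dots,F_n\in X\}$ and a step function $s$ with $s(t_0)=s_0$ and $s(t)=s_j$ for $t\in(t_{j-1},t_j]$, such that $t_j-t_{j-1}\le\varepsilon$ for $1\le j\le n$, $\sum_{j=1}^n\int_{t_{j-1}}^{t_j}\|F(t)-F_j\|\,dt<\varepsilon$, and $\frac{s_j-s_{j-1}}{t_j-t_{j-1}}+\mathcal{A}(s_j)\ni F_j$ for $1\le j\le n$. A $C^0$-solution is a function $u\in C([0,T];X)$ with $u(0)=u_0$ such that for each $\varepsilon>0$ there is an $\varepsilon$-solution $\mathcal{D},s$ with $\|u(t)-s(t)\|\le\varepsilon$ for all $t\in[0,T]$. *)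

theory Defs
  imports "HOL-Analysis.Analysis" "HOL-Probability.Essential_Supremum"
begin

section \<open>The space of Lebesgue integrable functions modulo a.e. equality\<close>

definition L1_rel :: "('a::euclidean_space \<Rightarrow> real) \<Rightarrow> ('a \<Rightarrow> real) \<Rightarrow> bool" where
  "L1_rel f g \<longleftrightarrow> integrable lebesgue f \<and> integrable lebesgue g \<and> (AE x in lebesgue. f x = g x)"

lemma L1_relI:
  "integrable lebesgue f \<Longrightarrow> integrable lebesgue g \<Longrightarrow> AE x in lebesgue. f x = g x \<Longrightarrow> L1_rel f g"
  by (simp add: L1_rel_def)

lemma L1_rel_part_equivp: "part_equivp L1_rel"
proof (rule part_equivpI)
  show "\<exists>f. L1_rel (f :: 'a \<Rightarrow> real) f"
    by (intro exI[of _ "\<lambda>_. 0"] L1_relI) auto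
  show "symp (L1_rel :: ('a \<Rightarrow> real) \<Rightarrow> _)"
    by (rule sympI) (auto simp: L1_rel_def)
  show "transp (L1_rel :: ('a \<Rightarrow> real) \<Rightarrow> _)"
    by (rule transpI) (auto simp: L1_rel_def)
qed

text \<open>\<open>'a L1\<close> is $L^1$ of the whole Euclidean space \<open>'a\<close>. Functions that are
  not integrable belong to no class. \<open>rep_L1 f\<close> is some representative of the class \<open>f\<close>.\<close>

quotient_type (overloaded) 'a L1 = "'a::euclidean_space \<Rightarrow> real" / partial: L1_rel
  by (rule L1_rel_part_equivp)

lemma integrable_rep_L1 [simp, intro]: "integrable lebesgue (rep_L1 f)"
  using Quotient3_rep_reflp[OF Quotient3_L1, of f] by (simp add: L1_rel_def)

lemma borel_measurable_rep_L1 [measurable, simp]: "rep_L1 f \<in> borel_measurable lebesgue"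
  by (rule borel_measurable_integrable) simp

lemma abs_rep_L1 [simp]: "abs_L1 (rep_L1 f) = f"
  by (rule Quotient3_abs_rep[OF Quotient3_L1])

lemma L1_eqI: "AE x in lebesgue. rep_L1 f x = rep_L1 g x \<Longrightarrow> f = g"
  using Quotient3_rel_rep[OF Quotient3_L1, of f g] by (simp add: L1_rel_def)

lemma L1_rel_rep_abs: "integrable lebesgue f \<Longrightarrow> L1_rel (rep_L1 (abs_L1 f)) f"
  by (rule rep_abs_rsp_left[OF Quotient3_L1]) (simp add: L1_rel_def)

lemma AE_rep_abs_L1:
  "integrable lebesgue f \<Longrightarrow> AE x in lebesgue. rep_L1 (abs_L1 f) x = f x"
  using L1_rel_rep_abs[of f] by (simp add: L1_rel_def)

lemma L1_rel_add:
  assumes "L1_rel f f'" "L1_rel g g'"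
  shows "L1_rel (\<lambda>x. f x + g x) (\<lambda>x. f' x + g' x)"
proof -
  have "AE x in lebesgue. f x = f' x" "AE x in lebesgue. g x = g' x"
    using assms by (auto simp: L1_rel_def)
  then have "AE x in lebesgue. f x + g x = f' x + g' x"
    by eventually_elim simp
  then show ?thesis
    using assms by (simp add: L1_rel_def)
qed

lemma L1_rel_mult:
  assumes "L1_rel f f'"
  shows "L1_rel (\<lambda>x. c * f x) (\<lambda>x. c * f' x)"
proof -
  have "AE x in lebesgue. f x = f' x"
    using assms by (auto simp: L1_rel_def)
  then have "AE x in lebesgue. c * f x = c * f' x"
    by eventually_elim simp
  then show ?thesis
    using assms by (simp add: L1_rel_def del: mult_cancel_left)
qed

lemma L1_rel_uminus: "L1_rel f f' \<Longrightarrow> L1_rel (\<lambda>x. - f x) (\<lambda>x. - f' x)"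
  using L1_rel_mult[of f f' "-1"] by simp

lemma L1_rel_diff: "L1_rel f f' \<Longrightarrow> L1_rel g g' \<Longrightarrow> L1_rel (\<lambda>x. f x - g x) (\<lambda>x. f' x - g' x)"
  using L1_rel_add[OF _ L1_rel_uminus] by fastforce

lemma L1_rel_integral_abs:
  assumes "L1_rel f f'"
  shows "(\<integral>x. \<bar>f x\<bar> \<partial>lebesgue) = (\<integral>x. \<bar>f' x\<bar> \<partial>lebesgue)"
proof (rule integral_cong_AE)
  have "AE x in lebesgue. f x = f' x"
    using assms by (auto simp: L1_rel_def)
  then show "AE x in lebesgue. \<bar>f x\<bar> = \<bar>f' x\<bar>"
    by eventually_elim simp
qed (use assms in \<open>auto simp: L1_rel_def intro!: borel_measurable_abs\<close>)

instantiation L1 :: (euclidean_space) real_normed_vector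
begin

lift_definition zero_L1 :: "'a L1" is "\<lambda>x. 0"
  by (simp add: L1_rel_def)

lift_definition plus_L1 :: "'a L1 \<Rightarrow> 'a L1 \<Rightarrow> 'a L1" is "\<lambda>f g x. f x + g x"
  by (rule L1_rel_add)

lift_definition minus_L1 :: "'a L1 \<Rightarrow> 'a L1 \<Rightarrow> 'a L1" is "\<lambda>f g x. f x - g x"
  by (rule L1_rel_diff)

lift_definition uminus_L1 :: "'a L1 \<Rightarrow> 'a L1" is "\<lambda>f x. - f x"
  by (rule L1_rel_uminus)

lift_definition scaleR_L1 :: "real \<Rightarrow> 'a L1 \<Rightarrow> 'a L1" is "\<lambda>c f x. c * f x"
  by (rule L1_rel_mult)

lift_definition norm_L1 :: "'a L1 \<Rightarrow> real" is "\<lambda>f. \<integral>x. \<bar>f x\<bar> \<partial>lebesgue"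
  by (rule L1_rel_integral_abs)

definition sgn_L1 :: "'a L1 \<Rightarrow> 'a L1"
  where "sgn_L1 f = scaleR (inverse (norm f)) f"

definition dist_L1 :: "'a L1 \<Rightarrow> 'a L1 \<Rightarrow> real"
  where "dist_L1 f g = norm (f - g)"

definition uniformity_L1 :: "('a L1 \<times> 'a L1) filter"
  where "uniformity_L1 = (INF e\<in>{0 <..}. principal {(x, y). dist x y < e})"

definition open_L1 :: "'a L1 set \<Rightarrow> bool"
  where "open_L1 S = (\<forall>x\<in>S. \<forall>\<^sub>F (x', y) in uniformity. x' = x \<longrightarrow> y \<in> S)"

instance
proof
  fix f g h :: "'a L1" and a b :: real
  show "dist f g = norm (f - g)" by (rule dist_L1_def)
  show "sgn f = scaleR (inverse (norm f)) f" by (rule sgn_L1_def)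
  show "uniformity = (INF e\<in>{0 <..}. principal {(x, y :: 'a L1). dist x y < e})"
    by (rule uniformity_L1_def)
  show "open U = (\<forall>x\<in>U. \<forall>\<^sub>F (x', y) in uniformity. x' = x \<longrightarrow> y \<in> U)" for U :: "'a L1 set"
    by (rule open_L1_def)
  show "f + g + h = f + (g + h)" by transfer (auto simp: L1_rel_def algebra_simps)
  show "f + g = g + f" by transfer (auto simp: L1_rel_def algebra_simps)
  show "0 + f = f" by transfer (auto simp: L1_rel_def algebra_simps)
  show "- f + f = 0" by transfer (auto simp: L1_rel_def algebra_simps)
  show "f - g = f + - g" by transfer (auto simp: L1_rel_def algebra_simps)
  show "a *\<^sub>R (f + g) = a *\<^sub>R f + a *\<^sub>R g" by transfer (auto simp: L1_rel_def algebra_simps)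
  show "(a + b) *\<^sub>R f = a *\<^sub>R f + b *\<^sub>R f" by transfer (auto simp: L1_rel_def algebra_simps)
  show "a *\<^sub>R b *\<^sub>R f = (a * b) *\<^sub>R f" by transfer (auto simp: L1_rel_def algebra_simps)
  show "1 *\<^sub>R f = f" by transfer (auto simp: L1_rel_def)
  show "norm f = 0 \<longleftrightarrow> f = 0"
    by transfer (auto simp: L1_rel_def integral_nonneg_eq_0_iff_AE)
  show "norm (f + g) \<le> norm f + norm g"
  proof transfer
    fix f g :: "'a \<Rightarrow> real" assume "L1_rel f f" "L1_rel g g"
    then have fg: "integrable lebesgue f" "integrable lebesgue g" by (auto simp: L1_rel_def)
    have "(\<integral>x. \<bar>f x + g x\<bar> \<partial>lebesgue) \<le> (\<integral>x. \<bar>f x\<bar> + \<bar>g x\<bar> \<partial>lebesgue)"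
      using fg by (intro integral_mono) auto
    then show "(\<integral>x. \<bar>f x + g x\<bar> \<partial>lebesgue) \<le> (\<integral>x. \<bar>f x\<bar> \<partial>lebesgue) + (\<integral>x. \<bar>g x\<bar> \<partial>lebesgue)"
      using fg by simp
  qed
  show "norm (a *\<^sub>R f) = \<bar>a\<bar> * norm f"
    by transfer (simp add: abs_mult)
qed

end

lemma norm_abs_L1: "integrable lebesgue f \<Longrightarrow> norm (abs_L1 f) = (\<integral>x. \<bar>f x\<bar> \<partial>lebesgue)"
  by (simp add: L1_rel_def norm_L1.abs_eq)

lemma norm_L1_eq: "norm f = (\<integral>x. \<bar>rep_L1 f x\<bar> \<partial>lebesgue)"
  using norm_abs_L1[of "rep_L1 f"] by simp

lemma abs_L1_minus:
  "integrable lebesgue f \<Longrightarrow> integrable lebesgue g \<Longrightarrow> abs_L1 f - abs_L1 g = abs_L1 (\<lambda>x. f x - g x)"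
  by (simp add: L1_rel_def minus_L1.abs_eq)

lemma abs_L1_plus:
  "integrable lebesgue f \<Longrightarrow> integrable lebesgue g \<Longrightarrow> abs_L1 f + abs_L1 g = abs_L1 (\<lambda>x. f x + g x)"
  by (simp add: L1_rel_def plus_L1.abs_eq)

lemma abs_L1_scaleR:
  "integrable lebesgue f \<Longrightarrow> c *\<^sub>R abs_L1 f = abs_L1 (\<lambda>x. c * f x)"
  by (simp add: L1_rel_def scaleR_L1.abs_eq)

lemma tendsto_abs_L1_dominated:
  fixes f :: "'a::euclidean_space \<Rightarrow> real"
  assumes "integrable lebesgue f" "\<And>i. integrable lebesgue (s i)" "integrable lebesgue w"
    and lim: "AE x in lebesgue. (\<lambda>i. s i x) \<longlonglongrightarrow> f x"
    and bd: "\<And>i. AE x in lebesgue. \<bar>s i x\<bar> \<le> w x"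
  shows "(\<lambda>i. abs_L1 (s i)) \<longlonglongrightarrow> abs_L1 f"
proof -
  have "(\<lambda>i. \<integral>x. \<bar>s i x - f x\<bar> \<partial>lebesgue) \<longlonglongrightarrow> (\<integral>x. 0 \<partial>(lebesgue :: 'a measure))"
  proof (rule integral_dominated_convergence[where w = "\<lambda>x. w x + \<bar>f x\<bar>"])
    show "AE x in lebesgue. (\<lambda>i. \<bar>s i x - f x\<bar>) \<longlonglongrightarrow> 0"
      using lim by eventually_elim (simp add: LIM_zero tendsto_rabs_zero)
    show "AE x in lebesgue. norm \<bar>s i x - f x\<bar> \<le> w x + \<bar>f x\<bar>" for i
      using bd[of i] by eventually_elim auto
  qed (use assms in auto)
  then show ?thesis
    using assms by (simp add: tendsto_iff dist_norm abs_L1_minus norm_abs_L1)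
qed

instance L1 :: (euclidean_space) banach
proof
  fix X :: "nat \<Rightarrow> 'a L1" assume X: "Cauchy X"
  let ?s = "\<lambda>n. rep_L1 (X n)"
  have nm: "(\<integral>x. norm (?s i x - ?s j x) \<partial>lebesgue) = norm (X i - X j)" for i j
    using norm_abs_L1[of "\<lambda>x. ?s i x - ?s j x"] abs_L1_minus[of "?s i" "?s j"] by simp
  have C: "\<exists>N. \<forall>i\<ge>N. \<forall>j\<ge>N. (LINT x|lebesgue. norm (?s i x - ?s j x)) < e" if "e > 0" for e
    using X that unfolding nm by (simp add: Cauchy_def dist_norm)
  obtain r where r: "strict_mono r" and AEC: "AE x in lebesgue. Cauchy (\<lambda>i. ?s (r i) x)"
    using cauchy_L1_AE_cauchy_subseq[of lebesgue ?s] C by auto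
  define f where "f = (\<lambda>x. lim (\<lambda>i. ?s (r i) x))"
  have lim: "AE x in lebesgue. (\<lambda>i. ?s (r i) x) \<longlonglongrightarrow> f x"
    using AEC by eventually_elim (simp add: f_def Cauchy_convergent_iff convergent_LIMSEQ_iff)
  have [measurable]: "f \<in> borel_measurable lebesgue"
    unfolding f_def by measurable
  have est: "(\<integral>\<^sup>+x. ennreal \<bar>?s m x - f x\<bar> \<partial>lebesgue) \<le> ennreal e"
    if N: "\<forall>i\<ge>N. \<forall>j\<ge>N. norm (X i - X j) < e" and m: "m \<ge> N" for e N m
  proof -
    have "(\<integral>\<^sup>+x. ennreal \<bar>?s m x - f x\<bar> \<partial>lebesgue)
        = (\<integral>\<^sup>+x. liminf (\<lambda>i. ennreal \<bar>?s m x - ?s (r i) x\<bar>) \<partial>lebesgue)"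
    proof (rule nn_integral_cong_AE, use lim in eventually_elim)
      fix x assume "(\<lambda>i. ?s (r i) x) \<longlonglongrightarrow> f x"
      then have "(\<lambda>i. ennreal \<bar>?s m x - ?s (r i) x\<bar>) \<longlonglongrightarrow> ennreal \<bar>?s m x - f x\<bar>"
        by (intro tendsto_intros)
      then show "ennreal \<bar>?s m x - f x\<bar> = liminf (\<lambda>i. ennreal \<bar>?s m x - ?s (r i) x\<bar>)"
        by (rule lim_imp_Liminf[OF sequentially_bot, symmetric])
    qed
    also have "\<dots> \<le> liminf (\<lambda>i. \<integral>\<^sup>+x. ennreal \<bar>?s m x - ?s (r i) x\<bar> \<partial>lebesgue)"
      by (intro nn_integral_liminf) simp
    also have "\<dots> = liminf (\<lambda>i. ennreal (norm (X m - X (r i))))"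
      using nm[of m "r _"] by (subst nn_integral_eq_integral) auto
    also have "\<dots> \<le> limsup (\<lambda>i. ennreal (norm (X m - X (r i))))"
      by (intro Liminf_le_Limsup) simp
    also have "\<dots> \<le> ennreal e"
    proof (rule Limsup_bounded, rule eventually_sequentiallyI[of N])
      fix i assume "N \<le> i"
      then have "r i \<ge> N" using r by (meson le_trans strict_mono_imp_increasing)
      with N m show "ennreal (norm (X m - X (r i))) \<le> ennreal e"
        by (intro ennreal_leI) (simp add: less_imp_le)
    qed
    finally show ?thesis .
  qed
  have CX: "\<exists>N. \<forall>i\<ge>N. \<forall>j\<ge>N. norm (X i - X j) < e" if "e > 0" for e
    using X that by (simp add: Cauchy_def dist_norm)
  obtain N1 where "\<forall>i\<ge>N1. \<forall>j\<ge>N1. norm (X i - X j) < 1" using CX[of 1] by auto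
  from est[OF this order_refl] have "(\<integral>\<^sup>+x. ennreal \<bar>?s N1 x - f x\<bar> \<partial>lebesgue) < \<infinity>"
    by (simp add: order_le_less_trans)
  then have "integrable lebesgue (\<lambda>x. ?s N1 x - f x)"
    by (intro integrableI_bounded) auto
  from Bochner_Integration.integrable_diff[OF integrable_rep_L1[of "X N1"] this]
  have f: "integrable lebesgue f" by simp
  have "X \<longlonglongrightarrow> abs_L1 f"
  proof (rule LIMSEQ_I)
    fix e :: real assume e: "0 < e"
    then obtain N where N: "\<forall>i\<ge>N. \<forall>j\<ge>N. norm (X i - X j) < e / 2" using CX[of "e / 2"] by auto
    show "\<exists>N. \<forall>m\<ge>N. norm (X m - abs_L1 f) < e"
    proof (intro exI allI impI)
      fix m assume "N \<le> m"
      have "norm (X m - abs_L1 f) = (\<integral>x. \<bar>?s m x - f x\<bar> \<partial>lebesgue)"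
        using abs_L1_minus[OF integrable_rep_L1 f, of "X m"] f by (simp add: norm_abs_L1)
      also have "ennreal \<dots> = (\<integral>\<^sup>+x. ennreal \<bar>?s m x - f x\<bar> \<partial>lebesgue)"
        using f by (subst nn_integral_eq_integral) auto
      also have "\<dots> \<le> ennreal (e / 2)" by (rule est[OF N \<open>N \<le> m\<close>])
      finally show "norm (X m - abs_L1 f) < e" using e by (simp add: ennreal_le_iff)
    qed
  qed
  then show "convergent X" by (auto simp: convergent_def)
qed

lemma second_countable_if_countable_dense:
  fixes K :: "'a::metric_space set"
  assumes K: "countable K" and dense: "closure K = UNIV"
  shows "\<exists>B::'a set set. countable B \<and> open = generate_topology B"
proof -
  let ?B = "(\<lambda>(d, q). ball d q) ` (K \<times> (\<rat> :: real set))"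
  have "countable ?B"
    using K by (intro countable_image countable_SIGMA) (auto simp: countable_rat)
  moreover have "open S = generate_topology ?B S" for S :: "'a set"
  proof
    assume S: "open S"
    have "\<exists>b\<in>?B. x \<in> b \<and> b \<subseteq> S" if x: "x \<in> S" for x
    proof -
      obtain e where e: "e > 0" "ball x e \<subseteq> S" using S x openE by blast
      obtain q where q: "q \<in> \<rat>" "0 < q" "q < e / 2"
        using Rats_dense_in_real[of 0 "e / 2"] e by auto
      obtain d where d: "d \<in> K" "dist d x < q"
        using dense q closure_approachable[of x K] by auto
      have "ball d q \<subseteq> ball x e"
      proof
        fix y assume "y \<in> ball d q"
        then have "dist x y < q + q"
          using dist_triangle[of x y d] d by (auto simp: dist_commute)
        then show "y \<in> ball x e" using q by simp
      qed
      then show ?thesis using d q e by (intro bexI[of _ "ball d q"]) auto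
    qed
    then have "S = \<Union>{b \<in> ?B. b \<subseteq> S}" by blast
    moreover have "generate_topology ?B (\<Union>{b \<in> ?B. b \<subseteq> S})"
      by (rule generate_topology.UN) (auto intro: generate_topology.Basis)
    ultimately show "generate_topology ?B S" by simp
  next
    assume "generate_topology ?B S"
    then show "open S" by induction auto
  qed
  ultimately show ?thesis by blast
qed

lemma countable_dense_L1:
  "\<exists>K :: 'a::euclidean_space L1 set. countable K \<and> closure K = UNIV"
proof -
  obtain B :: "'a set set" where B: "countable B" "topological_basis B"
    using ex_countable_basis by blast
  define \<U> where "\<U> = {U \<in> Union ` {F. finite F \<and> F \<subseteq> B}. U \<in> lmeasurable}"
  define ind :: "'a set \<Rightarrow> 'a L1" where "ind U = abs_L1 (indicator U)" for U
  define s :: "('a set \<times> real) list \<Rightarrow> 'a L1"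
    where "s xs = sum_list (map (\<lambda>(U, q). q *\<^sub>R ind U) xs)" for xs
  define K where "K = s ` lists (\<U> \<times> \<rat>)"
  have "countable \<U>"
    unfolding \<U>_def
    by (rule countable_subset[OF _ countable_image[OF countable_Collect_finite_subset[OF B(1)]]]) blast
  then have "countable K"
    unfolding K_def by (intro countable_image countable_lists countable_SIGMA) (auto simp: countable_rat)
  have s_K: "s xs \<in> K" if "xs \<in> lists (\<U> \<times> \<rat>)" for xs
    using that by (auto simp: K_def)
  have K_add: "x + y \<in> K" if xy: "x \<in> K" "y \<in> K" for x y
  proof -
    obtain xs ys where *: "x = s xs" "y = s ys" "xs \<in> lists (\<U> \<times> \<rat>)" "ys \<in> lists (\<U> \<times> \<rat>)"
      using xy by (auto simp: K_def)
    have "s (xs @ ys) \<in> K" using *(3,4) by (intro s_K) (simp add: append_in_lists_conv)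
    then show ?thesis using * by (simp add: s_def)
  qed
  have cl_add: "x + y \<in> closure K" if xy: "x \<in> closure K" "y \<in> closure K" for x y
  proof -
    obtain xn yn where "\<And>n. xn n \<in> K" "xn \<longlonglongrightarrow> x" "\<And>n. yn n \<in> K" "yn \<longlonglongrightarrow> y"
      using xy unfolding closure_sequential by blast
    then show ?thesis
      unfolding closure_sequential
      by (intro exI[of _ "\<lambda>n. xn n + yn n"]) (auto intro: K_add tendsto_add)
  qed
  have cl_lim: "x \<in> closure K" if "\<And>n. xn n \<in> closure K" "xn \<longlonglongrightarrow> x" for x xn
    using that closed_sequentially[OF closed_closure] by blast
  have int_ind: "integrable lebesgue (indicator U :: 'a \<Rightarrow> real)" if "U \<in> lmeasurable" for U
    using that by (simp add: integrable_on_indicator lmeasurable_iff_integrable)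
  have c1: "c *\<^sub>R ind U \<in> closure K" if U: "U \<in> \<U>" for c U
  proof -
    have q: "q *\<^sub>R ind U \<in> K" if "q \<in> \<rat>" for q
      using s_K[of "[(U, q)]"] U that by (simp add: s_def)
    have "\<exists>q\<in>\<rat>. dist q c < e" if "e > 0" for e
      using Rats_dense_in_real[of c "c + e"] that by (force simp: dist_real_def)
    then have "c \<in> closure \<rat>" by (simp add: closure_approachable)
    then obtain qn where "\<And>n. qn n \<in> \<rat>" "qn \<longlonglongrightarrow> c"
      unfolding closure_sequential by blast
    then show ?thesis
      unfolding closure_sequential
      by (intro exI[of _ "\<lambda>n. qn n *\<^sub>R ind U"]) (auto intro!: q tendsto_intros)
  qed
  have c2: "c *\<^sub>R ind V \<in> closure K" if V: "open V" "V \<in> lmeasurable" for c V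
  proof -
    obtain B' where B': "B' \<subseteq> B" "\<Union>B' = V"
      using B(2) V(1) unfolding topological_basis_def by blast
    define U where "U n = \<Union>{b \<in> B'. to_nat_on B' b < n}" for n
    have cB': "countable B'" using B' B countable_subset by blast
    have fin: "finite {b \<in> B'. to_nat_on B' b < n}" for n
      using inj_on_to_nat_on[OF cB']
      by (intro inj_on_finite[of "to_nat_on B'" _ "{..<n}"]) (auto intro: inj_on_subset)
    have "open (U n)" for n
      using B B' unfolding U_def topological_basis_def by auto
    then have Ub: "U n \<in> sets lebesgue" for n
      by (metis borel_open sets_completionI_sets sets_lborel)
    have UV: "U n \<subseteq> V" for n
      using B'(2) unfolding U_def by blast
    have Um: "U n \<in> lmeasurable" for n
      by (rule fmeasurableI2[OF V(2) UV Ub])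
    then have UU: "U n \<in> \<U>" for n
      using fin[of n] B' unfolding \<U>_def U_def by blast
    have "(\<lambda>n. ind (U n)) \<longlonglongrightarrow> ind V"
      unfolding ind_def
    proof (rule tendsto_abs_L1_dominated[where w = "indicator V"])
      show "AE x in lebesgue. (\<lambda>n. indicator (U n) x :: real) \<longlonglongrightarrow> indicator V x"
      proof (rule AE_I2)
        fix x :: 'a
        show "(\<lambda>n. indicator (U n) x :: real) \<longlonglongrightarrow> indicator V x"
        proof (cases "x \<in> V")
          case True
          then obtain b where b: "b \<in> B'" "x \<in> b" using B' by blast
          have "\<forall>n\<ge>Suc (to_nat_on B' b). indicator (U n) x = (indicator V x :: real)"
            using True b by (auto simp: U_def indicator_def)
          then show ?thesis
            by (intro tendsto_eventually eventually_sequentiallyI) blast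
        next
          case False
          then have "x \<notin> U n" for n using B' by (auto simp: U_def)
          with False show ?thesis by simp
        qed
      qed
      show "AE x in lebesgue. \<bar>indicator (U n) x :: real\<bar> \<le> indicator V x" for n
        using B' by (auto simp: U_def indicator_def)
    qed (use V Um int_ind in auto)
    then have "(\<lambda>n. c *\<^sub>R ind (U n)) \<longlonglongrightarrow> c *\<^sub>R ind V" by (intro tendsto_intros)
    then show ?thesis
      using cl_lim[of "\<lambda>n. c *\<^sub>R ind (U n)"] c1[OF UU] by simp
  qed
  have c3: "c *\<^sub>R ind A \<in> closure K" if A: "A \<in> lmeasurable" for c A
  proof -
    have "\<exists>V. open V \<and> A \<subseteq> V \<and> V - A \<in> lmeasurable \<and> measure lebesgue (V - A) < inverse (Suc n)" for n
    proof -
      have "A \<in> sets lebesgue" "inverse (real (Suc n)) > 0" using A by auto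
      from sets_lebesgue_outer_open[OF this] obtain V where
        V: "open V" "A \<subseteq> V" "V - A \<in> lmeasurable" "emeasure lebesgue (V - A) < ennreal (inverse (Suc n))" .
      have "measure lebesgue (V - A) < inverse (Suc n)"
        using V(3,4) by (simp add: emeasure_eq_measure2 ennreal_less_iff)
      with V show ?thesis by blast
    qed
    then obtain V where V: "\<And>n. open (V n)" "\<And>n. A \<subseteq> V n" "\<And>n. V n - A \<in> lmeasurable"
        "\<And>n. measure lebesgue (V n - A) < inverse (Suc n)"
      by metis
    have Vm: "V n \<in> lmeasurable" for n
    proof -
      have "V n = A \<union> (V n - A)" using V(2) by auto
      then show ?thesis using A V(3) by (metis fmeasurable.Un)
    qed
    have "norm (ind (V n) - ind A) \<le> inverse (Suc n)" for n
    proof -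
      have "norm (ind (V n) - ind A) = (\<integral>x. \<bar>indicator (V n) x - indicator A x :: real\<bar> \<partial>lebesgue)"
        using A Vm[of n] by (simp add: ind_def abs_L1_minus norm_abs_L1 int_ind)
      also have "\<dots> = (\<integral>x. indicator (V n - A) x \<partial>lebesgue)"
        using V(2)[of n] by (intro Bochner_Integration.integral_cong) (auto simp: indicator_def)
      also have "\<dots> = measure lebesgue (V n - A)" by simp
      finally show ?thesis using V(4)[of n] by simp
    qed
    then have "(\<lambda>n. ind (V n) - ind A) \<longlonglongrightarrow> 0"
      by (intro Lim_null_comparison[OF _ LIMSEQ_inverse_real_of_nat]) auto
    then have "(\<lambda>n. ind (V n)) \<longlonglongrightarrow> ind A" by (simp add: LIM_zero_iff)
    then have "(\<lambda>n. c *\<^sub>R ind (V n)) \<longlonglongrightarrow> c *\<^sub>R ind A" by (intro tendsto_intros)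
    then show ?thesis
      using cl_lim[of "\<lambda>n. c *\<^sub>R ind (V n)"] c2[OF V(1) Vm] by simp
  qed
  have "abs_L1 f \<in> closure K" if "integrable lebesgue f" for f :: "'a \<Rightarrow> real"
    using that
  proof (induction rule: integrable_induct)
    case (base A c)
    then have "A \<in> lmeasurable" by (simp add: fmeasurable_def)
    then have "c *\<^sub>R ind A = abs_L1 (\<lambda>x. indicator A x *\<^sub>R c)"
      using abs_L1_scaleR[of "indicator A" c] by (simp add: ind_def int_ind mult.commute)
    then show ?case using c3[OF \<open>A \<in> lmeasurable\<close>, of c] by simp
  next
    case (add f g)
    then show ?case using cl_add by (simp add: abs_L1_plus[symmetric])
  next
    case (lim f s)
    have "(\<lambda>i. abs_L1 (s i)) \<longlonglongrightarrow> abs_L1 f"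
      using lim by (intro tendsto_abs_L1_dominated[where w = "\<lambda>x. 2 * \<bar>f x\<bar>"]) auto
    then show ?case
      using cl_lim[of "\<lambda>i. abs_L1 (s i)"] lim by simp
  qed
  then have "closure K = UNIV"
    using integrable_rep_L1 abs_rep_L1 by (metis UNIV_eq_I)
  with \<open>countable K\<close> show ?thesis by blast
qed

instance L1 :: (euclidean_space) second_countable_topology
  using countable_dense_L1 by intro_classes (blast intro: second_countable_if_countable_dense)

text \<open>$L^1(G)$, embedded in $L^1$ of the whole space by extending functions by zero outside \<open>G\<close>.\<close>

definition L1_on :: "'a::euclidean_space set \<Rightarrow> 'a L1 set" where
  "L1_on G = {f. AE x in lebesgue. x \<notin> G \<longrightarrow> rep_L1 f x = 0}"

definition sup_on :: "'a::euclidean_space set \<Rightarrow> 'a L1 \<Rightarrow> ereal" where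
  "sup_on G f = esssup (lebesgue_on G) (\<lambda>x. ereal (rep_L1 f x))"

section \<open>Measurable-convex integrands\<close>

definition proper_fun :: "(real \<Rightarrow> ereal) \<Rightarrow> bool" where
  "proper_fun h \<longleftrightarrow> (\<forall>v. h v \<noteq> -\<infinity>) \<and> (\<exists>v. h v \<noteq> \<infinity>)"

definition lsc_fun :: "(real \<Rightarrow> ereal) \<Rightarrow> bool" where
  "lsc_fun h \<longleftrightarrow> (\<forall>v. h v \<le> Liminf (at v) h)"

text \<open>Only used for functions omitting the value \<open>-\<infinity>\<close>; recall that \<open>0 * \<infinity> = 0\<close> in \<open>ereal\<close>.\<close>

definition convex_fun :: "(real \<Rightarrow> ereal) \<Rightarrow> bool" where
  "convex_fun h \<longleftrightarrow> (\<forall>v w. \<forall>t\<in>{0..1}.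
     h ((1 - t) * v + t * w) \<le> ereal (1 - t) * h v + ereal t * h w)"

definition measurable_convex_integrand :: "'a::euclidean_space set \<Rightarrow> ('a \<Rightarrow> real \<Rightarrow> ereal) \<Rightarrow> bool" where
  "measurable_convex_integrand G \<phi> \<longleftrightarrow>
     (\<forall>x\<in>G. proper_fun (\<phi> x) \<and> lsc_fun (\<phi> x) \<and> convex_fun (\<phi> x)) \<and>
     (\<forall>\<xi>. (\<lambda>x. \<phi> x \<xi>) \<in> borel_measurable (lebesgue_on G))"

definition subgradient :: "('a \<Rightarrow> real \<Rightarrow> ereal) \<Rightarrow> 'a \<Rightarrow> real \<Rightarrow> real set" where
  "subgradient \<phi> x v = {u. \<forall>w. ereal (u * (w - v)) \<le> \<phi> x w - \<phi> x v}"

definition growth_bound :: "('a \<Rightarrow> real \<Rightarrow> real set) \<Rightarrow> real \<Rightarrow> 'a \<Rightarrow> ennreal" where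
  "growth_bound \<beta> C x = Sup {ennreal \<bar>u\<bar> |u v. u \<in> \<beta> x v \<and> \<bar>v\<bar> \<le> C}"

definition in_L2 :: "'a::euclidean_space set \<Rightarrow> ('a \<Rightarrow> ennreal) \<Rightarrow> bool" where
  "in_L2 G M \<longleftrightarrow> M \<in> borel_measurable (lebesgue_on G) \<and> (\<integral>\<^sup>+x. (M x)\<^sup>2 \<partial>lebesgue_on G) < \<infinity>"

section \<open>Operators\<close>

text \<open>A linear operator \<open>A : D \<subseteq> X \<rightarrow> X\<close>; the values of \<open>A\<close> outside \<open>D\<close> are irrelevant.\<close>

definition linear_operator :: "'b::real_vector set \<Rightarrow> 'b set \<Rightarrow> ('b \<Rightarrow> 'b) \<Rightarrow> bool" where
  "linear_operator X D A \<longleftrightarrow> subspace D \<and> D \<subseteq> X \<and> A ` D \<subseteq> X \<and>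
     (\<forall>u\<in>D. \<forall>v\<in>D. A (u + v) = A u + A v) \<and> (\<forall>c. \<forall>u\<in>D. A (c *\<^sub>R u) = c *\<^sub>R A u)"

definition resolvent :: "'b::real_vector set \<Rightarrow> ('b \<Rightarrow> 'b) \<Rightarrow> real \<Rightarrow> 'b \<Rightarrow> 'b" where
  "resolvent D A l = the_inv_into D (\<lambda>v. v + l *\<^sub>R A v)"

definition composed_relation ::
  "'a::euclidean_space set \<Rightarrow> ('a \<Rightarrow> real \<Rightarrow> real set) \<Rightarrow> 'a L1 set \<Rightarrow> ('a L1 \<Rightarrow> 'a L1) \<Rightarrow> 'a L1 \<Rightarrow> 'a L1 set"
  where "composed_relation G \<beta> D A u = {f. u \<in> L1_on G \<and> f \<in> L1_on G \<and>
     (\<exists>z\<in>D. A z = f \<and> (AE x in lebesgue_on G. rep_L1 u x \<in> \<beta> x (rep_L1 z x)))}"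

definition Dom :: "('b \<Rightarrow> 'b set) \<Rightarrow> 'b set" where
  "Dom \<A> = {u. \<A> u \<noteq> {}}"

section \<open>\<open>C\<^sup>0\<close>-solutions\<close>

text \<open>Here \<open>X\<close> is a linear subspace of the normed space \<open>'b\<close>, \<open>\<A>\<close> is a multivalued operator in \<open>X\<close>,
  and \<open>F\<close> is only evaluated on the open interval from \<open>0\<close> to \<open>T\<close>. The discretization consists of
  the points \<open>t 0, \<dots>, t n\<close> and the elements \<open>Fd 1, \<dots>, Fd n\<close>; the step function \<open>s\<close> takes the
  values \<open>sv 0, \<dots>, sv n\<close>.\<close>

definition eps_solution ::
  "'b::real_normed_vector set \<Rightarrow> ('b \<Rightarrow> 'b set) \<Rightarrow> (real \<Rightarrow> 'b) \<Rightarrow> real \<Rightarrow> real \<Rightarrow>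
   nat \<Rightarrow> (nat \<Rightarrow> real) \<Rightarrow> (nat \<Rightarrow> 'b) \<Rightarrow> (real \<Rightarrow> 'b) \<Rightarrow> bool" where
  "eps_solution X \<A> F T \<epsilon> n t Fd s \<longleftrightarrow>
     t 0 = 0 \<and> t n = T \<and>
     (\<forall>j\<in>{1..n}. t (j - 1) < t j \<and> t j - t (j - 1) \<le> \<epsilon> \<and> Fd j \<in> X) \<and>
     (\<Sum>j=1..n. \<integral>\<tau>. norm (F \<tau> - Fd j) \<partial>lebesgue_on {t (j - 1)<..<t j}) < \<epsilon> \<and>
     (\<exists>sv. (\<forall>j\<in>{0..n}. sv j \<in> X) \<and> s (t 0) = sv 0 \<and>
        (\<forall>j\<in>{1..n}. (\<forall>\<tau>\<in>{t (j - 1)<..t j}. s \<tau> = sv j) \<and>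
           Fd j \<in> (\<lambda>f. (sv j - sv (j - 1)) /\<^sub>R (t j - t (j - 1)) + f) ` \<A> (sv j)))"

definition C0_solution ::
  "'b::real_normed_vector set \<Rightarrow> ('b \<Rightarrow> 'b set) \<Rightarrow> (real \<Rightarrow> 'b) \<Rightarrow> real \<Rightarrow> 'b \<Rightarrow> (real \<Rightarrow> 'b) \<Rightarrow> bool" where
  "C0_solution X \<A> F T u0 u \<longleftrightarrow>
     continuous_on {0..T} u \<and> u ` {0..T} \<subseteq> X \<and> u 0 = u0 \<and>
     (\<forall>\<epsilon>>0. \<exists>n t Fd s. eps_solution X \<A> F T \<epsilon> n t Fd s \<and> (\<forall>\<tau>\<in>{0..T}. norm (u \<tau> - s \<tau>) \<le> \<epsilon>))"

end

theory Submission
  imports Defs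
begin

text \<open>The relation \<open>\<A>\<close> is accretive and \<open>I + \<lambda> \<A>\<close> is onto $L^1(G)$, so that well-posedness follows from
  Kobayashi's comparison of two implicit Euler schemes on different grids.

  Accretivity: by linearity and density of the domain, \<open>\<integral> \<alpha> A z \<ge> 0\<close> for every measurable selection
  \<open>\<alpha>\<close> of the sign of \<open>z\<close>. For \<open>u \<in> \<beta> z\<close> and \<open>u' \<in> \<beta> z'\<close>, monotonicity of \<open>\<beta>\<close> allows to choose
  one \<open>\<alpha>\<close> that is a sign of both \<open>z - z'\<close> and \<open>u - u'\<close>.

  Range: for bounded \<open>f\<close> the equation \<open>\<epsilon> z + \<beta>\<^sub>\<mu>(z) + A z = f\<close> with the Yosida approximation \<open>\<beta>\<^sub>\<mu>\<close>
  is a contraction fixed point problem, and hypothesis (c) bounds \<open>z\<close> by \<open>sup |f| / \<epsilon>\<close>. Hence the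
  \<open>\<beta>\<^sub>\<mu>(z)\<close> are bounded in $L^2$ by the growth bound, and testing with differences of solutions shows
  that their $L^2$ norms increase as \<open>\<mu>\<close> decreases and control their distances; so they converge.
  Accretivity and hypothesis (b) then permit \<open>\<epsilon> \<rightarrow> 0\<close> together with the truncation of \<open>f\<close>.\<close>

section \<open>\<open>C\<^sup>0\<close>-solutions for accretive operators\<close>

text \<open>No compactness is assumed, so every limit must come from a Cauchy estimate, and the two
  limits in the range proof need different ones. In L^1, accretivity compares solutions of one and
  the same relation only; the Yosida approximation \<open>(z - P \<mu> z) / \<mu>\<close> lies in
  the graph at \<open>P \<mu> z\<close> rather than at \<open>z\<close>, and the mismatch for two
  values of \<mu> has to be paired with the approximations themselves. This forces a quadratic
  argument: hence the square integrable growth bound, and a second use of (c), by which A is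
  monotone in the L^2 pairing on bounded elements. The term \<epsilon> z makes the fixed point map
  strictly contractive and provides the sup bound on which the quadratic argument rests. That bound
  is lost as \<epsilon> tends to 0, so the second limit uses L^1 estimates only: accretivity makes
  \<open>u\<close> converge, hence A z, and (b) recovers \<open>z\<close>. On the evolution side the
  forcing is merely integrable, while the comparison of two grids needs a modulus of continuity; a
  Lipschitz substitute \<open>H\<close> is therefore inserted, and the true forcing enters through
  integrated distances.\<close>

definition accretive :: "('b::real_normed_vector \<Rightarrow> 'b set) \<Rightarrow> bool" where
  "accretive \<A> \<longleftrightarrow> (\<forall>x y f g l. f \<in> \<A> x \<longrightarrow> g \<in> \<A> y \<longrightarrow> l > 0 \<longrightarrow>
     norm (x - y) \<le> norm (x - y + l *\<^sub>R (f - g)))"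

lemma accretiveD:
  "accretive \<A> \<Longrightarrow> f \<in> \<A> x \<Longrightarrow> g \<in> \<A> y \<Longrightarrow> l > 0 \<Longrightarrow> norm (x - y) \<le> norm (x - y + l *\<^sub>R (f - g))"
  unfolding accretive_def by blast

text \<open>Accretivity is used with \<open>l = h * k / (h + k)\<close>, the value for which
  \<open>l / h + l / k = 1\<close>: the multiples of \<open>x - y\<close> inside the norm then
  cancel, and a convex combination of the two mixed differences is left.\<close>

lemma accretive_two_steps:
  fixes x y x0 y0 F G :: "'b::real_normed_vector"
  assumes acc: "accretive \<A>" and h: "h > 0" and k: "k > 0"
    and x: "F - (x - x0) /\<^sub>R h \<in> \<A> x" and y: "G - (y - y0) /\<^sub>R k \<in> \<A> y"
  shows "norm (x - y) \<le> k / (h + k) * norm (x0 - y) + h / (h + k) * norm (x - y0)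
           + h * k / (h + k) * norm (F - G)"
proof -
  define w where "w = k / (h + k)"
  define w' where "w' = h / (h + k)"
  define l where "l = h * k / (h + k)"
  have l: "l > 0" using h k by (simp add: l_def)
  have ww: "w + w' = 1" using h k by (simp add: w_def w'_def add_divide_distrib[symmetric] add.commute)
  have lh: "l * inverse h = w" "l * inverse k = w'"
    using h k by (auto simp: w_def w'_def l_def field_simps)
  have [simp]: "0 \<le> w" "0 \<le> w'" using h k by (auto simp: w_def w'_def)
  have "x - y + l *\<^sub>R ((F - (x - x0) /\<^sub>R h) - (G - (y - y0) /\<^sub>R k))
      = x - y + l *\<^sub>R (F - G) - w *\<^sub>R (x - x0) + w' *\<^sub>R (y - y0)"
    by (simp add: scaleR_diff_right lh[symmetric] algebra_simps)
  also have "\<dots> = w *\<^sub>R (x0 - y) + w' *\<^sub>R (x - y0) + l *\<^sub>R (F - G) + (1 - (w + w')) *\<^sub>R (x - y)"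
    by (simp add: algebra_simps)
  also have "\<dots> = w *\<^sub>R (x0 - y) + w' *\<^sub>R (x - y0) + l *\<^sub>R (F - G)"
    by (simp add: ww)
  finally have "norm (x - y) \<le> norm (w *\<^sub>R (x0 - y) + w' *\<^sub>R (x - y0) + l *\<^sub>R (F - G))"
    using accretiveD[OF acc x y l] by simp
  also have "\<dots> \<le> norm (w *\<^sub>R (x0 - y)) + norm (w' *\<^sub>R (x - y0)) + norm (l *\<^sub>R (F - G))"
    by (intro order_trans[OF norm_triangle_ineq] add_mono norm_triangle_ineq order_refl)
  also have "\<dots> = w * norm (x0 - y) + w' * norm (x - y0) + l * norm (F - G)"
    using l by simp
  finally show ?thesis by (simp add: w_def w'_def l_def)
qed

text \<open>With parameter \<open>h\<close> the new value cancels against its own difference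
  quotient. Comparison with a fixed pair of the graph supplies the boundary values of the two-grid
  recursion.\<close>

lemma accretive_one_step:
  fixes x y x0 F g :: "'b::real_normed_vector"
  assumes acc: "accretive \<A>" and h: "h > 0"
    and x: "F - (x - x0) /\<^sub>R h \<in> \<A> x" and y: "g \<in> \<A> y"
  shows "norm (x - y) \<le> norm (x0 - y) + h * norm (F - g)"
proof -
  have "norm (x - y) \<le> norm (x - y + h *\<^sub>R ((F - (x - x0) /\<^sub>R h) - g))"
    by (rule accretiveD[OF acc x y h])
  also have "x - y + h *\<^sub>R ((F - (x - x0) /\<^sub>R h) - g) = (x0 - y) + h *\<^sub>R (F - g)"
    using h by (simp add: algebra_simps)
  also have "norm \<dots> \<le> norm (x0 - y) + norm (h *\<^sub>R (F - g))" by (rule norm_triangle_ineq)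
  finally show ?thesis using h by simp
qed

section \<open>Implicit Euler schemes and their comparison on two grids\<close>

definition implicit_euler ::
  "('b::real_normed_vector \<Rightarrow> 'b set) \<Rightarrow> real \<Rightarrow> nat \<Rightarrow> (nat \<Rightarrow> real) \<Rightarrow> (nat \<Rightarrow> 'b) \<Rightarrow> (nat \<Rightarrow> 'b) \<Rightarrow> bool" where
  "implicit_euler \<A> \<epsilon> n t f s \<longleftrightarrow> t 0 = 0 \<and>
     (\<forall>j<n. t j < t (Suc j) \<and> t (Suc j) - t j \<le> \<epsilon> \<and>
        f (Suc j) - (s (Suc j) - s j) /\<^sub>R (t (Suc j) - t j) \<in> \<A> (s (Suc j)))"

lemma implicit_euler_mono:
  assumes "implicit_euler \<A> \<epsilon> n t f s" "i \<le> j" "j \<le> n"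
  shows "t i \<le> t j"
  using assms(2,3)
proof (induction j rule: dec_induct)
  case (step k)
  then have "t k < t (Suc k)" using assms(1) by (simp add: implicit_euler_def)
  with step show ?case by simp
qed simp

lemma implicit_euler_nonneg: "implicit_euler \<A> \<epsilon> n t f s \<Longrightarrow> j \<le> n \<Longrightarrow> 0 \<le> t j"
  using implicit_euler_mono[of \<A> \<epsilon> n t f s 0 j] by (simp add: implicit_euler_def)

text \<open>Summation of the one-step bound, with the forcing split into \<open>f - H\<close> and
  \<open>H\<close>; \<open>K\<close> covers \<open>H\<close> together with the fixed element
  \<open>y\<close>. It is needed when one of two compared schemes is still at its initial
  node.\<close>

lemma implicit_euler_dist_start:
  fixes s :: "nat \<Rightarrow> 'b::real_normed_vector"
  assumes acc: "accretive \<A>" and s: "implicit_euler \<A> \<epsilon> n t f s" and y: "y \<in> \<A> x"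
    and K: "\<And>a. a \<in> {0..t n} \<Longrightarrow> norm (H a) + norm y \<le> K"
    and j: "j \<le> n"
  shows "norm (s j - x) \<le> norm (s 0 - x) + (\<Sum>i<j. (t (Suc i) - t i) * norm (f (Suc i) - H (t (Suc i)))) + K * t j"
  using j
proof (induction j)
  case 0
  then show ?case using s by (simp add: implicit_euler_def)
next
  case (Suc j)
  then have t: "t j < t (Suc j)" and
    e: "f (Suc j) - (s (Suc j) - s j) /\<^sub>R (t (Suc j) - t j) \<in> \<A> (s (Suc j))"
    using s by (auto simp: implicit_euler_def)
  have tj: "t (Suc j) \<in> {0..t n}"
    using implicit_euler_nonneg[OF s Suc.prems] implicit_euler_mono[OF s Suc.prems] by auto
  define h where "h = t (Suc j) - t j"
  have h: "h > 0" using t by (simp add: h_def)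
  have "norm (f (Suc j) - y) \<le> norm (f (Suc j) - H (t (Suc j))) + norm (H (t (Suc j)) - y)"
    using norm_triangle_ineq[of "f (Suc j) - H (t (Suc j))" "H (t (Suc j)) - y"] by simp
  also have "norm (H (t (Suc j)) - y) \<le> K"
    using K[OF tj] norm_triangle_ineq4[of "H (t (Suc j))" y] by linarith
  finally have "h * norm (f (Suc j) - y) \<le> h * (norm (f (Suc j) - H (t (Suc j))) + K)"
    using h by (intro mult_left_mono) auto
  moreover have "norm (s (Suc j) - x) \<le> norm (s j - x) + h * norm (f (Suc j) - y)"
    using accretive_one_step[OF acc h e[folded h_def] y] .
  moreover have "norm (s j - x) \<le> norm (s 0 - x) + (\<Sum>i<j. (t (Suc i) - t i) * norm (f (Suc i) - H (t (Suc i)))) + K * t j"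
    using Suc by simp
  ultimately show ?case
    by (simp add: h_def algebra_simps)
qed

text \<open>The weight \<open>P\<close> below replaces the square root in Kobayashi's estimate by the quadratic
  function \<open>Q (a, b) = (a - b)\<^sup>2 + \<epsilon> a + \<epsilon>' b\<close>, using \<open>2 \<surd>Q \<le> \<eta> + Q / \<eta>\<close>; the point is that
  \<open>Q\<close> is an exact supersolution of the two-parameter recursion of \<open>accretive_two_steps\<close>.\<close>

lemma kobayashi_estimate:
  fixes s s' :: "nat \<Rightarrow> 'b::real_normed_vector"
  assumes acc: "accretive \<A>"
    and s: "implicit_euler \<A> \<epsilon> n t f s" and s': "implicit_euler \<A> \<epsilon>' n' t' f' s'"
    and tT: "t n \<le> T" "t' n' \<le> T" and y: "y \<in> \<A> x"
    and K: "\<And>a. a \<in> {0..T} \<Longrightarrow> norm (H a) + norm y \<le> K" and K0: "K \<ge> 0"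
    and L: "\<And>a b. a \<in> {0..T} \<Longrightarrow> b \<in> {0..T} \<Longrightarrow> norm (H a - H b) \<le> L * \<bar>a - b\<bar>" and L0: "L \<ge> 0"
    and eps: "\<epsilon> \<ge> 0" "\<epsilon>' \<ge> 0" and \<eta>: "\<eta> > 0"
    and j: "j \<le> n" and k: "k \<le> n'"
  shows "norm (s j - s' k) \<le> norm (s 0 - x) + norm (s' 0 - x)
     + (\<Sum>i<j. (t (Suc i) - t i) * norm (f (Suc i) - H (t (Suc i))))
     + (\<Sum>i<k. (t' (Suc i) - t' i) * norm (f' (Suc i) - H (t' (Suc i))))
     + (K + L * t j) * (\<epsilon> + \<eta> + ((t j - t' k)\<^sup>2 + \<epsilon> * t j + \<epsilon>' * t' k) / \<eta>)"
proof -
  define E where "E j = (\<Sum>i<j. (t (Suc i) - t i) * norm (f (Suc i) - H (t (Suc i))))" for j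
  define E' where "E' k = (\<Sum>i<k. (t' (Suc i) - t' i) * norm (f' (Suc i) - H (t' (Suc i))))" for k
  \<comment> \<open>The leading \<epsilon> lets \<open>P (t i) b\<close> dominate
    \<open>\<bar>a - b\<bar>\<close>, although \<open>a = t i + h\<close> is one step
    further.\<close>
  define P where "P a b = \<epsilon> + \<eta> + ((a - b)\<^sup>2 + \<epsilon> * a + \<epsilon>' * b) / \<eta>" for a b
  define C where "C = norm (s 0 - x) + norm (s' 0 - x)"
  have Pge: "\<bar>a - b\<bar> + \<epsilon> \<le> P a b" if "a \<ge> 0" "b \<ge> 0" for a b
  proof -
    have "0 \<le> \<eta>\<^sup>2 + \<bar>a - b\<bar>\<^sup>2 - 2 * \<eta> * \<bar>a - b\<bar>"
      unfolding power2_diff[symmetric] by (rule zero_le_power2)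
    then have "2 * \<bar>a - b\<bar> * \<eta> \<le> \<eta> * \<eta> + (a - b)\<^sup>2"
      by (simp add: power2_eq_square algebra_simps)
    then have "2 * \<bar>a - b\<bar> \<le> \<eta> + (a - b)\<^sup>2 / \<eta>"
      using \<eta> by (simp add: field_simps)
    moreover have "(a - b)\<^sup>2 / \<eta> \<le> ((a - b)\<^sup>2 + \<epsilon> * a + \<epsilon>' * b) / \<eta>"
      using \<eta> eps that by (intro divide_right_mono) auto
    ultimately have "2 * \<bar>a - b\<bar> \<le> \<eta> + ((a - b)\<^sup>2 + \<epsilon> * a + \<epsilon>' * b) / \<eta>" by (rule order_trans[OF _ add_left_mono])
    then have "\<bar>a - b\<bar> \<le> \<eta> + ((a - b)\<^sup>2 + \<epsilon> * a + \<epsilon>' * b) / \<eta>"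
      by (rule order_trans[rotated]) simp
    then show ?thesis unfolding P_def by simp
  qed
  have "norm (s j - s' k) \<le> C + E j + E' k + (K + L * t j) * P (t j) (t' k)"
    if "j \<le> n" "k \<le> n'" for j k
    using that
  proof (induction "j + k" arbitrary: j k rule: less_induct)
    case less
    note t0 = implicit_euler_nonneg[OF s] implicit_euler_nonneg[OF s']
    consider "j = 0" | "k = 0" | j' k' where "j = Suc j'" "k = Suc k'"
      by (cases j; cases k) auto
    then show ?case
    proof cases
      case 1
      have "norm (s' k - x) \<le> norm (s' 0 - x) + E' k + K * t' k"
        unfolding E'_def
        by (rule implicit_euler_dist_start[OF acc s' y]) (use less.prems K tT in auto)
      moreover have "norm (s 0 - s' k) \<le> norm (s 0 - x) + norm (s' k - x)"
        using norm_triangle_ineq4[of "s 0 - x" "s' k - x"] by simp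
      moreover have "t 0 = 0" using s by (simp add: implicit_euler_def)
      moreover have "K * t' k \<le> K * P 0 (t' k)"
        using Pge[of 0 "t' k"] t0(2)[OF less.prems(2)] eps K0 by (intro mult_left_mono) auto
      ultimately show ?thesis using 1 by (simp add: C_def E_def)
    next
      case 2
      have "norm (s j - x) \<le> norm (s 0 - x) + E j + K * t j"
        unfolding E_def
        by (rule implicit_euler_dist_start[OF acc s y]) (use less.prems K tT in auto)
      moreover have "norm (s j - s' 0) \<le> norm (s j - x) + norm (s' 0 - x)"
        using norm_triangle_ineq4[of "s j - x" "s' 0 - x"] by simp
      moreover have "t' 0 = 0" using s' by (simp add: implicit_euler_def)
      moreover have "K * t j \<le> (K + L * t j) * P (t j) 0"
        using Pge[of "t j" 0] t0(1)[OF less.prems(1)] eps K0 L0 by (intro mult_mono) auto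
      ultimately show ?thesis using 2 by (simp add: C_def E'_def)
    next
      case (3 i l)
      define h where "h = t (Suc i) - t i"
      define h' where "h' = t' (Suc l) - t' l"
      have hp: "h > 0" "h \<le> \<epsilon>" "h' > 0" "h' \<le> \<epsilon>'"
        using s s' 3 less.prems by (auto simp: implicit_euler_def h_def h'_def)
      have st: "f (Suc i) - (s (Suc i) - s i) /\<^sub>R h \<in> \<A> (s (Suc i))"
        "f' (Suc l) - (s' (Suc l) - s' l) /\<^sub>R h' \<in> \<A> (s' (Suc l))"
        using s s' 3 less.prems by (auto simp: implicit_euler_def h_def h'_def)
      define w where "w = h' / (h + h')"
      define w' where "w' = h / (h + h')"
      have ww: "w + w' = 1" "w \<ge> 0" "w' \<ge> 0"
        using hp by (auto simp: w_def w'_def add_divide_distrib[symmetric] add.commute)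
      have wh: "w * h = h * h' / (h + h')" "w' * h' = w * h"
        using hp by (auto simp: w_def w'_def field_simps)
      define a where "a = t (Suc i)"
      define b where "b = t' (Suc l)"
      define d where "d = norm (f (Suc i) - H a)"
      define d' where "d' = norm (f' (Suc l) - H b)"
      have ta: "t i = a - h" "t' l = b - h'" by (auto simp: a_def b_def h_def h'_def)
      have ti: "t i \<ge> 0" "t' l \<ge> 0" "a \<ge> 0" "b \<ge> 0"
        using t0(1)[of i] t0(1)[of j] t0(2)[of l] t0(2)[of k] less.prems 3 by (auto simp: a_def b_def)
      have aT: "a \<in> {0..T}" "b \<in> {0..T}"
        using implicit_euler_mono[OF s, of j n] implicit_euler_mono[OF s', of k n'] less.prems 3 ti tT
        by (auto simp: a_def b_def)
      have Ej: "E (Suc i) = E i + h * d" "E' (Suc l) = E' l + h' * d'"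
        by (simp_all add: E_def E'_def h_def h'_def d_def d'_def a_def b_def)
      have IH1: "norm (s i - s' (Suc l)) \<le> C + E i + E' (Suc l) + (K + L * t i) * P (t i) b"
        using less.hyps[of i "Suc l"] less.prems 3 by (simp add: b_def)
      have IH2: "norm (s (Suc i) - s' l) \<le> C + E (Suc i) + E' l + (K + L * a) * P a (t' l)"
        using less.hyps[of "Suc i" l] less.prems 3 by (simp add: a_def)
      have Q: "w * P (t i) b + w' * P a (t' l) \<le> P a b"
      proof -
        \<comment> \<open>As \<open>w * h = w' * h'\<close>, the terms linear in
          \<open>a - b\<close> cancel; what is left is \<open>w * h\<close> times
          \<open>(h - \<epsilon>) + (h' - \<epsilon>')\<close>, nonpositive by the mesh
          bounds.\<close>
        have "w * ((a - h - b)\<^sup>2 + \<epsilon> * (a - h) + \<epsilon>' * b) + w' * ((a - (b - h'))\<^sup>2 + \<epsilon> * a + \<epsilon>' * (b - h'))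
          = (w + w') * ((a - b)\<^sup>2 + \<epsilon> * a + \<epsilon>' * b)
            + 2 * (a - b) * (w' * h' - w * h) + (w * h) * h + (w' * h') * h' - \<epsilon> * (w * h) - \<epsilon>' * (w' * h')"
          by (simp add: power2_eq_square algebra_simps)
        also have "\<dots> = ((a - b)\<^sup>2 + \<epsilon> * a + \<epsilon>' * b) + (w * h) * ((h - \<epsilon>) + (h' - \<epsilon>'))"
          unfolding wh(2) ww by (simp add: algebra_simps)
        also have "\<dots> \<le> (a - b)\<^sup>2 + \<epsilon> * a + \<epsilon>' * b"
          using hp ww mult_nonneg_nonpos[of "w * h" "(h - \<epsilon>) + (h' - \<epsilon>')"] by simp
        finally have "(w * ((t i - b)\<^sup>2 + \<epsilon> * t i + \<epsilon>' * b) + w' * ((a - t' l)\<^sup>2 + \<epsilon> * a + \<epsilon>' * t' l)) / \<eta>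
            \<le> ((a - b)\<^sup>2 + \<epsilon> * a + \<epsilon>' * b) / \<eta>"
          using \<eta> unfolding ta by (intro divide_right_mono) auto
        moreover have "w * P (t i) b + w' * P a (t' l) = (w + w') * (\<epsilon> + \<eta>) +
            (w * ((t i - b)\<^sup>2 + \<epsilon> * t i + \<epsilon>' * b) + w' * ((a - t' l)\<^sup>2 + \<epsilon> * a + \<epsilon>' * t' l)) / \<eta>"
          unfolding P_def by (simp add: algebra_simps add_divide_distrib)
        ultimately show ?thesis unfolding ww P_def[of a b] by simp
      qed
      have "norm (f (Suc i) - f' (Suc l)) \<le> norm (f (Suc i) - H a) + norm (H a - f' (Suc l))"
        using norm_triangle_ineq[of "f (Suc i) - H a" "H a - f' (Suc l)"] by simp
      also have "norm (H a - f' (Suc l)) \<le> norm (H a - H b) + norm (H b - f' (Suc l))"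
        using norm_triangle_ineq[of "H a - H b" "H b - f' (Suc l)"] by simp
      also have "norm (H a - H b) \<le> L * P (t i) b"
      proof -
        have "\<bar>a - b\<bar> \<le> \<bar>t i - b\<bar> + \<epsilon>" using ta hp by linarith
        also have "\<dots> \<le> P (t i) b" using Pge ti by simp
        finally have "L * \<bar>a - b\<bar> \<le> L * P (t i) b" using L0 by (rule mult_left_mono)
        then show ?thesis using L[OF aT] by linarith
      qed
      finally have ff: "norm (f (Suc i) - f' (Suc l)) \<le> d + d' + L * P (t i) b"
        by (simp add: d_def d'_def norm_minus_commute)
      have "norm (s (Suc i) - s' (Suc l)) \<le> w * norm (s i - s' (Suc l)) + w' * norm (s (Suc i) - s' l)
           + w * h * norm (f (Suc i) - f' (Suc l))"
        using accretive_two_steps[OF acc hp(1,3) st] unfolding w_def[symmetric] w'_def[symmetric] wh(1)[symmetric] .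
      also have "\<dots> \<le> w * (C + E i + E' (Suc l) + (K + L * t i) * P (t i) b)
          + w' * (C + E (Suc i) + E' l + (K + L * a) * P a (t' l)) + w * h * (d + d' + L * P (t i) b)"
        using ww hp by (intro add_mono mult_left_mono IH1 IH2 ff) auto
      \<comment> \<open>The weight \<open>K + L * t\<close> grows by \<open>L * h\<close> from
        \<open>t i\<close> to \<open>a\<close>, which absorbs the Lipschitz error
        \<open>w * h * L * P (t i) b\<close> exactly. Likewise \<open>w * h = w' * h'\<close>
        completes the forcing sums to \<open>E (Suc i)\<close> and
        \<open>E' (Suc l)\<close>.\<close>
      also have "\<dots> = (w + w') * (C + E i + E' l) + w * (h' * d') + w' * (h * d)
          + (K + L * a) * (w * P (t i) b + w' * P a (t' l)) + w * h * d + w * h * d'"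
        unfolding Ej ta by (simp add: algebra_simps)
      also have "w * h * d' = w' * h' * d'" using wh(2) by simp
      also have "(w + w') * (C + E i + E' l) + w * (h' * d') + w' * (h * d)
          + (K + L * a) * (w * P (t i) b + w' * P a (t' l)) + w * h * d + w' * h' * d'
        = (w + w') * (C + E (Suc i) + E' (Suc l)) + (K + L * a) * (w * P (t i) b + w' * P a (t' l))"
        unfolding Ej by (simp add: algebra_simps)
      also have "\<dots> \<le> C + E (Suc i) + E' (Suc l) + (K + L * a) * P a b"
        using Q K0 L0 ti by (simp add: ww mult_left_mono)
      finally show ?thesis unfolding 3 a_def b_def .
    qed
  qed
  from this[OF j k] show ?thesis by (simp add: C_def E_def E'_def P_def)
qed

section \<open>Integrals over subintervals and Lipschitz approximation of the forcing\<close>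

lemma integrable_lebesgue_on_subset:
  fixes f :: "'a::euclidean_space \<Rightarrow> 'b::{banach, second_countable_topology}"
  assumes "integrable (lebesgue_on S) f" "U \<subseteq> S" "U \<in> sets lebesgue" "S \<in> sets lebesgue"
  shows "integrable (lebesgue_on U) f"
  using set_integrable_subset[of lebesgue S f U] assms
  by (simp add: integrable_restrict_space set_integrable_def)

text \<open>Superadditivity in the domain is what the grid sums use; with \<open>V = {}\<close> it
  becomes monotonicity in the domain.\<close>

lemma integral_lebesgue_on_disjoint_le:
  fixes f :: "'a::euclidean_space \<Rightarrow> real"
  assumes f: "integrable (lebesgue_on S) f" "\<And>x. 0 \<le> f x"
    and U: "U \<subseteq> S" "U \<in> sets lebesgue" and V: "V \<subseteq> S" "V \<in> sets lebesgue"
    and S: "S \<in> sets lebesgue" and disj: "U \<inter> V = {}"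
  shows "(\<integral>x. f x \<partial>lebesgue_on U) + (\<integral>x. f x \<partial>lebesgue_on V) \<le> (\<integral>x. f x \<partial>lebesgue_on S)"
proof -
  have i: "integrable lebesgue (\<lambda>x. indicator W x *\<^sub>R f x)" if "W \<subseteq> S" "W \<in> sets lebesgue" for W
    using integrable_lebesgue_on_subset[OF f(1) that S] that by (simp add: integrable_restrict_space)
  have "(\<integral>x. indicator U x *\<^sub>R f x \<partial>lebesgue) + (\<integral>x. indicator V x *\<^sub>R f x \<partial>lebesgue)
     = (\<integral>x. indicator U x *\<^sub>R f x + indicator V x *\<^sub>R f x \<partial>lebesgue)"
    using i U V by simp
  also have "\<dots> \<le> (\<integral>x. indicator S x *\<^sub>R f x \<partial>lebesgue)"
    using i[OF U] i[OF V] i[OF order_refl S] U V disj f(2)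
    by (intro integral_mono) (auto simp: indicator_def)
  finally show ?thesis using U V S by (simp add: integral_restrict_space)
qed

lemma integrable_lebesgue_on_norm_diff:
  fixes F :: "real \<Rightarrow> 'b::{banach, second_countable_topology}"
  assumes F: "integrable (lebesgue_on {0<..<T}) F" and H: "continuous_on {0<..<T} H"
    and B: "\<And>x. x \<in> {0<..<T} \<Longrightarrow> norm (H x) \<le> B" and ab: "0 \<le> a" "b \<le> T"
  shows "integrable (lebesgue_on {a<..<b}) (\<lambda>x. norm (F x - H x))"
proof -
  have "finite_measure (lebesgue_on {0<..<T})"
    by (rule finite_measure_lebesgue_on) simp
  then have "integrable (lebesgue_on {0<..<T}) H"
    using B by (intro finite_measure.integrable_const_bound[where B = B] AE_I2
        continuous_imp_measurable_on_sets_lebesgue[OF H]) auto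
  then have "integrable (lebesgue_on {0<..<T}) (\<lambda>x. norm (F x - H x))"
    using F by auto
  then show ?thesis
    by (rule integrable_lebesgue_on_subset) (use ab in auto)
qed

lemma
  fixes H :: "real \<Rightarrow> 'b::real_normed_vector"
  assumes L: "L \<ge> 0" "\<And>a b. norm (H a - H b) \<le> L * \<bar>a - b\<bar>"
  shows continuous_on_real_lipschitz: "continuous_on S H"
    and norm_real_lipschitz_le: "x \<in> {0..T} \<Longrightarrow> norm (H x) \<le> norm (H 0) + L * T"
proof -
  have "L-lipschitz_on UNIV H"
    using L by (intro lipschitz_onI) (auto simp: dist_norm)
  then show "continuous_on S H"
    using continuous_on_subset[OF lipschitz_on_continuous_on] by blast
  assume x: "x \<in> {0..T}"
  have "norm (H x) \<le> norm (H 0) + norm (H x - H 0)"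
    using norm_triangle_ineq[of "H 0" "H x - H 0"] by simp
  also have "norm (H x - H 0) \<le> L * \<bar>x - 0\<bar>" by (rule L)
  also have "\<dots> \<le> L * T" using x L by (intro mult_left_mono) auto
  finally show "norm (H x) \<le> norm (H 0) + L * T" by simp
qed

text \<open>Approximability passes to sums and to L^1 limits, so induction over integrable functions
  reduces the claim to multiples of indicators; inner regularity then leaves closed sets, whose
  indicators are limits of functions of the distance. The two-grid estimate compares
  \<open>H\<close> at unrelated nodes, and the Lipschitz bound controls this by their
  distance.\<close>

lemma lipschitz_dense_integrable:
  fixes F :: "real \<Rightarrow> 'b::{banach, second_countable_topology}"
  assumes "integrable (lebesgue_on {0<..<T}) F" "e > 0"
  shows "\<exists>H L. L \<ge> 0 \<and> (\<forall>a b. norm (H a - H b) \<le> L * \<bar>a - b\<bar>) \<and>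
    (\<integral>x. norm (F x - H x) \<partial>lebesgue_on {0<..<T}) < e"
proof -
  define M where "M = lebesgue_on {0<..<T}"
  define lip where "lip H L \<longleftrightarrow> L \<ge> 0 \<and> (\<forall>a b. norm (H a - H b) \<le> L * \<bar>a - b\<bar>)" for H :: "real \<Rightarrow> 'b" and L
  define appr where "appr F \<longleftrightarrow> (\<forall>e>0. \<exists>H L. lip H L \<and> (\<integral>x. norm (F x - H x) \<partial>M) < e)" for F :: "real \<Rightarrow> 'b"
  interpret finite_measure M unfolding M_def by (rule finite_measure_lebesgue_on) simp
  have sp: "space M = {0<..<T}" by (simp add: M_def)
  have lipcont: "continuous_on S H" if "lip H L" for H L S
    using that unfolding lip_def by (intro continuous_on_real_lipschitz) auto
  have meas: "H \<in> borel_measurable M" if "continuous_on {0<..<T} H" for H :: "real \<Rightarrow> 'b"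
    unfolding M_def using that by (rule continuous_imp_measurable_on_sets_lebesgue) simp
  have lipint: "integrable M H" if "lip H L" for H L
  proof (rule integrable_const_bound[where B = "norm (H 0) + L * T"])
    show "H \<in> borel_measurable M" by (rule meas[OF lipcont[OF that]])
    show "AE x in M. norm (H x) \<le> norm (H 0) + L * T"
    proof (rule AE_I2)
      fix x assume "x \<in> space M"
      then have x: "0 < x" "x < T" by (auto simp: sp)
      show "norm (H x) \<le> norm (H 0) + L * T"
        by (rule norm_real_lipschitz_le) (use that x in \<open>auto simp: lip_def\<close>)
    qed
  qed
  have tri: "(\<integral>x. norm (F x - H x) \<partial>M) \<le> (\<integral>x. norm (F x - F' x) \<partial>M) + (\<integral>x. norm (F' x - H x) \<partial>M)"
    if i: "integrable M F" "integrable M F'" "integrable M H" for F F' H :: "real \<Rightarrow> 'b"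
  proof -
    have "(\<integral>x. norm (F x - H x) \<partial>M) \<le> (\<integral>x. norm (F x - F' x) + norm (F' x - H x) \<partial>M)"
    proof (rule integral_mono)
      show "norm (F x - H x) \<le> norm (F x - F' x) + norm (F' x - H x)" for x
        using norm_triangle_ineq[of "F x - F' x" "F' x - H x"] by simp
    qed (use i in auto)
    then show ?thesis using i by simp
  qed
  have appr_trans: "appr F"
    if F: "integrable M F" and ap: "\<And>e. e > 0 \<Longrightarrow> \<exists>F'. integrable M F' \<and> appr F' \<and> (\<integral>x. norm (F x - F' x) \<partial>M) < e"
    for F
    unfolding appr_def
  proof (intro allI impI)
    fix e :: real assume "e > 0"
    then obtain F' where F': "integrable M F'" "appr F'" "(\<integral>x. norm (F x - F' x) \<partial>M) < e / 2"
      using ap[of "e / 2"] by auto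
    obtain H L where H: "lip H L" "(\<integral>x. norm (F' x - H x) \<partial>M) < e / 2"
      using F'(2) \<open>e > 0\<close> unfolding appr_def by (meson half_gt_zero)
    have "(\<integral>x. norm (F x - H x) \<partial>M) < e"
      using tri[OF F F'(1) lipint[OF H(1)]] F'(3) H(2) by linarith
    then show "\<exists>H L. lip H L \<and> (\<integral>x. norm (F x - H x) \<partial>M) < e" using H(1) by blast
  qed
  have appr_closed: "appr (\<lambda>x. indicator K x *\<^sub>R c)" if K: "closed K" for K c
  proof (cases "K = {}")
    case True
    have "lip (\<lambda>x. 0) 0" by (simp add: lip_def)
    then show ?thesis unfolding appr_def True by (intro allI impI exI[of _ "\<lambda>x. 0"] exI[of _ 0]) auto
  next
    case False
    \<comment> \<open>Equal to \<open>c\<close> on \<open>K\<close> and, for \<open>n > 0\<close>,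
      decaying linearly to 0 at distance \<open>1 / n\<close>. As \<open>K\<close> is closed, a
      point outside has positive distance, so its values are eventually 0.\<close>
    define H where "H n x = max 0 (1 - real n * infdist x K) *\<^sub>R c" for n x
    have lipH: "lip (H n) (real n * norm c)" for n
    proof -
      have "norm (H n a - H n b) \<le> real n * norm c * \<bar>a - b\<bar>" for a b
      proof -
        have "\<bar>max 0 (1 - real n * infdist a K) - max 0 (1 - real n * infdist b K)\<bar>
          \<le> \<bar>real n * infdist a K - real n * infdist b K\<bar>" by linarith
        also have "\<dots> = real n * \<bar>infdist a K - infdist b K\<bar>"
          by (simp add: right_diff_distrib[symmetric] abs_mult)
        also have "\<dots> \<le> real n * \<bar>a - b\<bar>"
          using infdist_triangle_abs[of a K b] by (intro mult_left_mono) (auto simp: dist_real_def)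
        finally have "\<bar>max 0 (1 - real n * infdist a K) - max 0 (1 - real n * infdist b K)\<bar> * norm c
            \<le> real n * \<bar>a - b\<bar> * norm c"
          by (rule mult_right_mono) simp
        then show ?thesis by (simp add: H_def scaleR_diff_left[symmetric] mult.commute mult.left_commute)
      qed
      then show ?thesis by (simp add: lip_def)
    qed
    have "(\<lambda>n. \<integral>x. norm (indicator K x *\<^sub>R c - H n x) \<partial>M) \<longlonglongrightarrow> (\<integral>x. 0 \<partial>M)"
    proof (rule integral_dominated_convergence[where w = "\<lambda>x. norm c"])
      have H: "H n \<in> borel_measurable M" for n by (rule meas[OF lipcont[OF lipH]])
      have "(\<lambda>x. indicator K x *\<^sub>R c) \<in> borel_measurable lebesgue"
        using K by (intro borel_measurable_scaleR borel_measurable_indicator) auto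
      then have "(\<lambda>x. indicator K x *\<^sub>R c) \<in> borel_measurable M"
        unfolding M_def by (rule measurable_restrict_space1)
      with H show "(\<lambda>x. norm (indicator K x *\<^sub>R c - H n x)) \<in> borel_measurable M" for n
        by auto
      show "AE x in M. (\<lambda>n. norm (indicator K x *\<^sub>R c - H n x)) \<longlonglongrightarrow> 0"
      proof (rule AE_I2)
        fix x
        show "(\<lambda>n. norm (indicator K x *\<^sub>R c - H n x)) \<longlonglongrightarrow> 0"
        proof (cases "x \<in> K")
          case True
          then show ?thesis by (simp add: H_def)
        next
          case xK: False
          then have d: "infdist x K > 0"
            using K False by (simp add: infdist_pos_not_in_closed)
          obtain N where N: "1 / infdist x K < real N" using reals_Archimedean2 by blast
          have "norm (indicator K x *\<^sub>R c - H n x) = 0" if "n \<ge> N" for n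
          proof -
            have "1 / infdist x K < real n" using N that by linarith
            then have "1 - real n * infdist x K \<le> 0" using d by (simp add: field_simps)
            then show ?thesis using xK by (simp add: H_def max_def)
          qed
          then show ?thesis by (intro tendsto_eventually eventually_sequentiallyI)
        qed
      qed
      show "AE x in M. norm (norm (indicator K x *\<^sub>R c - H n x)) \<le> norm c" for n
      proof (rule AE_I2)
        fix x
        have "0 \<le> infdist x K" by (rule infdist_nonneg)
        then have "\<bar>indicator K x - max 0 (1 - real n * infdist x K)\<bar> \<le> 1"
          by (auto simp: indicator_def max_def)
        then have "\<bar>indicator K x - max 0 (1 - real n * infdist x K)\<bar> * norm c \<le> 1 * norm c"
          by (rule mult_right_mono) simp
        then show "norm (norm (indicator K x *\<^sub>R c - H n x)) \<le> norm c"
          by (simp add: H_def scaleR_diff_left[symmetric])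
      qed
    qed simp_all
    then have lim: "(\<lambda>n. \<integral>x. norm (indicator K x *\<^sub>R c - H n x) \<partial>M) \<longlonglongrightarrow> 0" by simp
    show ?thesis unfolding appr_def
    proof (intro allI impI)
      fix e :: real assume "e > 0"
      from order_tendstoD(2)[OF lim this] obtain n where
        "(\<integral>x. norm (indicator K x *\<^sub>R c - H n x) \<partial>M) < e"
        by (auto dest: eventually_happens)
      then show "\<exists>H L. lip H L \<and> (\<integral>x. norm (indicator K x *\<^sub>R c - H x) \<partial>M) < e" using lipH by blast
    qed
  qed
  have "appr F" using assms(1) unfolding M_def[symmetric]
  proof (induction rule: integrable_induct)
    case (base A c)
    have A: "A \<in> sets lebesgue" "A \<subseteq> {0<..<T}"
      using base(1) by (auto simp: M_def sets_restrict_space)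
    show ?case
    proof (rule appr_trans)
      show "integrable M (\<lambda>x. indicator A x *\<^sub>R c)"
        using base by (simp add: integrable_scaleR_left)
      fix e :: real assume e: "e > 0"
      define d where "d = e / (norm c + 1)"
      have d: "d > 0" using e by (simp add: d_def add_nonneg_pos)
      obtain K where K: "closed K" "K \<subseteq> A" "A - K \<in> lmeasurable" "emeasure lebesgue (A - K) < ennreal d"
        using sets_lebesgue_inner_closed[OF A(1) d] by metis
      have "K \<in> sets lebesgue" using K(1) by auto
      moreover have "K \<subseteq> {0<..<T}" using K(2) A(2) by blast
      ultimately have KM: "K \<in> sets M" by (simp add: M_def sets_restrict_space_iff)
      have AKM: "A - K \<in> sets M" using KM base by auto
      have "measure M (A - K) = measure lebesgue (A - K)"
        unfolding M_def by (rule measure_restrict_space) (use A in auto)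
      also have "\<dots> < d" using K(3,4) d by (simp add: emeasure_eq_measure2 ennreal_less_iff)
      finally have m: "measure M (A - K) < d" .
      have "(\<integral>x. norm (indicator A x *\<^sub>R c - indicator K x *\<^sub>R c) \<partial>M) = (\<integral>x. indicator (A - K) x * norm c \<partial>M)"
        using K(2) by (intro Bochner_Integration.integral_cong) (auto simp: indicator_def)
      also have "\<dots> = measure M (A - K) * norm c" using AKM by simp
      also have "\<dots> \<le> d * norm c" using m by (intro mult_right_mono) auto
      also have "d * norm c < d * (norm c + 1)" using d by simp
      also have "\<dots> = e" using add_nonneg_pos[of "norm c" 1] by (simp add: d_def)
      finally show "\<exists>F'. integrable M F' \<and> appr F' \<and> (\<integral>x. norm (indicator A x *\<^sub>R c - F' x) \<partial>M) < e"
        using appr_closed[OF K(1)] KM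
        by (intro exI[of _ "\<lambda>x. indicator K x *\<^sub>R c"]) (auto simp: less_top[symmetric] intro!: integrable_scaleR_left)
    qed
  next
    case (add f g)
    show ?case unfolding appr_def
    proof (intro allI impI)
      fix e :: real assume "e > 0"
      then obtain H L H' L' where H: "lip H L" "(\<integral>x. norm (f x - H x) \<partial>M) < e / 2"
        "lip H' L'" "(\<integral>x. norm (g x - H' x) \<partial>M) < e / 2"
        using add.IH unfolding appr_def by (meson half_gt_zero)
      have "norm (H a + H' a - (H b + H' b)) \<le> (L + L') * \<bar>a - b\<bar>" for a b
      proof -
        have "norm (H a + H' a - (H b + H' b)) \<le> norm (H a - H b) + norm (H' a - H' b)"
          using norm_triangle_ineq[of "H a - H b" "H' a - H' b"] by (simp add: algebra_simps)
        also have "\<dots> \<le> L * \<bar>a - b\<bar> + L' * \<bar>a - b\<bar>"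
          using H(1,3) unfolding lip_def by (intro add_mono) auto
        finally show ?thesis by (simp add: distrib_right)
      qed
      then have l: "lip (\<lambda>x. H x + H' x) (L + L')" using H(1,3) by (simp add: lip_def)
      have "(\<integral>x. norm (f x + g x - (H x + H' x)) \<partial>M) \<le> (\<integral>x. norm (f x - H x) + norm (g x - H' x) \<partial>M)"
      proof (rule integral_mono)
        show "norm (f x + g x - (H x + H' x)) \<le> norm (f x - H x) + norm (g x - H' x)" for x
          using norm_triangle_ineq[of "f x - H x" "g x - H' x"] by (simp add: algebra_simps)
      qed (use add lipint[OF H(1)] lipint[OF H(3)] in auto)
      also have "\<dots> < e"
        using add lipint[OF H(1)] lipint[OF H(3)] H by simp
      finally show "\<exists>H L. lip H L \<and> (\<integral>x. norm (f x + g x - H x) \<partial>M) < e" using l by blast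
    qed
  next
    case (lim f s)
    show ?case
    proof (rule appr_trans[OF lim.hyps(4)])
      fix e :: real assume e: "e > 0"
      have "(\<lambda>n. \<integral>x. norm (f x - s n x) \<partial>M) \<longlonglongrightarrow> (\<integral>x. 0 \<partial>M)"
      proof (rule integral_dominated_convergence[where w = "\<lambda>x. 3 * norm (f x)"])
        show "AE x in M. (\<lambda>n. norm (f x - s n x)) \<longlonglongrightarrow> 0"
        proof (rule AE_I2)
          fix x assume "x \<in> space M"
          then have "(\<lambda>n. f x - s n x) \<longlonglongrightarrow> f x - f x" by (intro tendsto_intros lim.hyps(2))
          then show "(\<lambda>n. norm (f x - s n x)) \<longlonglongrightarrow> 0" by (simp add: tendsto_norm_zero)
        qed
        show "AE x in M. norm (norm (f x - s n x)) \<le> 3 * norm (f x)" for n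
        proof (rule AE_I2)
          fix x assume "x \<in> space M"
          then show "norm (norm (f x - s n x)) \<le> 3 * norm (f x)"
            using lim.hyps(3)[of x n] norm_triangle_ineq4[of "f x" "s n x"] by simp
        qed
      qed (use lim in auto)
      then have "(\<lambda>n. \<integral>x. norm (f x - s n x) \<partial>M) \<longlonglongrightarrow> 0" by simp
      from order_tendstoD(2)[OF this e] obtain n where "(\<integral>x. norm (f x - s n x) \<partial>M) < e"
        by (auto dest: eventually_happens)
      then show "\<exists>F'. integrable M F' \<and> appr F' \<and> (\<integral>x. norm (f x - F' x) \<partial>M) < e"
        using lim by blast
    qed
  qed
  then show ?thesis using \<open>e > 0\<close> unfolding appr_def lip_def M_def by blast
qed

section \<open>Comparison of approximate solutions\<close>

text \<open>Step values belong to right end points, so each \<open>s a\<close> is the value at a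
  node no further than \<epsilon> from \<open>a\<close>. Positivity of \<epsilon> comes from the
  length of the first step, which exists because \<open>T > 0\<close>.\<close>

lemma eps_solution_implicit_euler:
  fixes F :: "real \<Rightarrow> 'b::real_normed_vector"
  assumes es: "eps_solution X \<A> F T \<epsilon> n t f s" and T: "T > 0"
  obtains v where "implicit_euler \<A> \<epsilon> n t f v" "v 0 = s 0" "t n = T" "\<epsilon> > 0" "s ` {0..T} \<subseteq> X"
    "(\<Sum>i<n. \<integral>\<tau>. norm (F \<tau> - f (Suc i)) \<partial>lebesgue_on {t i<..<t (Suc i)}) < \<epsilon>"
    "\<And>a. a \<in> {0..T} \<Longrightarrow> \<exists>j\<le>n. s a = v j \<and> \<bar>a - t j\<bar> \<le> \<epsilon>"
proof -
  from es have t: "t 0 = 0" "t n = T"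
    and st: "\<And>j. j \<in> {1..n} \<Longrightarrow> t (j - 1) < t j \<and> t j - t (j - 1) \<le> \<epsilon> \<and> f j \<in> X"
    and sum: "(\<Sum>j=1..n. \<integral>\<tau>. norm (F \<tau> - f j) \<partial>lebesgue_on {t (j - 1)<..<t j}) < \<epsilon>"
    unfolding eps_solution_def by blast+
  from es obtain v where vX: "\<forall>j\<in>{0..n}. v j \<in> X" and v0: "s (t 0) = v 0"
    and v: "\<forall>j\<in>{1..n}. (\<forall>\<tau>\<in>{t (j - 1)<..t j}. s \<tau> = v j) \<and>
           f j \<in> (\<lambda>f. (v j - v (j - 1)) /\<^sub>R (t j - t (j - 1)) + f) ` \<A> (v j)"
    unfolding eps_solution_def by blast
  have "n \<noteq> 0" using t T by (metis less_irrefl)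
  then have \<epsilon>: "\<epsilon> > 0" using st[of 1] by auto
  have eul: "implicit_euler \<A> \<epsilon> n t f v"
    unfolding implicit_euler_def
  proof (intro conjI allI impI t)
    fix j assume "j < n"
    then have j: "Suc j \<in> {1..n}" by auto
    show "t j < t (Suc j)" "t (Suc j) - t j \<le> \<epsilon>" using st[OF j] by auto
    show "f (Suc j) - (v (Suc j) - v j) /\<^sub>R (t (Suc j) - t j) \<in> \<A> (v (Suc j))"
      using bspec[OF v j] by auto
  qed
  have near: "\<exists>j\<le>n. s a = v j \<and> \<bar>a - t j\<bar> \<le> \<epsilon>" if a: "a \<in> {0..T}" for a
  proof (cases "a = 0")
    case True
    then show ?thesis using v0 t \<epsilon> by (intro exI[of _ 0]) auto
  next
    case False
    \<comment> \<open>The least index selects the interval \<open>{t (j - 1)<..t j}\<close>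
      containing \<open>a\<close>; the time 0 lies in no such interval, hence the case
      distinction.\<close>
    define j where "j = (LEAST j. a \<le> t j)"
    have ex: "a \<le> t n" using a t by simp
    have j: "a \<le> t j" "j \<le> n" unfolding j_def using ex by (auto intro: LeastI Least_le)
    have "j \<noteq> 0"
    proof
      assume "j = 0"
      then show False using j(1) t(1) a False by simp
    qed
    then have "\<not> a \<le> t (j - 1)" unfolding j_def by (intro not_less_Least) auto
    with j \<open>j \<noteq> 0\<close> st[of j] bspec[OF v, of j] show ?thesis
      by (intro exI[of _ j]) auto
  qed
  show thesis
  proof (rule that[OF eul _ t(2) \<epsilon>])
    show "v 0 = s 0" using v0 t by simp
    show "s ` {0..T} \<subseteq> X" using near vX by fastforce
    show "(\<Sum>i<n. \<integral>\<tau>. norm (F \<tau> - f (Suc i)) \<partial>lebesgue_on {t i<..<t (Suc i)}) < \<epsilon>"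
      using sum by (simp add: sum.atLeast1_atMost_eq)
  qed (rule near)
qed

lemma integral_lebesgue_on_const:
  fixes a b c :: real
  shows "a \<le> b \<Longrightarrow> (\<integral>x. c \<partial>lebesgue_on {a<..<b}) = (b - a) * c"
  by (simp add: measure_restrict_space)

text \<open>\<open>norm (f (Suc i) - H b)\<close> does not depend on the point of its interval and
  can be averaged there: the triangle inequality through \<open>F x\<close> and \<open>H x\<close>
  produces two integral errors and an oscillation of \<open>H\<close> of at most
  \<open>L * \<epsilon>\<close>. The sums of the two-grid estimate thus become quantities that an
  \<epsilon>-solution controls.\<close>

lemma implicit_euler_forcing_error:
  fixes F :: "real \<Rightarrow> 'b::{banach, second_countable_topology}"
  assumes s: "implicit_euler \<A> \<epsilon> n t f s" and T: "t n = T"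
    and F: "integrable (lebesgue_on {0<..<T}) F"
    and L: "L \<ge> 0" "\<And>a b. norm (H a - H b) \<le> L * \<bar>a - b\<bar>"
    and j: "j \<le> n"
  shows "(\<Sum>i<j. (t (Suc i) - t i) * norm (f (Suc i) - H (t (Suc i))))
    \<le> (\<Sum>i<n. \<integral>\<tau>. norm (F \<tau> - f (Suc i)) \<partial>lebesgue_on {t i<..<t (Suc i)})
      + (\<integral>\<tau>. norm (F \<tau> - H \<tau>) \<partial>lebesgue_on {0<..<T}) + L * \<epsilon> * T"
proof -
  have HB: "norm (H x) \<le> norm (H 0) + L * T" if "x \<in> {0<..<T}" for x
    by (rule norm_real_lipschitz_le[OF L]) (use that in auto)
  note int_H = integrable_lebesgue_on_norm_diff[OF F continuous_on_real_lipschitz[OF L] HB]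
  note int_c = integrable_lebesgue_on_norm_diff[OF F continuous_on_const order_refl]
  define p where "p i = (\<integral>\<tau>. norm (F \<tau> - f (Suc i)) \<partial>lebesgue_on {t i<..<t (Suc i)})" for i
  have p0: "p i \<ge> 0" for i unfolding p_def by (intro integral_nonneg_AE) auto
  have "(\<Sum>i<j. (t (Suc i) - t i) * norm (f (Suc i) - H (t (Suc i))))
     \<le> (\<Sum>i<j. p i) + (\<integral>\<tau>. norm (F \<tau> - H \<tau>) \<partial>lebesgue_on {0<..<t j}) + L * \<epsilon> * t j"
    using j
  proof (induction j)
    case 0
    then show ?case using s by (simp add: implicit_euler_def)
  next
    case (Suc i)
    define a where "a = t i"
    define b where "b = t (Suc i)"
    have ab: "0 \<le> a" "a < b" "b - a \<le> \<epsilon>" "b \<le> T"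
      using s Suc.prems implicit_euler_nonneg[OF s, of i] implicit_euler_mono[OF s Suc.prems] T
      by (auto simp: a_def b_def implicit_euler_def)
    have ic: "integrable (lebesgue_on {a<..<b}) (\<lambda>x. norm (F x - f (Suc i)))"
      using int_c ab by simp
    have iH: "integrable (lebesgue_on {a<..<b}) (\<lambda>x. norm (F x - H x))"
      using int_H ab by simp
    have icon: "integrable (lebesgue_on {a<..<b}) (\<lambda>x. c)" for c :: real
      by (intro finite_measure.integrable_const finite_measure_lebesgue_on) simp
    have "(b - a) * norm (f (Suc i) - H b) = (\<integral>x. norm (f (Suc i) - H b) \<partial>lebesgue_on {a<..<b})"
      using ab by (subst integral_lebesgue_on_const) auto
    also have "\<dots> \<le> (\<integral>x. norm (F x - f (Suc i)) + norm (F x - H x) + L * \<epsilon> \<partial>lebesgue_on {a<..<b})"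
    proof (rule integral_mono)
      fix x assume "x \<in> space (lebesgue_on {a<..<b})"
      then have x: "a < x" "x < b" by auto
      have "norm (f (Suc i) - H b) \<le> norm (F x - f (Suc i)) + norm (F x - H b)"
        using norm_triangle_ineq4[of "F x - H b" "F x - f (Suc i)"] by simp
      also have "norm (F x - H b) \<le> norm (F x - H x) + norm (H x - H b)"
        using norm_triangle_ineq[of "F x - H x" "H x - H b"] by simp
      also have "norm (H x - H b) \<le> L * \<bar>x - b\<bar>" by (rule L)
      also have "\<dots> \<le> L * \<epsilon>" using x ab L by (intro mult_left_mono) auto
      finally show "norm (f (Suc i) - H b) \<le> norm (F x - f (Suc i)) + norm (F x - H x) + L * \<epsilon>" by simp
    qed (use ic iH icon in auto)
    also have "\<dots> = p i + (\<integral>x. norm (F x - H x) \<partial>lebesgue_on {a<..<b}) + (b - a) * (L * \<epsilon>)"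
      using ic iH icon ab integral_lebesgue_on_const[of a b "L * \<epsilon>"] by (simp add: p_def a_def b_def)
    finally have "(b - a) * norm (f (Suc i) - H b)
       \<le> p i + (\<integral>x. norm (F x - H x) \<partial>lebesgue_on {a<..<b}) + (b - a) * (L * \<epsilon>)" .
    moreover have "(\<integral>x. norm (F x - H x) \<partial>lebesgue_on {0<..<a}) + (\<integral>x. norm (F x - H x) \<partial>lebesgue_on {a<..<b})
       \<le> (\<integral>x. norm (F x - H x) \<partial>lebesgue_on {0<..<b})"
      using int_H[of 0 b] ab by (intro integral_lebesgue_on_disjoint_le) auto
    moreover have "(\<Sum>i<i. (t (Suc i) - t i) * norm (f (Suc i) - H (t (Suc i))))
     \<le> (\<Sum>i<i. p i) + (\<integral>\<tau>. norm (F \<tau> - H \<tau>) \<partial>lebesgue_on {0<..<a}) + L * \<epsilon> * a"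
      using Suc by (simp add: a_def)
    ultimately show ?case by (simp add: a_def[symmetric] b_def[symmetric] algebra_simps)
  qed
  moreover have "(\<Sum>i<j. p i) \<le> (\<Sum>i<n. p i)"
    using j p0 by (intro sum_mono2) auto
  moreover have tj: "0 \<le> t j" "t j \<le> T"
    using implicit_euler_nonneg[OF s j] implicit_euler_mono[OF s j order_refl] T by auto
  moreover have "(\<integral>\<tau>. norm (F \<tau> - H \<tau>) \<partial>lebesgue_on {0<..<t j}) \<le> (\<integral>\<tau>. norm (F \<tau> - H \<tau>) \<partial>lebesgue_on {0<..<T})"
  proof -
    have "{0<..<t j} \<subseteq> {0<..<T}" using tj by auto
    then show ?thesis
      using integral_lebesgue_on_disjoint_le[of "{0<..<T}" "\<lambda>\<tau>. norm (F \<tau> - H \<tau>)" "{0<..<t j}" "{}"]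
        int_H[of 0 T] by (simp add: integral_restrict_space)
  qed
  moreover have "L * \<epsilon> * t j \<le> L * \<epsilon> * T"
  \<comment> \<open>Nonnegativity of \<epsilon> is read off from a first step; without any step,
    \<open>t j\<close> equals \<open>T\<close>.\<close>
  proof (cases n)
    case 0
    then show ?thesis using j T by simp
  next
    case (Suc m)
    then have "t 0 < t 1 \<and> t 1 - t 0 \<le> \<epsilon>" using s by (auto simp: implicit_euler_def)
    then have "\<epsilon> \<ge> 0" by simp
    then show ?thesis using tj L by (intro mult_left_mono) auto
  qed
  ultimately show ?thesis unfolding p_def by linarith
qed

lemma eps_solution_modulus:
  fixes F :: "real \<Rightarrow> 'b::{banach, second_countable_topology}"
  assumes acc: "accretive \<A>" and T: "T > 0" and F: "integrable (lebesgue_on {0<..<T}) F"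
    and u0: "u0 \<in> closure (Dom \<A>)" and e: "e > 0"
  obtains \<delta> where "\<delta> > 0"
    "\<And>\<epsilon> n t f s \<epsilon>' n' t' f' s' a b.
       eps_solution X \<A> F T \<epsilon> n t f s \<Longrightarrow> \<epsilon> \<le> \<delta> \<Longrightarrow> norm (s 0 - u0) \<le> \<delta> \<Longrightarrow>
       eps_solution X \<A> F T \<epsilon>' n' t' f' s' \<Longrightarrow> \<epsilon>' \<le> \<delta> \<Longrightarrow> norm (s' 0 - u0) \<le> \<delta> \<Longrightarrow>
       a \<in> {0..T} \<Longrightarrow> b \<in> {0..T} \<Longrightarrow> \<bar>a - b\<bar> \<le> \<delta> \<Longrightarrow> norm (s a - s' b) \<le> e"
proof -
  obtain x where x: "x \<in> Dom \<A>" "dist x u0 < e / 16"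
    using u0 e closure_approachable[of u0 "Dom \<A>"] by (meson divide_pos_pos zero_less_numeral)
  obtain y where y: "y \<in> \<A> x" using x(1) by (auto simp: Dom_def)
  obtain H L where L: "L \<ge> 0" "\<And>a b. norm (H a - H b) \<le> L * \<bar>a - b\<bar>"
    and FH: "(\<integral>\<tau>. norm (F \<tau> - H \<tau>) \<partial>lebesgue_on {0<..<T}) < e / 16"
    using lipschitz_dense_integrable[OF F, of "e / 16"] e by auto
  define K where "K = norm (H 0) + L * T + norm y"
  have K0: "K \<ge> 0" using L T by (simp add: K_def)
  have K: "norm (H a) + norm y \<le> K" if "a \<in> {0..T}" for a
    using norm_real_lipschitz_le[OF L that] by (simp add: K_def)
  define Z where "Z = K + L * T"
  have Z0: "Z \<ge> 0" using K0 L T by (simp add: Z_def)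
  \<comment> \<open>\<eta> is fixed before the mesh size: \<open>Z * \<eta>\<close> takes a quarter
    of \<open>e\<close>, and \<delta> is afterwards chosen small enough to compensate the division
    by \<eta>.\<close>
  define \<eta> where "\<eta> = e / (4 * (Z + 1))"
  have \<eta>: "\<eta> > 0" using e Z0 by (simp add: \<eta>_def)
  have Z\<eta>: "Z * \<eta> \<le> e / 4"
  proof -
    have "Z * \<eta> \<le> (Z + 1) * \<eta>" using \<eta> by (intro mult_right_mono) auto
    also have "\<dots> = e / 4" using Z0 by (simp add: \<eta>_def field_simps)
    finally show ?thesis .
  qed
  \<comment> \<open>All terms that vanish with the mesh. \<open>4 * d\<close> comes from two initial
    values and two forcing errors; \<open>3 * d\<close> bounds the distance of the two nodes, from
    \<open>\<bar>a - b\<bar>\<close> and the two node errors. With four contributions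
    \<open>e / 16\<close> and with \<open>Z * \<eta>\<close> the total stays below
    \<open>3 * e / 4\<close>.\<close>
  define g where "g d = 4 * d + 2 * (L * d * T) + Z * (d + ((3 * d)\<^sup>2 + d * T + d * T) / \<eta>)" for d
  have "(g \<longlongrightarrow> g 0) (at_right 0)"
    unfolding g_def using \<eta> by (intro tendsto_intros) auto
  then have "(g \<longlongrightarrow> 0) (at_right 0)" by (simp add: g_def)
  from order_tendstoD(2)[OF this, of "e / 4"] e
  have "\<forall>\<^sub>F d in at_right 0. g d < e / 4" by simp
  moreover have "\<forall>\<^sub>F d::real in at_right 0. d > 0" by (simp add: eventually_at_filter)
  ultimately have "\<forall>\<^sub>F d in at_right 0. d > 0 \<and> g d < e / 4" by (rule eventually_conj[rotated])
  then have "\<exists>d. d > 0 \<and> g d < e / 4" by (rule eventually_happens'[rotated]) simp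
  then obtain \<delta> where \<delta>: "\<delta> > 0"
      "4 * \<delta> + 2 * (L * \<delta> * T) + Z * (\<delta> + ((3 * \<delta>)\<^sup>2 + \<delta> * T + \<delta> * T) / \<eta>) < e / 4"
    unfolding g_def by blast
  show thesis
  proof (rule that[OF \<delta>(1)])
    fix \<epsilon> n t f s \<epsilon>' n' t' f' s' a b
    assume s: "eps_solution X \<A> F T \<epsilon> n t f s" and \<epsilon>: "\<epsilon> \<le> \<delta>" and s0: "norm (s 0 - u0) \<le> \<delta>"
      and s': "eps_solution X \<A> F T \<epsilon>' n' t' f' s'" and \<epsilon>': "\<epsilon>' \<le> \<delta>" and s0': "norm (s' 0 - u0) \<le> \<delta>"
      and ab: "a \<in> {0..T}" "b \<in> {0..T}" "\<bar>a - b\<bar> \<le> \<delta>"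
    obtain v where v: "implicit_euler \<A> \<epsilon> n t f v" "v 0 = s 0" "t n = T" "\<epsilon> > 0" "s ` {0..T} \<subseteq> X"
      "(\<Sum>i<n. \<integral>\<tau>. norm (F \<tau> - f (Suc i)) \<partial>lebesgue_on {t i<..<t (Suc i)}) < \<epsilon>"
      "\<And>a. a \<in> {0..T} \<Longrightarrow> \<exists>j\<le>n. s a = v j \<and> \<bar>a - t j\<bar> \<le> \<epsilon>"
      by (rule eps_solution_implicit_euler[OF s T]) (rule that; assumption)
    obtain v' where v': "implicit_euler \<A> \<epsilon>' n' t' f' v'" "v' 0 = s' 0" "t' n' = T" "\<epsilon>' > 0" "s' ` {0..T} \<subseteq> X"
      "(\<Sum>i<n'. \<integral>\<tau>. norm (F \<tau> - f' (Suc i)) \<partial>lebesgue_on {t' i<..<t' (Suc i)}) < \<epsilon>'"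
      "\<And>a. a \<in> {0..T} \<Longrightarrow> \<exists>j\<le>n'. s' a = v' j \<and> \<bar>a - t' j\<bar> \<le> \<epsilon>'"
      by (rule eps_solution_implicit_euler[OF s' T]) (rule that; assumption)
    obtain j where j: "j \<le> n" "s a = v j" "\<bar>a - t j\<bar> \<le> \<epsilon>" using v(7)[OF ab(1)] by auto
    obtain k where k: "k \<le> n'" "s' b = v' k" "\<bar>b - t' k\<bar> \<le> \<epsilon>'" using v'(7)[OF ab(2)] by auto
    have tj: "0 \<le> t j" "t j \<le> T" "0 \<le> t' k" "t' k \<le> T"
      using implicit_euler_nonneg[OF v(1) j(1)] implicit_euler_mono[OF v(1) j(1) order_refl]
       implicit_euler_nonneg[OF v'(1) k(1)] implicit_euler_mono[OF v'(1) k(1) order_refl] v(3) v'(3)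
      by auto
    define E where "E = (\<Sum>i<j. (t (Suc i) - t i) * norm (f (Suc i) - H (t (Suc i))))"
    define E' where "E' = (\<Sum>i<k. (t' (Suc i) - t' i) * norm (f' (Suc i) - H (t' (Suc i))))"
    have Le: "L * \<epsilon> * T \<le> L * \<delta> * T" "L * \<epsilon>' * T \<le> L * \<delta> * T"
      using \<epsilon> \<epsilon>' L T by (auto intro!: mult_right_mono mult_left_mono)
    have E: "E \<le> \<delta> + e / 16 + L * \<delta> * T"
      using implicit_euler_forcing_error[OF v(1,3) F L j(1)] FH v(6) \<epsilon> Le unfolding E_def by linarith
    have E': "E' \<le> \<delta> + e / 16 + L * \<delta> * T"
      using implicit_euler_forcing_error[OF v'(1,3) F L k(1)] FH v'(6) \<epsilon>' Le unfolding E'_def by linarith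
    have xu: "norm (u0 - x) \<le> e / 16" using x(2) by (simp add: dist_norm norm_minus_commute)
    have x0: "norm (v 0 - x) \<le> \<delta> + e / 16"
      using norm_triangle_ineq[of "s 0 - u0" "u0 - x"] s0 xu v(2) by simp
    have x0': "norm (v' 0 - x) \<le> \<delta> + e / 16"
      using norm_triangle_ineq[of "s' 0 - u0" "u0 - x"] s0' xu v'(2) by simp
    define q where "q = ((t j - t' k)\<^sup>2 + \<epsilon> * t j + \<epsilon>' * t' k) / \<eta>"
    have "\<bar>t j - t' k\<bar> \<le> 3 * \<delta>" using j k ab(3) \<epsilon> \<epsilon>' by linarith
    then have "(t j - t' k)\<^sup>2 \<le> (3 * \<delta>)\<^sup>2" by (metis abs_ge_zero power2_abs power_mono)
    moreover have "\<epsilon> * t j \<le> \<delta> * T" "\<epsilon>' * t' k \<le> \<delta> * T"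
      using tj \<epsilon> \<epsilon>' v(4) v'(4) \<delta>(1) by (auto intro!: mult_mono)
    ultimately have q: "q \<le> ((3 * \<delta>)\<^sup>2 + \<delta> * T + \<delta> * T) / \<eta>"
      unfolding q_def using \<eta> by (intro divide_right_mono add_mono) simp_all
    have q0: "q \<ge> 0" unfolding q_def using \<eta> tj v(4) v'(4) by simp
    define r where "r = ((3 * \<delta>)\<^sup>2 + \<delta> * T + \<delta> * T) / \<eta>"
    have "norm (s a - s' b) \<le> norm (v 0 - x) + norm (v' 0 - x) + E + E' + (K + L * t j) * (\<epsilon> + \<eta> + q)"
      unfolding j k E_def E'_def q_def
      by (rule kobayashi_estimate[OF acc v(1) v'(1) _ _ y K K0 L(2) L(1) _ _ \<eta> j(1) k(1), of T])
        (use v v' in auto)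
    moreover have "(K + L * t j) * (\<epsilon> + \<eta> + q) \<le> Z * (\<delta> + \<eta> + r)"
      unfolding Z_def r_def using q q0 \<eta> \<epsilon> v(4) tj L K0 T
      by (intro mult_mono add_mono add_nonneg_nonneg mult_nonneg_nonneg) auto
    moreover have "Z * (\<delta> + \<eta> + r) = Z * \<eta> + Z * (\<delta> + r)"
      by (simp add: algebra_simps)
    ultimately show "norm (s a - s' b) \<le> e"
      using x0 x0' E E' Z\<eta> \<delta>(2)[folded r_def] e by linarith
  qed
qed

section \<open>Construction of approximate solutions\<close>

lemma sum_integral_consecutive_le:
  fixes f :: "real \<Rightarrow> real"
  assumes f: "integrable (lebesgue_on {0<..<T}) f" "\<And>x. 0 \<le> f x"
    and t: "t 0 = 0" "\<And>i. i < n \<Longrightarrow> t i \<le> t (Suc i)" "t n \<le> T"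
  shows "(\<Sum>i<n. \<integral>x. f x \<partial>lebesgue_on {t i<..<t (Suc i)}) \<le> (\<integral>x. f x \<partial>lebesgue_on {0<..<t n})"
  using t
proof (induction n)
  case 0
  then show ?case by (simp add: integral_restrict_space)
next
  case (Suc n)
  have n: "t n \<le> t (Suc n)" using Suc.prems by simp
  have "t 0 \<le> t n" if "\<And>i. i < n \<Longrightarrow> t i \<le> t (Suc i)" for n
    using that by (induction n) (auto intro: order_trans)
  then have t0: "0 \<le> t n" using Suc.prems(1,2) by (metis less_Suc_eq)
  have "{0<..<t (Suc n)} \<subseteq> {0<..<T}" using Suc.prems(3) by auto
  then have "integrable (lebesgue_on {0<..<t (Suc n)}) f"
    by (intro integrable_lebesgue_on_subset[OF f(1)]) auto
  moreover have "{0<..<t n} \<subseteq> {0<..<t (Suc n)}" "{t n<..<t (Suc n)} \<subseteq> {0<..<t (Suc n)}"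
    using n t0 by auto
  ultimately have "(\<integral>x. f x \<partial>lebesgue_on {0<..<t n}) + (\<integral>x. f x \<partial>lebesgue_on {t n<..<t (Suc n)})
       \<le> (\<integral>x. f x \<partial>lebesgue_on {0<..<t (Suc n)})"
    using f(2) by (intro integral_lebesgue_on_disjoint_le) auto
  moreover have "(\<Sum>i<n. \<integral>x. f x \<partial>lebesgue_on {t i<..<t (Suc i)}) \<le> (\<integral>x. f x \<partial>lebesgue_on {0<..<t n})"
    using Suc n by force
  ultimately show ?case by simp
qed

text \<open>The substitute \<open>H\<close> may take values outside the subspace \<open>X\<close>,
  whereas the discrete forcing must lie in it. An almost nearest value of \<open>F\<close> itself
  serves: its distance to \<open>H (t j)\<close> exceeds that of \<open>F \<tau>\<close> by at most
  \<open>d\<close> for every \<tau>, an inequality that can be integrated in \<tau>.\<close>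

lemma ex_almost_nearest:
  fixes S :: "'b::real_normed_vector set"
  assumes "S \<noteq> {}" "d > 0"
  obtains x where "x \<in> S" "\<And>y. y \<in> S \<Longrightarrow> norm (x - h) \<le> norm (y - h) + d"
proof -
  let ?I = "Inf ((\<lambda>y. norm (y - h)) ` S)"
  have "\<exists>r\<in>(\<lambda>y. norm (y - h)) ` S. r < ?I + d"
    using assms by (intro cInf_lessD) auto
  then obtain x where x: "x \<in> S" "norm (x - h) < ?I + d" by auto
  have "?I \<le> norm (y - h)" if "y \<in> S" for y
    using that by (intro cInf_lower bdd_belowI[where m = 0]) auto
  with x show thesis by (intro that[of x]) (auto intro: less_imp_le order_trans)
qed

text \<open>Multiplied by \<open>h\<close>, a step from \<open>x\<close> becomes the resolvent
  equation \<open>z + h *\<^sub>R y = x + h *\<^sub>R f (Suc j)\<close>.\<close>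

lemma implicit_euler_exists:
  fixes X :: "'b::real_normed_vector set"
  assumes X: "subspace X" and u0: "u0 \<in> X" and f: "\<And>j. f j \<in> X" and h: "h > 0"
    and range: "\<And>g. g \<in> X \<Longrightarrow> \<exists>x\<in>X. \<exists>y\<in>\<A> x. x + h *\<^sub>R y = g"
  shows "\<exists>v. v 0 = u0 \<and> (\<forall>j. v j \<in> X \<and> f (Suc j) - (v (Suc j) - v j) /\<^sub>R h \<in> \<A> (v (Suc j)))"
proof -
  have "\<exists>z. z \<in> X \<and> f (Suc j) - (z - x) /\<^sub>R h \<in> \<A> z" if "x \<in> X" for x j
  proof -
    have "x + h *\<^sub>R f (Suc j) \<in> X" using X f that by (simp add: subspace_add subspace_scale)
    from range[OF this] obtain z y where z: "z \<in> X" "y \<in> \<A> z" "z + h *\<^sub>R y = x + h *\<^sub>R f (Suc j)" by auto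
    then have "z - x = h *\<^sub>R (f (Suc j) - y)" by (simp add: algebra_simps)
    then have "f (Suc j) - (z - x) /\<^sub>R h = y" using h by simp
    with z show ?thesis by metis
  qed
  then obtain S where S: "\<And>x j. x \<in> X \<Longrightarrow> S x j \<in> X \<and> f (Suc j) - (S x j - x) /\<^sub>R h \<in> \<A> (S x j)"
    by metis
  define v where "v = rec_nat u0 (\<lambda>j x. S x j)"
  have v: "v 0 = u0" "v (Suc j) = S (v j) j" for j by (simp_all add: v_def)
  have vX: "v j \<in> X" for j by (induction j) (use u0 S v in auto)
  show ?thesis
    by (rule exI[of _ v]) (use v vX S in auto)
qed

lemma eps_solution_exists:
  fixes F :: "real \<Rightarrow> 'b::{banach, second_countable_topology}"
  assumes X: "subspace X" and u0: "u0 \<in> X" and T: "T > 0" and F: "integrable (lebesgue_on {0<..<T}) F"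
    and FX: "\<And>t. t \<in> {0<..<T} \<Longrightarrow> F t \<in> X"
    and range: "\<And>l g. l > 0 \<Longrightarrow> g \<in> X \<Longrightarrow> \<exists>x\<in>X. \<exists>y\<in>\<A> x. x + l *\<^sub>R y = g"
    and e: "e > 0"
  obtains n t f s where "eps_solution X \<A> F T e n t f s" "s 0 = u0"
proof -
  obtain H L where L: "L \<ge> 0" "\<And>a b. norm (H a - H b) \<le> L * \<bar>a - b\<bar>"
    and FH: "(\<integral>\<tau>. norm (F \<tau> - H \<tau>) \<partial>lebesgue_on {0<..<T}) < e / 8"
    using lipschitz_dense_integrable[OF F, of "e / 8"] e by auto
  define d where "d = e / (4 * T)"
  have d: "d > 0" using e T by (simp add: d_def)
  \<comment> \<open>The two summands force \<open>h \<le> e\<close> and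
    \<open>8 * L * h * T \<le> e\<close>. The forcing error is then made up of less than
    \<open>e / 4\<close> from \<open>F - H\<close>, of \<open>2 * L * h * T \<le> e / 4\<close>, and
    of \<open>d * T = e / 4\<close>.\<close>
  obtain n where n: "T / e + 8 * L * T * T / e < real n" using reals_Archimedean2 by blast
  have LT: "8 * L * T * T / e \<ge> 0" "T / e > 0" using L T e by auto
  then have n0: "real n > 0" using n by linarith
  define h where "h = T / real n"
  have h: "h > 0" using T n0 by (simp add: h_def)
  have he: "h \<le> e"
  proof -
    have "T / e < real n" using n LT by linarith
    then show ?thesis using e n0 by (simp add: h_def field_simps)
  qed
  have Lh: "8 * L * h * T \<le> e"
  proof -
    have "8 * L * T * T / e < real n" using n LT by linarith
    then show ?thesis using e n0 by (simp add: h_def field_simps)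
  qed
  have nh: "real n * h = T" using n0 by (simp add: h_def)
  define t where "t j = real j * h" for j
  have tS: "t (Suc j) = t j + h" for j by (simp add: t_def algebra_simps)
  have t0: "t j \<ge> 0" for j using h by (simp add: t_def)
  have tT: "t j \<le> T" if "j \<le> n" for j
    using that h nh by (simp add: t_def) (metis mult_right_mono less_imp_le of_nat_le_iff)
  have "\<exists>x\<in>X. \<forall>\<tau>\<in>{0<..<T}. norm (x - H (t j)) \<le> norm (F \<tau> - H (t j)) + d" for j
  proof (rule ex_almost_nearest[of "F ` {0<..<T}" d "H (t j)"])
    fix x assume "x \<in> F ` {0<..<T}" "\<And>y. y \<in> F ` {0<..<T} \<Longrightarrow> norm (x - H (t j)) \<le> norm (y - H (t j)) + d"
    then show ?thesis using FX by blast
  qed (use T d in auto)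
  then obtain f where f: "\<And>j. f j \<in> X" "\<And>j \<tau>. \<tau> \<in> {0<..<T} \<Longrightarrow> norm (f j - H (t j)) \<le> norm (F \<tau> - H (t j)) + d"
    by metis
  have "\<exists>v. v 0 = u0 \<and> (\<forall>j. v j \<in> X \<and> f (Suc j) - (v (Suc j) - v j) /\<^sub>R h \<in> \<A> (v (Suc j)))"
    by (rule implicit_euler_exists[OF X u0 f(1) h range[OF h]])
  then obtain v where v: "v 0 = u0" "\<And>j. v j \<in> X"
      "\<And>j. f (Suc j) - (v (Suc j) - v j) /\<^sub>R h \<in> \<A> (v (Suc j))"
    by metis
  \<comment> \<open>Rounding \<open>\<tau> / h\<close> up gives the right end point of the interval,
    and \<open>v 0\<close> at time 0.\<close>
  define s where "s \<tau> = v (nat \<lceil>\<tau> / h\<rceil>)" for \<tau>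
  have HB: "norm (H x) \<le> norm (H 0) + L * T" if "x \<in> {0<..<T}" for x
    by (rule norm_real_lipschitz_le[OF L]) (use that in auto)
  note int_H = integrable_lebesgue_on_norm_diff[OF F continuous_on_real_lipschitz[OF L] HB]
  note int_c = integrable_lebesgue_on_norm_diff[OF F continuous_on_const order_refl]
  have step: "(\<integral>\<tau>. norm (F \<tau> - f (Suc i)) \<partial>lebesgue_on {t i<..<t (Suc i)})
      \<le> 2 * (\<integral>\<tau>. norm (F \<tau> - H \<tau>) \<partial>lebesgue_on {t i<..<t (Suc i)}) + h * (2 * L * h + d)"
    if i: "i < n" for i
  proof -
    have iT: "t (Suc i) \<le> T" using i by (intro tT) auto
    have icon: "integrable (lebesgue_on {t i<..<t (Suc i)}) (\<lambda>x. c)" for c :: real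
      by (intro finite_measure.integrable_const finite_measure_lebesgue_on) simp
    have iH: "integrable (lebesgue_on {t i<..<t (Suc i)}) (\<lambda>x. norm (F x - H x))"
      using int_H t0 iT by simp
    have "(\<integral>\<tau>. norm (F \<tau> - f (Suc i)) \<partial>lebesgue_on {t i<..<t (Suc i)})
      \<le> (\<integral>\<tau>. 2 * norm (F \<tau> - H \<tau>) + (2 * L * h + d) \<partial>lebesgue_on {t i<..<t (Suc i)})"
    proof (rule integral_mono)
      fix x assume "x \<in> space (lebesgue_on {t i<..<t (Suc i)})"
      then have x: "t i < x" "x < t (Suc i)" by auto
      then have xT: "x \<in> {0<..<T}" using t0[of i] iT by auto
      have "norm (F x - f (Suc i)) \<le> norm (F x - H (t (Suc i))) + norm (f (Suc i) - H (t (Suc i)))"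
        using norm_triangle_ineq4[of "F x - H (t (Suc i))" "f (Suc i) - H (t (Suc i))"] by simp
      also have "\<dots> \<le> 2 * norm (F x - H (t (Suc i))) + d" using f(2)[OF xT, of "Suc i"] by simp
      also have "norm (F x - H (t (Suc i))) \<le> norm (F x - H x) + L * h"
      proof -
        have "norm (F x - H (t (Suc i))) \<le> norm (F x - H x) + norm (H x - H (t (Suc i)))"
          using norm_triangle_ineq[of "F x - H x" "H x - H (t (Suc i))"] by simp
        moreover have "norm (H x - H (t (Suc i))) \<le> L * \<bar>x - t (Suc i)\<bar>" by (rule L)
        moreover have "L * \<bar>x - t (Suc i)\<bar> \<le> L * h" using x L by (intro mult_left_mono) (auto simp: tS)
        ultimately show ?thesis by linarith
      qed
      finally show "norm (F x - f (Suc i)) \<le> 2 * norm (F x - H x) + (2 * L * h + d)" by simp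
    qed (use int_c iT t0 iH icon in auto)
    also have "\<dots> = 2 * (\<integral>\<tau>. norm (F \<tau> - H \<tau>) \<partial>lebesgue_on {t i<..<t (Suc i)}) + h * (2 * L * h + d)"
      using iH icon integral_lebesgue_on_const[of "t i" "t (Suc i)" "2 * L * h + d"] h by (simp add: tS)
    finally show ?thesis .
  qed
  have "(\<Sum>i<n. \<integral>\<tau>. norm (F \<tau> - f (Suc i)) \<partial>lebesgue_on {t i<..<t (Suc i)})
     \<le> (\<Sum>i<n. 2 * (\<integral>\<tau>. norm (F \<tau> - H \<tau>) \<partial>lebesgue_on {t i<..<t (Suc i)}) + h * (2 * L * h + d))"
    by (intro sum_mono step) auto
  also have "\<dots> = 2 * (\<Sum>i<n. \<integral>\<tau>. norm (F \<tau> - H \<tau>) \<partial>lebesgue_on {t i<..<t (Suc i)}) + (real n * h) * (2 * L * h + d)"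
    by (simp add: sum.distrib sum_distrib_left)
  also have "(\<Sum>i<n. \<integral>\<tau>. norm (F \<tau> - H \<tau>) \<partial>lebesgue_on {t i<..<t (Suc i)})
      \<le> (\<integral>\<tau>. norm (F \<tau> - H \<tau>) \<partial>lebesgue_on {0<..<t n})"
    using h int_H[of 0 T] tT by (intro sum_integral_consecutive_le[where T = T]) (auto simp: t_def algebra_simps)
  also have "t n = T" by (simp add: t_def nh)
  also have "2 * (\<integral>\<tau>. norm (F \<tau> - H \<tau>) \<partial>lebesgue_on {0<..<T}) + (real n * h) * (2 * L * h + d) < e"
  proof -
    have "(real n * h) * (2 * L * h + d) = 2 * L * h * T + d * T" unfolding nh by (simp add: algebra_simps)
    also have "d * T = e / 4" using T by (simp add: d_def)
    finally show ?thesis using FH Lh e by linarith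
  qed
  finally have sum: "(\<Sum>i<n. \<integral>\<tau>. norm (F \<tau> - f (Suc i)) \<partial>lebesgue_on {t i<..<t (Suc i)}) < e"
    by simp
  have s: "s \<tau> = v j" if "\<tau> \<in> {t (j - 1)<..t j}" "j \<ge> 1" for \<tau> j
  proof -
    have "real j - 1 < \<tau> / h" "\<tau> / h \<le> real j"
      using that h by (auto simp: t_def field_simps of_nat_diff)
    then have "\<lceil>\<tau> / h\<rceil> = int j" by (intro ceiling_unique) auto
    then show ?thesis by (simp add: s_def)
  qed
  have "eps_solution X \<A> F T e n t f s"
    unfolding eps_solution_def
  proof (intro conjI ballI exI[of _ v])
    show "t 0 = 0" "t n = T" by (simp_all add: t_def nh)
    show "s (t 0) = v 0" by (simp add: s_def t_def)
    show "(\<Sum>j = 1..n. LINT \<tau>|lebesgue_on {t (j - 1)<..<t j}. norm (F \<tau> - f j)) < e"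
      using sum by (simp add: sum.atLeast1_atMost_eq)
    fix j assume "j \<in> {1..n}"
    then obtain i where i: "j = Suc i" by (cases j) auto
    show "t (j - 1) < t j" "t j - t (j - 1) \<le> e" using h he by (auto simp: i tS)
    show "\<And>\<tau>. \<tau> \<in> {t (j - 1)<..t j} \<Longrightarrow> s \<tau> = v j" using s[of _ j] i by auto
    show "f j \<in> (\<lambda>f. (v j - v (j - 1)) /\<^sub>R (t j - t (j - 1)) + f) ` \<A> (v j)"
      unfolding i by (rule image_eqI[OF _ v(3)[of i]]) (simp add: tS)
  qed (use f v in auto)
  moreover have "s 0 = u0" by (simp add: s_def v)
  ultimately show thesis by (rule that)
qed

section \<open>Uniqueness and existence of the limit function\<close>

lemma eps_solution_mono:
  "eps_solution X \<A> F T \<epsilon> n t f s \<Longrightarrow> \<epsilon> \<le> \<epsilon>' \<Longrightarrow> eps_solution X \<A> F T \<epsilon>' n t f s"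
  unfolding eps_solution_def
  by (elim conjE, intro conjI) (assumption, assumption, blast intro: order_trans, rule less_le_trans)

text \<open>Each solution is within \<open>e / 3\<close> of an \<epsilon>-solution, and the two
  \<epsilon>-solutions are within \<open>e / 3\<close> of each other. Closeness at time 0 is what
  puts their initial values near \<open>u0\<close>.\<close>

lemma C0_solution_unique:
  fixes F :: "real \<Rightarrow> 'b::{banach, second_countable_topology}"
  assumes acc: "accretive \<A>" and T: "T > 0" and F: "integrable (lebesgue_on {0<..<T}) F"
    and u0: "u0 \<in> closure (Dom \<A>)"
    and u: "C0_solution X \<A> F T u0 u" and v: "C0_solution X \<A> F T u0 v" and a: "a \<in> {0..T}"
  shows "v a = u a"
proof -
  have "norm (v a - u a) \<le> 0 + e" if e: "e > 0" for e
  proof -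
    have e3: "e / 3 > 0" using e by simp
    obtain \<delta> where \<delta>: "\<delta> > 0"
      "\<And>\<epsilon> n t f s \<epsilon>' n' t' f' s' a b.
       eps_solution X \<A> F T \<epsilon> n t f s \<Longrightarrow> \<epsilon> \<le> \<delta> \<Longrightarrow> norm (s 0 - u0) \<le> \<delta> \<Longrightarrow>
       eps_solution X \<A> F T \<epsilon>' n' t' f' s' \<Longrightarrow> \<epsilon>' \<le> \<delta> \<Longrightarrow> norm (s' 0 - u0) \<le> \<delta> \<Longrightarrow>
       a \<in> {0..T} \<Longrightarrow> b \<in> {0..T} \<Longrightarrow> \<bar>a - b\<bar> \<le> \<delta> \<Longrightarrow> norm (s a - s' b) \<le> e / 3"
      by (rule eps_solution_modulus[OF acc T F u0 e3, of X]) (rule that; assumption)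
    define \<epsilon> where "\<epsilon> = min \<delta> (e / 3)"
    have \<epsilon>: "\<epsilon> > 0" "\<epsilon> \<le> \<delta>" "\<epsilon> \<le> e / 3" using e \<delta>(1) by (auto simp: \<epsilon>_def)
    obtain n t f s where s: "eps_solution X \<A> F T \<epsilon> n t f s" "\<forall>\<tau>\<in>{0..T}. norm (u \<tau> - s \<tau>) \<le> \<epsilon>"
      using u \<epsilon>(1) unfolding C0_solution_def by blast
    obtain n' t' f' s' where s': "eps_solution X \<A> F T \<epsilon> n' t' f' s'" "\<forall>\<tau>\<in>{0..T}. norm (v \<tau> - s' \<tau>) \<le> \<epsilon>"
      using v \<epsilon>(1) unfolding C0_solution_def by blast
    have "u 0 = u0" "v 0 = u0" using u v by (auto simp: C0_solution_def)
    then have "norm (s 0 - u0) \<le> \<delta>" "norm (s' 0 - u0) \<le> \<delta>"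
      using bspec[OF s(2), of 0] bspec[OF s'(2), of 0] T \<epsilon> by (auto simp: norm_minus_commute)
    then have "norm (s a - s' a) \<le> e / 3"
      using \<delta>(1) by (intro \<delta>(2)[OF s(1) \<epsilon>(2) _ s'(1) \<epsilon>(2) _ a a]) auto
    moreover have "norm (u a - s a) \<le> e / 3" "norm (v a - s' a) \<le> e / 3"
      using bspec[OF s(2) a] bspec[OF s'(2) a] \<epsilon>(3) by auto
    moreover have "norm (v a - u a) \<le> norm (v a - s' a) + norm (s a - s' a) + norm (u a - s a)"
      using norm_triangle_ineq4[of "v a - s' a" "s a - s' a"]
        norm_triangle_ineq4[of "(v a - s' a) - (s a - s' a)" "u a - s a"]
        norm_triangle_ineq4[of "v a - s' a" "u a - s a + (s a - s' a)"]
        norm_triangle_ineq[of "u a - s a" "s a - s' a"] by (simp add: algebra_simps)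
    ultimately show ?thesis by linarith
  qed
  then have "norm (v a - u a) \<le> 0" by (rule field_le_epsilon)
  then show ?thesis by simp
qed

text \<open>The schemes of accuracy \<open>1 / (k + 1)\<close> are uniformly Cauchy. The relation
  itself never has to pass to the limit: a solution is defined by its approximating schemes, and
  these are at hand.\<close>

theorem C0_solution_exists:
  fixes F :: "real \<Rightarrow> 'b::{banach, second_countable_topology}"
  assumes acc: "accretive \<A>" and X: "subspace X" "closed X" and DomX: "Dom \<A> \<subseteq> X"
    and range: "\<And>l g. l > 0 \<Longrightarrow> g \<in> X \<Longrightarrow> \<exists>x\<in>X. \<exists>y\<in>\<A> x. x + l *\<^sub>R y = g"
    and T: "T > 0" and F: "integrable (lebesgue_on {0<..<T}) F"
    and FX: "\<And>t. t \<in> {0<..<T} \<Longrightarrow> F t \<in> X" and u0: "u0 \<in> closure (Dom \<A>)"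
  shows "\<exists>u. C0_solution X \<A> F T u0 u"
proof -
  have u0X: "u0 \<in> X" using closure_minimal[OF DomX X(2)] u0 by blast
  have "\<exists>n t f s. eps_solution X \<A> F T (inverse (real (Suc k))) n t f s \<and> s 0 = u0" for k
    by (rule eps_solution_exists[OF X(1) u0X T F FX range, of "inverse (real (Suc k))"]) (assumption, auto)
  then obtain n t f s where s: "\<And>k. eps_solution X \<A> F T (inverse (real (Suc k))) (n k) (t k) (f k) (s k)"
    and s0: "\<And>k. s k 0 = u0" by metis
  \<comment> \<open>Admitting different times makes the limit continuous although every
    \<open>s k\<close> may jump.\<close>
  have key: "\<exists>\<delta>>0. \<exists>N. \<forall>k\<ge>N. \<forall>l\<ge>N. \<forall>a\<in>{0..T}. \<forall>b\<in>{0..T}. \<bar>a - b\<bar> \<le> \<delta> \<longrightarrow> norm (s k a - s l b) \<le> e"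
    if e: "e > 0" for e
  proof -
    obtain \<delta> where \<delta>: "\<delta> > 0"
      "\<And>\<epsilon> n t f s \<epsilon>' n' t' f' s' a b.
       eps_solution X \<A> F T \<epsilon> n t f s \<Longrightarrow> \<epsilon> \<le> \<delta> \<Longrightarrow> norm (s 0 - u0) \<le> \<delta> \<Longrightarrow>
       eps_solution X \<A> F T \<epsilon>' n' t' f' s' \<Longrightarrow> \<epsilon>' \<le> \<delta> \<Longrightarrow> norm (s' 0 - u0) \<le> \<delta> \<Longrightarrow>
       a \<in> {0..T} \<Longrightarrow> b \<in> {0..T} \<Longrightarrow> \<bar>a - b\<bar> \<le> \<delta> \<Longrightarrow> norm (s a - s' b) \<le> e"
      by (rule eps_solution_modulus[OF acc T F u0 e, of X]) (rule that; assumption)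
    obtain N where N: "inverse (real (Suc N)) < \<delta>" using reals_Archimedean[OF \<delta>(1)] by blast
    have Nk: "inverse (real (Suc k)) \<le> \<delta>" if "k \<ge> N" for k
    proof -
      have "inverse (real (Suc k)) \<le> inverse (real (Suc N))" using that by (intro le_imp_inverse_le) auto
      with N show ?thesis by (rule order_trans[OF _ less_imp_le, rotated])
    qed
    have "norm (s k a - s l b) \<le> e" if "k \<ge> N" "l \<ge> N" "a \<in> {0..T}" "b \<in> {0..T}" "\<bar>a - b\<bar> \<le> \<delta>" for k l a b
      by (rule \<delta>(2)[OF s Nk[OF that(1)] _ s Nk[OF that(2)] _ that(3-5)]) (use \<delta>(1) s0 in auto)
    then show ?thesis using \<delta>(1) by blast
  qed
  have "convergent (\<lambda>k. s k a)" if "a \<in> {0..T}" for a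
  proof (rule Cauchy_convergent, rule CauchyI)
    fix e :: real assume "e > 0"
    then have "e / 2 > 0" by simp
    from key[OF this] obtain \<delta> N where "\<delta> > 0" "\<forall>k\<ge>N. \<forall>l\<ge>N. \<forall>a\<in>{0..T}. \<forall>b\<in>{0..T}. \<bar>a - b\<bar> \<le> \<delta> \<longrightarrow> norm (s k a - s l b) \<le> e / 2"
      by blast
    then have "\<forall>k\<ge>N. \<forall>l\<ge>N. norm (s k a - s l a) \<le> e / 2" using that by auto
    then show "\<exists>N. \<forall>k\<ge>N. \<forall>l\<ge>N. norm (s k a - s l a) < e"
      using \<open>e > 0\<close> by (intro exI[of _ N] allI impI) (rule le_less_trans[of _ "e / 2"], auto)
  qed
  then obtain u where u: "\<And>a. a \<in> {0..T} \<Longrightarrow> (\<lambda>k. s k a) \<longlonglongrightarrow> u a"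
    unfolding convergent_def by metis
  have "continuous_on {0..T} u"
    unfolding continuous_on_iff
  proof (intro ballI allI impI)
    fix a e :: real assume a: "a \<in> {0..T}" and e: "0 < e"
    then have "e / 2 > 0" by simp
    from key[OF this] obtain \<delta> N where \<delta>: "\<delta> > 0" "\<forall>k\<ge>N. \<forall>l\<ge>N. \<forall>a\<in>{0..T}. \<forall>b\<in>{0..T}. \<bar>a - b\<bar> \<le> \<delta> \<longrightarrow> norm (s k a - s l b) \<le> e / 2"
      by blast
    have le: "norm (u b - u a) \<le> e / 2" if b: "b \<in> {0..T}" "\<bar>b - a\<bar> \<le> \<delta>" for b
    proof (rule LIMSEQ_le_const2)
      show "(\<lambda>k. norm (s k b - s k a)) \<longlonglongrightarrow> norm (u b - u a)"
        by (intro tendsto_intros u a b)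
      show "\<exists>N. \<forall>k\<ge>N. norm (s k b - s k a) \<le> e / 2"
        by (intro exI[of _ N] allI impI \<delta>(2)[rule_format] a b)
    qed
    then show "\<exists>d>0. \<forall>x'\<in>{0..T}. dist x' a < d \<longrightarrow> dist (u x') (u a) < e"
    proof (intro exI[of _ \<delta>] conjI ballI impI)
      fix b assume "b \<in> {0..T}" "dist b a < \<delta>"
      then have "norm (u b - u a) \<le> e / 2" using le by (simp add: dist_real_def)
      then show "dist (u b) (u a) < e" using e unfolding dist_norm by linarith
    qed (rule \<delta>(1))
  qed
  moreover have "u ` {0..T} \<subseteq> X"
  proof
    fix y assume "y \<in> u ` {0..T}"
    then obtain a where a: "a \<in> {0..T}" "y = u a" by auto
    have "s k a \<in> X" for k
    proof -
      obtain v where "s k ` {0..T} \<subseteq> X"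
        by (rule eps_solution_implicit_euler[OF s T]) (rule that; assumption)
      with a show ?thesis by auto
    qed
    then show "y \<in> X" using closed_sequentially[OF X(2), of "\<lambda>k. s k a"] u[OF a(1)] a(2) by auto
  qed
  moreover have "u 0 = u0"
    using u[of 0] T by (simp add: s0 LIMSEQ_const_iff)
  moreover have "\<exists>n t f s. eps_solution X \<A> F T \<epsilon> n t f s \<and> (\<forall>\<tau>\<in>{0..T}. norm (u \<tau> - s \<tau>) \<le> \<epsilon>)"
    if \<epsilon>: "\<epsilon> > 0" for \<epsilon>
  proof -
    obtain \<delta> N where \<delta>: "\<delta> > 0" "\<forall>k\<ge>N. \<forall>l\<ge>N. \<forall>a\<in>{0..T}. \<forall>b\<in>{0..T}. \<bar>a - b\<bar> \<le> \<delta> \<longrightarrow> norm (s k a - s l b) \<le> \<epsilon>"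
      using key[OF \<epsilon>] by blast
    obtain M where M: "inverse (real (Suc M)) < \<epsilon>" using reals_Archimedean[OF \<epsilon>] by blast
    define k where "k = max M N"
    have "inverse (real (Suc k)) \<le> inverse (real (Suc M))" by (intro le_imp_inverse_le) (auto simp: k_def)
    also note M
    finally have "eps_solution X \<A> F T \<epsilon> (n k) (t k) (f k) (s k)"
      by (rule eps_solution_mono[OF s less_imp_le])
    moreover have "norm (u a - s k a) \<le> \<epsilon>" if a: "a \<in> {0..T}" for a
    proof (rule LIMSEQ_le_const2)
      show "(\<lambda>l. norm (s l a - s k a)) \<longlonglongrightarrow> norm (u a - s k a)"
        by (intro tendsto_intros u a)
      have "k \<ge> N" by (simp add: k_def)
      then show "\<exists>N. \<forall>l\<ge>N. norm (s l a - s k a) \<le> \<epsilon>"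
        using \<delta>(1) by (intro exI[of _ N] allI impI \<delta>(2)[rule_format] a) auto
    qed
    ultimately show ?thesis by blast
  qed
  ultimately have sol: "C0_solution X \<A> F T u0 u"
    unfolding C0_solution_def by simp
  show ?thesis by (rule exI[of _ u]) (rule sol)
qed

section \<open>Convex functions on the line and their proximal maps\<close>

definition real_subgradient :: "(real \<Rightarrow> real) \<Rightarrow> real \<Rightarrow> real set" where
  "real_subgradient g v = {u. \<forall>w. u * (w - v) \<le> g w - g v}"

text \<open>The inverse of \<open>I + \<mu> \<partial>g\<close>;
  \<open>(v - prox \<mu> g v) / \<mu>\<close> is the Yosida approximation of the
  subgradient.\<close>

definition prox :: "real \<Rightarrow> (real \<Rightarrow> real) \<Rightarrow> real \<Rightarrow> real" where
  "prox \<mu> g v = (THE w. (v - w) / \<mu> \<in> real_subgradient g w)"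

lemma real_subgradient_mono:
  assumes "u \<in> real_subgradient g v" "u' \<in> real_subgradient g v'"
  shows "0 \<le> (u - u') * (v - v')"
proof -
  have "u * (v' - v) \<le> g v' - g v" "u' * (v - v') \<le> g v - g v'"
    using assms by (auto simp: real_subgradient_def)
  then show ?thesis by (simp add: algebra_simps)
qed

text \<open>The subgradient inequality at \<open>w\<close> is added to the expansion of
  \<open>(y - v)\<^sup>2\<close> about \<open>w\<close>. Besides minimality this gives quadratic
  growth away from \<open>w\<close>, hence a strict minimum, on which the measurability proof
  relies.\<close>

lemma prox_energy_decrease:
  assumes \<mu>: "\<mu> > 0" and w: "(v - w) / \<mu> \<in> real_subgradient g w"
  shows "g w + (w - v)\<^sup>2 / (2 * \<mu>) + (y - w)\<^sup>2 / (2 * \<mu>) \<le> g y + (y - v)\<^sup>2 / (2 * \<mu>)"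
proof -
  have "(v - w) / \<mu> * (y - w) \<le> g y - g w" using w by (auto simp: real_subgradient_def)
  moreover have "(w - v)\<^sup>2 / (2 * \<mu>) + (y - w)\<^sup>2 / (2 * \<mu>) = (y - v)\<^sup>2 / (2 * \<mu>) + (v - w) / \<mu> * (y - w)"
    using \<mu> by (simp add: field_simps power2_eq_square)
  ultimately show ?thesis by linarith
qed

locale convex_potential =
  fixes g :: "real \<Rightarrow> real"
  assumes convex: "convex_on UNIV g" and nonneg: "\<And>v. 0 \<le> g v" and zero [simp]: "g 0 = 0"
begin

lemma continuous: "continuous_on S g"
  using convex_on_continuous[OF open_UNIV convex] continuous_on_subset by blast

lemma zero_in_real_subgradient: "0 \<in> real_subgradient g 0"
  using nonneg by (simp add: real_subgradient_def)

lemma real_subgradient_closed: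
  assumes "u \<longlonglongrightarrow> u'" "v \<longlonglongrightarrow> v'" "\<And>n. u n \<in> real_subgradient g (v n)"
  shows "u' \<in> real_subgradient g v'"
  unfolding real_subgradient_def
proof (rule CollectI, rule allI)
  fix w
  have "isCont g v'" using continuous[of UNIV] by (simp add: continuous_on_eq_continuous_at)
  then have "(\<lambda>n. g (v n)) \<longlonglongrightarrow> g v'" using assms(2) by (rule isCont_tendsto_compose)
  then have 1: "(\<lambda>n. g w - g (v n)) \<longlonglongrightarrow> g w - g v'" by (intro tendsto_intros)
  have 2: "(\<lambda>n. u n * (w - v n)) \<longlonglongrightarrow> u' * (w - v')" by (intro tendsto_intros assms)
  show "u' * (w - v') \<le> g w - g v'"
    by (rule LIMSEQ_le[OF 2 1]) (use assms(3) in \<open>auto simp: real_subgradient_def\<close>)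
qed

text \<open>The inclusion is the first order condition for a minimiser \<open>m\<close> of
  \<open>q\<close>: along the segment to \<open>w\<close> the change of the square is linear in
  \<open>s\<close> up to a second order remainder, and convexity bounds the change of
  \<open>g\<close> by \<open>s * (g w - g m)\<close>.\<close>

lemma prox_exists:
  assumes \<mu>: "\<mu> > 0"
  shows "\<exists>w. (v - w) / \<mu> \<in> real_subgradient g w"
proof -
  define q where "q w = g w + (w - v)\<^sup>2 / (2 * \<mu>)" for w
  \<comment> \<open>Outside this interval the quadratic term alone is at least
    \<open>v\<^sup>2 / (2 * \<mu>) = q 0\<close>, and 0 lies inside.\<close>
  have "continuous_on {v - \<bar>v\<bar>..v + \<bar>v\<bar>} q"
    unfolding q_def using \<mu> by (intro continuous_intros continuous) auto
  then obtain m where m: "m \<in> {v - \<bar>v\<bar>..v + \<bar>v\<bar>}" "\<And>w. w \<in> {v - \<bar>v\<bar>..v + \<bar>v\<bar>} \<Longrightarrow> q m \<le> q w"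
    using continuous_attains_inf[of "{v - \<bar>v\<bar>..v + \<bar>v\<bar>}" q] by auto
  have min: "q m \<le> q w" for w
  proof (cases "w \<in> {v - \<bar>v\<bar>..v + \<bar>v\<bar>}")
    case False
    then have "\<bar>v\<bar> \<le> \<bar>w - v\<bar>" by (auto simp: not_le)
    then have "v\<^sup>2 \<le> (w - v)\<^sup>2" by (simp add: abs_le_square_iff)
    then have "v\<^sup>2 / (2 * \<mu>) \<le> (w - v)\<^sup>2 / (2 * \<mu>)" using \<mu> by (intro divide_right_mono) auto
    then have "q 0 \<le> q w" using nonneg[of w] by (simp add: q_def)
    moreover have "q m \<le> q 0" by (rule m(2)) auto
    ultimately show ?thesis by simp
  qed (rule m(2))
  have "(v - m) / \<mu> * (w - m) \<le> g w - g m" for w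
  proof (rule field_le_epsilon)
    fix e :: real assume e: "e > 0"
    define c where "c = (w - m)\<^sup>2 / (2 * \<mu>)"
    have c: "c \<ge> 0" using \<mu> by (simp add: c_def)
    \<comment> \<open>Chosen so that \<open>s * c \<le> e\<close>, where \<open>s * c\<close> is the
      remainder left after division by \<open>s\<close>; the cap 1 keeps the convex combination
      admissible.\<close>
    define s where "s = min 1 (e / (c + 1))"
    have s: "0 < s" "s \<le> 1" using e c by (auto simp: s_def)
    have "s * c \<le> e / (c + 1) * (c + 1)"
      using s c e by (intro mult_mono) (auto simp: s_def)
    then have sc: "s * c \<le> e" using c by simp
    have "g ((1 - s) * m + s * w) \<le> (1 - s) * g m + s * g w"
      using convex_onD[OF convex, of s m w] s by simp
    moreover have "q m \<le> q ((1 - s) * m + s * w)" by (rule min)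
    moreover have "((1 - s) * m + s * w - v)\<^sup>2 = (m - v)\<^sup>2 + 2 * s * ((m - v) * (w - m)) + s * s * (w - m)\<^sup>2"
      by (simp add: power2_eq_square algebra_simps)
    ultimately have "g m + (m - v)\<^sup>2 / (2 * \<mu>) \<le> (1 - s) * g m + s * g w +
       ((m - v)\<^sup>2 + 2 * s * ((m - v) * (w - m)) + s * s * (w - m)\<^sup>2) / (2 * \<mu>)"
      by (simp add: q_def)
    also have "\<dots> = g m + (m - v)\<^sup>2 / (2 * \<mu>) + s * (g w - g m + (m - v) * (w - m) / \<mu> + s * c)"
      using \<mu> by (simp add: c_def field_simps)
    finally have "0 \<le> s * (g w - g m + (m - v) * (w - m) / \<mu> + s * c)" by simp
    then have "0 \<le> g w - g m + (m - v) * (w - m) / \<mu> + s * c"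
      using s(1) by (simp add: zero_le_mult_iff)
    moreover have "(m - v) * (w - m) / \<mu> = - ((v - m) / \<mu> * (w - m))"
      by (simp add: algebra_simps add_divide_distrib diff_divide_distrib)
    ultimately show "(v - m) / \<mu> * (w - m) \<le> g w - g m + e" using sc by linarith
  qed
  then show ?thesis by (auto simp: real_subgradient_def)
qed

text \<open>Monotonicity of the subgradient gives
  \<open>(w - w')\<^sup>2 \<le> (v - v') * (w - w')\<close>. Equal arguments yield uniqueness, which
  justifies the definite description in \<open>prox\<close>.\<close>

lemma prox_unique:
  assumes \<mu>: "\<mu> > 0" and w: "(v - w) / \<mu> \<in> real_subgradient g w" and w': "(v' - w') / \<mu> \<in> real_subgradient g w'"
  shows "\<bar>w - w'\<bar> \<le> \<bar>v - v'\<bar>"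
proof -
  have "0 \<le> ((v - w) / \<mu> - (v' - w') / \<mu>) * (w - w')" by (rule real_subgradient_mono[OF w w'])
  also have "\<dots> = ((v - v') * (w - w') - (w - w')\<^sup>2) / \<mu>"
    by (simp add: algebra_simps power2_eq_square add_divide_distrib diff_divide_distrib)
  finally have "(w - w')\<^sup>2 \<le> (v - v') * (w - w')" using \<mu> by (simp add: zero_le_divide_iff)
  also have "\<dots> \<le> \<bar>v - v'\<bar> * \<bar>w - w'\<bar>" by (metis abs_ge_self abs_mult)
  finally have "\<bar>w - w'\<bar> * \<bar>w - w'\<bar> \<le> \<bar>v - v'\<bar> * \<bar>w - w'\<bar>"
    by (simp only: power2_eq_square abs_mult_self_eq)
  then show ?thesis by (cases "w = w'") (simp_all del: abs_mult_self_eq)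
qed

lemma prox_in_real_subgradient:
  assumes "\<mu> > 0"
  shows "(v - prox \<mu> g v) / \<mu> \<in> real_subgradient g (prox \<mu> g v)"
  unfolding prox_def
proof (rule theI')
  show "\<exists>!w. (v - w) / \<mu> \<in> real_subgradient g w"
    using prox_exists[OF assms] prox_unique[OF assms, of v _ v] by fastforce
qed

lemma prox_nonexpansive: "\<mu> > 0 \<Longrightarrow> \<bar>prox \<mu> g v - prox \<mu> g v'\<bar> \<le> \<bar>v - v'\<bar>"
  using prox_unique prox_in_real_subgradient by blast

lemma prox_zero: "\<mu> > 0 \<Longrightarrow> prox \<mu> g 0 = 0"
  using prox_unique[of \<mu> 0 "prox \<mu> g 0" 0 0] prox_in_real_subgradient[of \<mu> 0] zero_in_real_subgradient
  by simp

lemma abs_prox_le: "\<mu> > 0 \<Longrightarrow> \<bar>prox \<mu> g v\<bar> \<le> \<bar>v\<bar>"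
  using prox_nonexpansive[of \<mu> v 0] by (simp add: prox_zero)

text \<open>A countable description of the sublevel sets of the minimiser \<open>m\<close>. The
  energy is convex with its strict minimum at \<open>m\<close>, so for \<open>a \<ge> m\<close> no
  point to the right of \<open>a\<close> has smaller energy; if \<open>a < m\<close>, a rational
  point between \<open>a\<close> and \<open>m\<close> does.\<close>

lemma prox_le_iff:
  assumes \<mu>: "\<mu> > 0"
  shows "prox \<mu> g v \<le> a \<longleftrightarrow>
    (\<forall>w\<in>\<rat>. a < w \<longrightarrow> g a + (a - v)\<^sup>2 / (2 * \<mu>) \<le> g w + (w - v)\<^sup>2 / (2 * \<mu>))"
proof -
  define q where "q w = g w + (w - v)\<^sup>2 / (2 * \<mu>)" for w
  define m where "m = prox \<mu> g v"
  have min: "q m + (y - m)\<^sup>2 / (2 * \<mu>) \<le> q y" for y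
    using prox_energy_decrease[OF \<mu> prox_in_real_subgradient[OF \<mu>]] by (simp add: q_def m_def)
  have "q m \<le> q y" for y
  proof -
    have "0 \<le> (y - m)\<^sup>2 / (2 * \<mu>)" using \<mu> by simp
    with min[of y] show ?thesis by linarith
  qed
  note min' = this
  have conv: "q ((1 - s) * x + s * y) \<le> (1 - s) * q x + s * q y" if s: "0 \<le> s" "s \<le> 1" for s x y
  proof -
    have "((1 - s) * x + s * y - v)\<^sup>2 = (1 - s) * (x - v)\<^sup>2 + s * (y - v)\<^sup>2 - s * (1 - s) * (x - y)\<^sup>2"
      by (simp add: power2_eq_square algebra_simps)
    also have "\<dots> \<le> (1 - s) * (x - v)\<^sup>2 + s * (y - v)\<^sup>2" using s by simp
    finally have "((1 - s) * x + s * y - v)\<^sup>2 / (2 * \<mu>) \<le> ((1 - s) * (x - v)\<^sup>2 + s * (y - v)\<^sup>2) / (2 * \<mu>)"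
      using \<mu> by (intro divide_right_mono) auto
    moreover have "g ((1 - s) * x + s * y) \<le> (1 - s) * g x + s * g y"
      using convex_onD[OF convex, of s x y] s by simp
    ultimately show ?thesis by (simp add: q_def add_divide_distrib distrib_left)
  qed
  have between: "\<exists>s. 0 < s \<and> s < 1 \<and> y = (1 - s) * x + s * z" if "x < y" "y < z" for x y z :: real
  proof (intro exI[of _ "(y - x) / (z - x)"] conjI)
    have "x + (y - x) / (z - x) * (z - x) = y" using that by simp
    then show "y = (1 - (y - x) / (z - x)) * x + (y - x) / (z - x) * z"
      unfolding left_diff_distrib right_diff_distrib by simp
  qed (use that in auto)
  show ?thesis unfolding m_def[symmetric] q_def[symmetric]
  proof
    assume ma: "m \<le> a"
    show "\<forall>w\<in>\<rat>. a < w \<longrightarrow> q a \<le> q w"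
    proof (intro ballI impI)
      fix w assume "a < w"
      show "q a \<le> q w"
      proof (cases "m = a")
        case True
        then show ?thesis using min' by simp
      next
        case False
        with ma have "m < a" by simp
        from between[OF this \<open>a < w\<close>] obtain s where s: "0 < s" "s < 1" "a = (1 - s) * m + s * w" by auto
        have "q a \<le> (1 - s) * q m + s * q w" using conv[of s m w] s by simp
        also have "\<dots> \<le> (1 - s) * q w + s * q w" using s min'[of w] by (intro add_mono mult_left_mono) auto
        finally show ?thesis by (simp add: algebra_simps)
      qed
    qed
  next
    assume *: "\<forall>w\<in>\<rat>. a < w \<longrightarrow> q a \<le> q w"
    show "m \<le> a"
    proof (rule ccontr)
      assume "\<not> m \<le> a"
      then have am: "a < m" by simp
      obtain w where w: "w \<in> \<rat>" "a < w" "w < m" using Rats_dense_in_real[OF am] by auto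
      from between[OF w(2,3)] obtain s where s: "0 < s" "s < 1" "w = (1 - s) * a + s * m" by auto
      have "0 < (a - m)\<^sup>2 / (2 * \<mu>)" using am \<mu> by simp
      then have "q m < q a" using min[of a] by linarith
      then have "s * q m < s * q a" using s by simp
      moreover have "q w \<le> (1 - s) * q a + s * q m" using conv[of s a m] s by simp
      ultimately have "q w < q a" by (simp add: algebra_simps)
      then show False using * w by force
    qed
  qed
qed

end

text \<open>In the countable criterion \<open>g x\<close> is evaluated only at \<open>a\<close> and
  at rationals, so measurability for each fixed argument suffices although \<open>z x\<close> varies
  with \<open>x\<close>.\<close>

lemma borel_measurable_prox:
  assumes g: "\<And>x. x \<in> space M \<Longrightarrow> convex_potential (g x)"
    and meas: "\<And>v. (\<lambda>x. g x v) \<in> borel_measurable M" and z [measurable]: "z \<in> borel_measurable M"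
    and \<mu>: "\<mu> > 0"
  shows "(\<lambda>x. prox \<mu> (g x) (z x)) \<in> borel_measurable M"
  unfolding borel_measurable_iff_le
proof
  fix a
  note meas [measurable]
  have "{x \<in> space M. prox \<mu> (g x) (z x) \<le> a} =
    {x \<in> space M. \<forall>r. a < of_rat r \<longrightarrow>
       g x a + (a - z x)\<^sup>2 / (2 * \<mu>) \<le> g x (of_rat r) + (of_rat r - z x)\<^sup>2 / (2 * \<mu>)}"
    using convex_potential.prox_le_iff[OF g \<mu>] by (auto simp: Rats_def)
  also have "\<dots> \<in> sets M"
    by measurable
  finally show "{x \<in> space M. prox \<mu> (g x) (z x) \<le> a} \<in> sets M" .
qed

lemma convex_potential_integrand:
  assumes "proper_fun h" "convex_fun h" "\<And>\<xi>. 0 \<le> h \<xi> \<and> h \<xi> < \<infinity>" "h 0 = 0"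
  shows "convex_potential (\<lambda>v. real_of_ereal (h v))"
proof
  have h: "ereal (real_of_ereal (h v)) = h v" for v using assms(3)[of v] by (simp add: ereal_real')
  show "convex_on UNIV (\<lambda>v. real_of_ereal (h v))"
  proof (rule convex_onI)
    fix t x y :: real assume t: "0 < t" "t < 1"
    obtain a b c where abc: "h x = ereal a" "h y = ereal b" "h ((1 - t) * x + t * y) = ereal c"
      using h by metis
    have "h ((1 - t) * x + t * y) \<le> ereal (1 - t) * h x + ereal t * h y"
      using assms(2) t unfolding convex_fun_def by auto
    then show "real_of_ereal (h ((1 - t) *\<^sub>R x + t *\<^sub>R y)) \<le> (1 - t) * real_of_ereal (h x) + t * real_of_ereal (h y)"
      by (simp add: abc)
  qed simp
  show "0 \<le> real_of_ereal (h v)" for v using assms(3)[of v] by (simp add: real_of_ereal_pos)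
qed (simp add: assms)

lemma subgradient_eq_real_subgradient:
  assumes "\<And>\<xi>. 0 \<le> \<phi> x \<xi> \<and> \<phi> x \<xi> < \<infinity>"
  shows "subgradient \<phi> x v = real_subgradient (\<lambda>v. real_of_ereal (\<phi> x v)) v"
proof -
  have "\<phi> x w - \<phi> x v = ereal (real_of_ereal (\<phi> x w) - real_of_ereal (\<phi> x v))" for w
    using assms[of w] assms[of v] by (cases "\<phi> x w"; cases "\<phi> x v") auto
  then show ?thesis by (simp add: subgradient_def real_subgradient_def)
qed

section \<open>The space $L^1(G)$\<close>

lemma AE_rep_plus: "AE x in lebesgue. rep_L1 (f + g) x = rep_L1 f x + rep_L1 g x"
  using AE_rep_abs_L1[of "\<lambda>x. rep_L1 f x + rep_L1 g x"] abs_L1_plus[of "rep_L1 f" "rep_L1 g"] by simp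

lemma AE_rep_minus: "AE x in lebesgue. rep_L1 (f - g) x = rep_L1 f x - rep_L1 g x"
  using AE_rep_abs_L1[of "\<lambda>x. rep_L1 f x - rep_L1 g x"] abs_L1_minus[of "rep_L1 f" "rep_L1 g"] by simp

lemma AE_rep_scaleR: "AE x in lebesgue. rep_L1 (c *\<^sub>R f) x = c * rep_L1 f x"
  using AE_rep_abs_L1[of "\<lambda>x. c * rep_L1 f x"] abs_L1_scaleR[of "rep_L1 f" c] by simp

lemma AE_rep_zero: "AE x in lebesgue. rep_L1 0 x = 0"
  using AE_rep_abs_L1[of "\<lambda>x. 0"] by (simp add: zero_L1.abs_eq)

lemma norm_L1_le:
  assumes "integrable lebesgue h" "AE x in lebesgue. \<bar>rep_L1 f x\<bar> \<le> h x"
  shows "norm f \<le> (\<integral>x. h x \<partial>lebesgue)"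
  unfolding norm_L1_eq using assms by (intro integral_mono_AE) auto

lemma norm_L1_mono:
  assumes "AE x in lebesgue. \<bar>rep_L1 f x\<bar> \<le> \<bar>rep_L1 g x\<bar>"
  shows "norm f \<le> norm g"
  unfolding norm_L1_eq[of g] using assms by (intro norm_L1_le) auto

lemma norm_L1_diff_eq: "norm (f - g) = (\<integral>x. \<bar>rep_L1 f x - rep_L1 g x\<bar> \<partial>lebesgue)"
proof -
  have "AE x in lebesgue. \<bar>rep_L1 (f - g) x\<bar> = \<bar>rep_L1 f x - rep_L1 g x\<bar>"
    using AE_rep_minus[of f g] by eventually_elim simp
  then show ?thesis unfolding norm_L1_eq by (intro integral_cong_AE) auto
qed

lemma L1_tendsto_AE_subseq:
  assumes "f \<longlonglongrightarrow> g"
  obtains r where "strict_mono r" "AE x in lebesgue. (\<lambda>n. rep_L1 (f (r n)) x) \<longlonglongrightarrow> rep_L1 g x"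
proof -
  have "(\<lambda>n. norm (f n - g)) \<longlonglongrightarrow> 0"
    using assms by (simp add: LIM_zero tendsto_norm_zero)
  then have "(\<lambda>n. \<integral>x. norm (rep_L1 (f n) x - rep_L1 g x) \<partial>lebesgue) \<longlonglongrightarrow> 0"
    by (simp add: norm_L1_diff_eq)
  then obtain r where r: "strict_mono r"
    "AE x in lebesgue. (\<lambda>n. rep_L1 (f (r n)) x - rep_L1 g x) \<longlonglongrightarrow> 0"
    using tendsto_L1_AE_subseq[of lebesgue "\<lambda>n x. rep_L1 (f n) x - rep_L1 g x"] by auto
  from r(2) have "AE x in lebesgue. (\<lambda>n. rep_L1 (f (r n)) x) \<longlonglongrightarrow> rep_L1 g x"
    by eventually_elim (simp add: LIM_zero_iff)
  with r(1) show thesis by (rule that)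
qed

lemma AE_closed_L1:
  assumes lim: "f \<longlonglongrightarrow> g" and "\<And>n. AE x in lebesgue. x \<in> S \<longrightarrow> rep_L1 (f n) x \<in> C x"
    and cl: "\<And>x. x \<in> S \<Longrightarrow> closed (C x)"
  shows "AE x in lebesgue. x \<in> S \<longrightarrow> rep_L1 g x \<in> C x"
proof -
  obtain r where r: "strict_mono r" "AE x in lebesgue. (\<lambda>n. rep_L1 (f (r n)) x) \<longlonglongrightarrow> rep_L1 g x"
    by (rule L1_tendsto_AE_subseq[OF lim])
  have "AE x in lebesgue. \<forall>n. x \<in> S \<longrightarrow> rep_L1 (f n) x \<in> C x"
    using assms(2) by (subst AE_all_countable) blast
  with r(2) show ?thesis
  proof eventually_elim
    case (elim x)
    then show ?case using closed_sequentially[OF cl, of x "\<lambda>n. rep_L1 (f (r n)) x"] by blast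
  qed
qed

lemma subspace_L1_on: "subspace (L1_on G)"
proof (rule subspaceI)
  have "AE x in lebesgue. x \<notin> G \<longrightarrow> rep_L1 (0::'a L1) x = 0"
    using AE_rep_zero by eventually_elim simp
  then show "0 \<in> L1_on G" by (simp add: L1_on_def)
  fix f g :: "'a L1" and c :: real
  assume f: "f \<in> L1_on G"
  {
    assume "g \<in> L1_on G"
    with f have "AE x in lebesgue. x \<notin> G \<longrightarrow> rep_L1 f x = 0" "AE x in lebesgue. x \<notin> G \<longrightarrow> rep_L1 g x = 0"
      by (auto simp: L1_on_def)
    with AE_rep_plus[of f g] have "AE x in lebesgue. x \<notin> G \<longrightarrow> rep_L1 (f + g) x = 0"
      by eventually_elim auto
    then show "f + g \<in> L1_on G" by (simp add: L1_on_def)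
  }
  from f have "AE x in lebesgue. x \<notin> G \<longrightarrow> rep_L1 f x = 0" by (auto simp: L1_on_def)
  with AE_rep_scaleR[of c f] have "AE x in lebesgue. x \<notin> G \<longrightarrow> rep_L1 (c *\<^sub>R f) x = 0"
    by eventually_elim auto
  then show "c *\<^sub>R f \<in> L1_on G" by (simp add: L1_on_def)
qed

lemma closed_L1_on: "closed (L1_on G)"
  unfolding closed_sequential_limits
proof (intro allI impI, elim conjE)
  fix f :: "nat \<Rightarrow> 'a L1" and g assume f: "\<forall>n. f n \<in> L1_on G" and lim: "f \<longlonglongrightarrow> g"
  have "AE x in lebesgue. x \<in> - G \<longrightarrow> rep_L1 (f n) x \<in> {0}" for n
    using f by (simp add: L1_on_def)
  then have "AE x in lebesgue. x \<in> - G \<longrightarrow> rep_L1 g x \<in> {0}"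
    by (rule AE_closed_L1[OF lim]) simp
  then show "g \<in> L1_on G" by (simp add: L1_on_def)
qed

text \<open>\<open>h\<close> is meaningful on \<open>G\<close> only; the indicator extends it by
  zero, and integrability of the product is supplied at each use.\<close>

definition restrict_L1 :: "'a::euclidean_space set \<Rightarrow> ('a \<Rightarrow> real) \<Rightarrow> 'a L1" where
  "restrict_L1 G h = abs_L1 (\<lambda>x. indicator G x * h x)"

lemma AE_rep_restrict_L1:
  assumes "integrable lebesgue (\<lambda>x. indicator G x * h x)"
  shows "AE x in lebesgue. rep_L1 (restrict_L1 G h) x = indicator G x * h x"
  unfolding restrict_L1_def by (rule AE_rep_abs_L1[OF assms])

lemma restrict_L1_in_L1_on:
  assumes "integrable lebesgue (\<lambda>x. indicator G x * h x)"
  shows "restrict_L1 G h \<in> L1_on G"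
proof -
  have "AE x in lebesgue. x \<notin> G \<longrightarrow> rep_L1 (restrict_L1 G h) x = 0"
    using AE_rep_restrict_L1[OF assms] by eventually_elim simp
  then show ?thesis by (simp add: L1_on_def)
qed

lemma integrable_indicator_dominated:
  fixes h w :: "'a::euclidean_space \<Rightarrow> real"
  assumes G: "G \<in> sets lebesgue" and h: "h \<in> borel_measurable (lebesgue_on G)"
    and w: "integrable lebesgue w" and le: "AE x in lebesgue. x \<in> G \<longrightarrow> \<bar>h x\<bar> \<le> \<bar>w x\<bar>"
  shows "integrable lebesgue (\<lambda>x. indicator G x * h x)"
proof (rule Bochner_Integration.integrable_bound[OF w])
  have "(\<lambda>x. indicator G x *\<^sub>R h x) \<in> borel_measurable lebesgue"
    using h G by (subst borel_measurable_restrict_space_iff[symmetric]) auto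
  then show "(\<lambda>x. indicator G x * h x) \<in> borel_measurable lebesgue" by simp
  show "AE x in lebesgue. norm (indicator G x * h x) \<le> norm (w x)"
    using le by eventually_elim (auto simp: indicator_def)
qed

text \<open>Duality of L^1 with bounded functions. A plain function \<alpha> can be a selection of
  signs or \<open>rep_L1 z\<close> for a bounded \<open>z\<close>; in the second case this is the
  L^2 product, available without leaving L^1.\<close>

definition pairing :: "('a::euclidean_space \<Rightarrow> real) \<Rightarrow> 'a L1 \<Rightarrow> real" where
  "pairing \<alpha> f = (\<integral>x. \<alpha> x * rep_L1 f x \<partial>lebesgue)"

context
  fixes \<alpha> :: "'a::euclidean_space \<Rightarrow> real" and C :: real
  assumes \<alpha> [measurable]: "\<alpha> \<in> borel_measurable lebesgue" and le: "AE x in lebesgue. \<bar>\<alpha> x\<bar> \<le> C"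
begin

lemma integrable_pairing: "integrable lebesgue (\<lambda>x. \<alpha> x * rep_L1 f x)"
proof (rule Bochner_Integration.integrable_bound[where f = "\<lambda>x. C * \<bar>rep_L1 f x\<bar>"])
  show "AE x in lebesgue. norm (\<alpha> x * rep_L1 f x) \<le> norm (C * \<bar>rep_L1 f x\<bar>)"
    using le by eventually_elim (auto simp: abs_mult intro!: mult_right_mono)
qed auto

lemma pairing_add: "pairing \<alpha> (f + g) = pairing \<alpha> f + pairing \<alpha> g"
proof -
  have "AE x in lebesgue. \<alpha> x * rep_L1 (f + g) x = \<alpha> x * rep_L1 f x + \<alpha> x * rep_L1 g x"
    using AE_rep_plus[of f g] by eventually_elim (simp add: distrib_left)
  then have "pairing \<alpha> (f + g) = (\<integral>x. \<alpha> x * rep_L1 f x + \<alpha> x * rep_L1 g x \<partial>lebesgue)"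
    unfolding pairing_def by (intro integral_cong_AE) auto
  then show ?thesis using integrable_pairing[of f] integrable_pairing[of g] by (simp add: pairing_def)
qed

lemma pairing_scaleR: "pairing \<alpha> (c *\<^sub>R f) = c * pairing \<alpha> f"
proof -
  have "AE x in lebesgue. \<alpha> x * rep_L1 (c *\<^sub>R f) x = c * (\<alpha> x * rep_L1 f x)"
    using AE_rep_scaleR[of c f] by eventually_elim simp
  then have "pairing \<alpha> (c *\<^sub>R f) = (\<integral>x. c * (\<alpha> x * rep_L1 f x) \<partial>lebesgue)"
    unfolding pairing_def by (intro integral_cong_AE) auto
  then show ?thesis by (simp add: pairing_def)
qed

lemma pairing_diff: "pairing \<alpha> (f - g) = pairing \<alpha> f - pairing \<alpha> g"
  using pairing_add[of f "- g"] pairing_scaleR[of "-1" g] by simp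

lemma abs_pairing_le: "\<bar>pairing \<alpha> f\<bar> \<le> C * norm f"
proof -
  have "\<bar>pairing \<alpha> f\<bar> \<le> (\<integral>x. \<bar>\<alpha> x * rep_L1 f x\<bar> \<partial>lebesgue)"
    unfolding pairing_def by (rule integral_abs_bound)
  also have "\<dots> \<le> (\<integral>x. C * \<bar>rep_L1 f x\<bar> \<partial>lebesgue)"
  proof (rule integral_mono_AE)
    show "AE x in lebesgue. \<bar>\<alpha> x * rep_L1 f x\<bar> \<le> C * \<bar>rep_L1 f x\<bar>"
      using le by eventually_elim (auto simp: abs_mult intro!: mult_right_mono)
  qed (use integrable_pairing in auto)
  finally show ?thesis by (simp add: norm_L1_eq)
qed

lemma tendsto_pairing:
  assumes "f \<longlonglongrightarrow> g"
  shows "(\<lambda>n. pairing \<alpha> (f n)) \<longlonglongrightarrow> pairing \<alpha> g"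
proof -
  have "(\<lambda>n. norm (f n - g)) \<longlonglongrightarrow> 0"
    using assms by (simp add: LIM_zero tendsto_norm_zero)
  then have "(\<lambda>n. C * norm (f n - g)) \<longlonglongrightarrow> C * 0" by (intro tendsto_intros)
  then have lim: "(\<lambda>n. C * norm (f n - g)) \<longlonglongrightarrow> 0" by simp
  have "(\<lambda>n. pairing \<alpha> (f n) - pairing \<alpha> g) \<longlonglongrightarrow> 0"
  proof (rule Lim_null_comparison[OF always_eventually lim], rule allI)
    show "norm (pairing \<alpha> (f n) - pairing \<alpha> g) \<le> C * norm (f n - g)" for n
      using abs_pairing_le[of "f n - g"] by (simp add: pairing_diff)
  qed
  then show ?thesis by (simp add: LIM_zero_iff)
qed

end

lemma norm_eq_pairing:
  assumes "\<alpha> \<in> borel_measurable lebesgue" "AE x in lebesgue. \<alpha> x * rep_L1 f x = \<bar>rep_L1 f x\<bar>"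
  shows "pairing \<alpha> f = norm f"
  unfolding pairing_def norm_L1_eq
  by (rule integral_cong_AE[OF borel_measurable_times[OF assms(1) borel_measurable_rep_L1]
      borel_measurable_abs[OF borel_measurable_rep_L1] assms(2)])

section \<open>Linear m-accretive operators with the maximum principle\<close>

locale L1_operator =
  fixes G :: "'a::euclidean_space set" and D :: "'a L1 set" and A :: "'a L1 \<Rightarrow> 'a L1"
  assumes G: "open G" "bounded G"
    and lin: "linear_operator (L1_on G) D A"
    and dense: "L1_on G \<subseteq> closure D"
    and bij: "\<And>l. l > 0 \<Longrightarrow> bij_betw (\<lambda>v. v + l *\<^sub>R A v) D (L1_on G)"
    and contr: "\<And>l. l > 0 \<Longrightarrow> 1-lipschitz_on (L1_on G) (resolvent D A l)"
    and sup: "\<And>f l. f \<in> L1_on G \<Longrightarrow> l > 0 \<Longrightarrow> sup_on G (resolvent D A l f) \<le> max (sup_on G f) 0"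
begin

abbreviation J :: "real \<Rightarrow> 'a L1 \<Rightarrow> 'a L1" where "J \<equiv> resolvent D A"
abbreviation X :: "'a L1 set" where "X \<equiv> L1_on G"

lemma G_lmeasurable: "G \<in> lmeasurable" using G by (intro lmeasurable_open)

lemma G_sets [measurable, simp]: "G \<in> sets lebesgue" using G_lmeasurable by auto

lemma AE_on_G: "(AE x in lebesgue_on G. P x) \<longleftrightarrow> (AE x in lebesgue. x \<in> G \<longrightarrow> P x)"
  by (simp add: AE_restrict_space_iff)

lemma integrable_indicator_G: "integrable lebesgue (indicator G :: 'a \<Rightarrow> real)"
  using G_lmeasurable by (simp add: integrable_on_indicator lmeasurable_iff_integrable)

lemma D_X: "v \<in> D \<Longrightarrow> v \<in> X" and A_X: "v \<in> D \<Longrightarrow> A v \<in> X"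
  and D_add: "u \<in> D \<Longrightarrow> v \<in> D \<Longrightarrow> u + v \<in> D" and D_scale: "v \<in> D \<Longrightarrow> c *\<^sub>R v \<in> D"
  and D_zero: "0 \<in> D"
  and A_add: "u \<in> D \<Longrightarrow> v \<in> D \<Longrightarrow> A (u + v) = A u + A v" and A_scale: "v \<in> D \<Longrightarrow> A (c *\<^sub>R v) = c *\<^sub>R A v"
  using lin unfolding linear_operator_def subspace_def by auto

lemma D_diff: "u \<in> D \<Longrightarrow> v \<in> D \<Longrightarrow> u - v \<in> D"
  using D_add[OF _ D_scale, of u v "-1"] by simp

lemma A_diff: "u \<in> D \<Longrightarrow> v \<in> D \<Longrightarrow> A (u - v) = A u - A v"
  using A_add[OF _ D_scale, of u v "-1"] A_scale[of v "-1"] by simp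

lemma A_zero: "A 0 = 0"
  using A_scale[OF D_zero, of 0] by simp

lemma X_add: "u \<in> X \<Longrightarrow> v \<in> X \<Longrightarrow> u + v \<in> X" and X_diff: "u \<in> X \<Longrightarrow> v \<in> X \<Longrightarrow> u - v \<in> X"
  and X_scale: "v \<in> X \<Longrightarrow> c *\<^sub>R v \<in> X" and X_zero: "0 \<in> X"
  using subspace_L1_on[of G] by (auto intro: subspace_add subspace_diff subspace_scale subspace_0)

lemma J_unique: "l > 0 \<Longrightarrow> v \<in> D \<Longrightarrow> J l (v + l *\<^sub>R A v) = v"
  unfolding resolvent_def using bij[of l] by (intro the_inv_into_f_f) (auto simp: bij_betw_def)

lemma J_props:
  assumes "l > 0" "f \<in> X"
  shows "J l f \<in> D" "J l f + l *\<^sub>R A (J l f) = f"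
proof -
  obtain v where "v \<in> D" "f = v + l *\<^sub>R A v" using bij[OF assms(1)] assms(2) by (auto simp: bij_betw_def)
  then show "J l f \<in> D" "J l f + l *\<^sub>R A (J l f) = f" using J_unique[OF assms(1)] by auto
qed

lemma J_X: "l > 0 \<Longrightarrow> f \<in> X \<Longrightarrow> J l f \<in> X"
  using J_props D_X by blast

lemma J_add:
  assumes "l > 0" "f \<in> X" "g \<in> X"
  shows "J l (f + g) = J l f + J l g"
proof -
  note f = J_props[OF assms(1,2)] and g = J_props[OF assms(1,3)]
  have "J l f + J l g + l *\<^sub>R A (J l f + J l g) = (J l f + l *\<^sub>R A (J l f)) + (J l g + l *\<^sub>R A (J l g))"
    using f(1) g(1) by (simp add: A_add scaleR_add_right)
  then show ?thesis
    using J_unique[OF assms(1) D_add[OF f(1) g(1)]] f(2) g(2) by simp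
qed

lemma J_scale:
  assumes "l > 0" "f \<in> X"
  shows "J l (c *\<^sub>R f) = c *\<^sub>R J l f"
proof -
  have "c *\<^sub>R J l f + l *\<^sub>R A (c *\<^sub>R J l f) = c *\<^sub>R (J l f + l *\<^sub>R A (J l f))"
    by (simp add: A_scale[OF J_props(1)[OF assms]] scaleR_add_right mult.commute)
  then show ?thesis
    using J_unique[OF assms(1) D_scale[OF J_props(1)[OF assms]], of c] J_props(2)[OF assms] by simp
qed

lemma J_diff: "l > 0 \<Longrightarrow> f \<in> X \<Longrightarrow> g \<in> X \<Longrightarrow> J l (f - g) = J l f - J l g"
  using J_add[of l f "(-1) *\<^sub>R g"] J_scale[of l g "-1"] X_scale[of g "-1"] by simp

lemma J_zero: "l > 0 \<Longrightarrow> J l 0 = 0"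
  using J_unique[of l 0] by (simp add: D_zero A_zero)

lemma norm_J_le: "l > 0 \<Longrightarrow> f \<in> X \<Longrightarrow> norm (J l f) \<le> norm f"
  using lipschitz_onD[OF contr, of l f 0] by (simp add: X_zero J_zero)

text \<open>\<open>A\<close> commutes with its resolvent on \<open>D\<close>:
  \<open>A w = (z - w) / l\<close> lies in \<open>D\<close> again, so \<open>A\<close> can be
  applied to \<open>w + l *\<^sub>R A w = z\<close>. The quotient \<open>(z - J l z) / l\<close> is
  thus \<open>J l (A z)\<close>, which tends to \<open>A z\<close>; in this way contraction
  properties of \<open>J\<close> become sign properties of \<open>A\<close>.\<close>

lemma diff_J:
  assumes l: "l > 0" and z: "z \<in> D"
  shows "z - J l z = l *\<^sub>R J l (A z)"
proof -
  define w where "w = J l z"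
  have w: "w \<in> D" "w + l *\<^sub>R A w = z" using J_props[OF l D_X[OF z]] by (auto simp: w_def)
  then have lw: "l *\<^sub>R A w = z - w" by (simp add: eq_diff_eq add.commute)
  then have "A w = inverse l *\<^sub>R (z - w)" using l by (simp flip: lw)
  then have Aw: "A w \<in> D" using D_scale[OF D_diff[OF z w(1)]] by simp
  have "A z = A (w + l *\<^sub>R A w)" by (simp add: w(2))
  also have "\<dots> = A w + l *\<^sub>R A (A w)" using w(1) Aw by (simp add: A_add A_scale D_scale)
  finally have "A z = A w + l *\<^sub>R A (A w)" .
  then have "J l (A z) = A w" using J_unique[OF l Aw] by simp
  then show ?thesis using lw by (simp add: w_def)
qed

text \<open>On \<open>D\<close> the error is at most \<open>l * norm (A z)\<close>; contractivity,
  uniform in \<open>l\<close>, carries the convergence to the closure of \<open>D\<close>.\<close>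

lemma J_tendsto:
  assumes f: "f \<in> X"
  shows "(\<lambda>n. J (inverse (real (Suc n))) f) \<longlonglongrightarrow> f"
proof (rule LIMSEQ_I)
  fix e :: real assume e: "e > 0"
  have "f \<in> closure D" using dense f by blast
  from this[unfolded closure_approachable, rule_format, of "e / 4"] e
  obtain z where z: "z \<in> D" "dist z f < e / 4" by auto
  have zf: "norm (z - f) < e / 4" using z by (simp add: dist_norm)
  have nA: "norm (A z) + 1 > 0" by (simp add: add_nonneg_pos)
  obtain N where N: "inverse (real (Suc N)) < e / 4 / (norm (A z) + 1)"
    using reals_Archimedean[of "e / 4 / (norm (A z) + 1)"] e nA by auto
  have "norm (J (inverse (real (Suc n))) f - f) < e" if n: "n \<ge> N" for n
  proof -
    define l where "l = inverse (real (Suc n))"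
    have l: "l > 0" by (simp add: l_def)
    have "l \<le> inverse (real (Suc N))" unfolding l_def using n by (intro le_imp_inverse_le) auto
    with N have "l < e / 4 / (norm (A z) + 1)" by simp
    then have "l * (norm (A z) + 1) < e / 4" using nA by (simp only: pos_less_divide_eq)
    then have lA: "l * norm (A z) < e / 4" using l by (simp add: distrib_left)
    have "norm (z - J l z) = l * norm (J l (A z))" using diff_J[OF l z(1)] l by simp
    also have "\<dots> \<le> l * norm (A z)" using norm_J_le[OF l A_X[OF z(1)]] l by simp
    finally have 1: "norm (z - J l z) \<le> l * norm (A z)" .
    have 2: "norm (J l f - J l z) \<le> norm (f - z)"
      using norm_J_le[OF l X_diff[OF f D_X[OF z(1)]]] J_diff[OF l f D_X[OF z(1)]] by simp
    have "norm (J l f - f) \<le> norm (J l f - J l z) + norm (z - J l z) + norm (z - f)"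
      using norm_triangle_ineq4[of "J l f - J l z" "z - J l z"]
        norm_triangle_ineq[of "(J l f - J l z) - (z - J l z)" "z - f"] by simp
    then show ?thesis unfolding l_def[symmetric] using 1 2 lA zf e norm_minus_commute[of f z] by linarith
  qed
  then show "\<exists>N. \<forall>n\<ge>N. norm (J (inverse (real (Suc n))) f - f) < e" by (intro exI[of _ N] allI impI)
qed

text \<open>Here linearity is essential: as \<open>A z = lim (z - J l z) / l\<close>, the inequality holds for
  \<^emph>\<open>every\<close> selection \<open>\<alpha>\<close> of the sign of \<open>z\<close>, also on the set where \<open>z\<close> vanishes.\<close>

lemma pairing_sgn_A_nonneg:
  assumes z: "z \<in> D" and \<alpha>: "\<alpha> \<in> borel_measurable lebesgue" "AE x in lebesgue. \<bar>\<alpha> x\<bar> \<le> 1"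
    and sgn: "AE x in lebesgue. \<alpha> x * rep_L1 z x = \<bar>rep_L1 z x\<bar>"
  shows "0 \<le> pairing \<alpha> (A z)"
proof (rule LIMSEQ_le_const[OF tendsto_pairing[OF \<alpha> J_tendsto[OF A_X[OF z]]]])
  have "0 \<le> pairing \<alpha> (J l (A z))" if l: "l > 0" for l
  proof -
    have "pairing \<alpha> (J l z) \<le> norm (J l z)" using abs_pairing_le[OF \<alpha>, of "J l z"] by simp
    also have "\<dots> \<le> norm z" by (rule norm_J_le[OF l D_X[OF z]])
    also have "\<dots> = pairing \<alpha> z" by (rule norm_eq_pairing[OF \<alpha>(1) sgn, symmetric])
    finally have "0 \<le> pairing \<alpha> (z - J l z)" by (simp add: pairing_diff[OF \<alpha>])
    then have "0 \<le> l * pairing \<alpha> (J l (A z))" using diff_J[OF l z] by (simp add: pairing_scaleR[OF \<alpha>])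
    then show ?thesis using l by (simp add: zero_le_mult_iff)
  qed
  then show "\<exists>N. \<forall>n\<ge>N. 0 \<le> pairing \<alpha> (J (inverse (real (Suc n))) (A z))" by simp
qed

text \<open>\<open>z n = J 1 (z n + A (z n))\<close>, and \<open>J 1\<close> is continuous.\<close>

lemma A_closed:
  assumes z: "\<And>n. z n \<in> D" and lim: "z \<longlonglongrightarrow> z'" "(\<lambda>n. A (z n)) \<longlonglongrightarrow> w"
  shows "z' \<in> D" "A z' = w"
proof -
  have X: "z' \<in> X" "w \<in> X"
    by (rule closed_sequentially[OF closed_L1_on _ lim(1)], rule D_X[OF z])
      (rule closed_sequentially[OF closed_L1_on _ lim(2)], rule A_X[OF z])
  have "continuous_on X (J 1)" by (rule lipschitz_on_continuous_on[OF contr]) simp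
  moreover have "(\<lambda>n. z n + A (z n)) \<longlonglongrightarrow> z' + w" by (rule tendsto_add[OF lim])
  moreover have "\<forall>\<^sub>F n in sequentially. z n + A (z n) \<in> X"
    using X_add[OF D_X[OF z] A_X[OF z]] by (rule always_eventually[OF allI])
  ultimately have "(\<lambda>n. J 1 (z n + A (z n))) \<longlonglongrightarrow> J 1 (z' + w)"
    by (rule continuous_on_tendsto_compose[OF _ _ X_add[OF X]])
  moreover have "J 1 (z n + A (z n)) = z n" for n using J_unique[OF zero_less_one z, of n] by simp
  ultimately have "z \<longlonglongrightarrow> J 1 (z' + w)" by simp
  then have eq: "J 1 (z' + w) = z'" using lim(1) by (rule LIMSEQ_unique)
  have "J 1 (z' + w) \<in> D" "J 1 (z' + w) + 1 *\<^sub>R A (J 1 (z' + w)) = z' + w"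
    by (rule J_props[OF zero_less_one X_add[OF X]])+
  then show "z' \<in> D" "A z' = w" unfolding eq by simp_all
qed

section \<open>Order properties of the resolvent and monotonicity in L^2\<close>

lemma J_le_const:
  assumes l: "l > 0" and f: "f \<in> X" and C: "C \<ge> 0" and le: "AE x in lebesgue. x \<in> G \<longrightarrow> rep_L1 f x \<le> C"
  shows "AE x in lebesgue. x \<in> G \<longrightarrow> rep_L1 (J l f) x \<le> C"
proof -
  have "rep_L1 f \<in> borel_measurable (lebesgue_on G)" by (intro measurable_restrict_space1) simp
  then have "sup_on G f \<le> ereal C"
    unfolding sup_on_def using le by (intro esssup_I) (auto simp: AE_on_G)
  then have le': "sup_on G (J l f) \<le> ereal C"
    using sup[OF f l] C by (auto simp: max_def zero_ereal_def split: if_splits intro: order_trans)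
  have "AE x in lebesgue_on G. ereal (rep_L1 (J l f) x) \<le> sup_on G (J l f)"
    unfolding sup_on_def by (rule esssup_AE)
  then have "AE x in lebesgue_on G. ereal (rep_L1 (J l f) x) \<le> ereal C"
  proof eventually_elim
    case (elim x)
    then show ?case using le' by (rule order_trans)
  qed
  then have "AE x in lebesgue_on G. rep_L1 (J l f) x \<le> C" by simp
  then show ?thesis by (simp add: AE_on_G)
qed

text \<open>The upper bound with constant 0, applied to the negative of \<open>f\<close>.\<close>

lemma J_nonneg:
  assumes l: "l > 0" and f: "f \<in> X" and le: "AE x in lebesgue. x \<in> G \<longrightarrow> 0 \<le> rep_L1 f x"
  shows "AE x in lebesgue. x \<in> G \<longrightarrow> 0 \<le> rep_L1 (J l f) x"
proof -
  have "AE x in lebesgue. x \<in> G \<longrightarrow> rep_L1 ((-1) *\<^sub>R f) x \<le> 0"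
    using le AE_rep_scaleR[of "-1" f] by eventually_elim auto
  then have "AE x in lebesgue. x \<in> G \<longrightarrow> rep_L1 (J l ((-1) *\<^sub>R f)) x \<le> 0"
    by (intro J_le_const[OF l X_scale[OF f]]) auto
  with AE_rep_scaleR[of "-1" "J l f"] show ?thesis
    unfolding J_scale[OF l f] by eventually_elim auto
qed

lemma J_abs_le:
  assumes l: "l > 0" and f: "f \<in> X" and C: "C \<ge> 0" and le: "AE x in lebesgue. x \<in> G \<longrightarrow> \<bar>rep_L1 f x\<bar> \<le> C"
  shows "AE x in lebesgue. x \<in> G \<longrightarrow> \<bar>rep_L1 (J l f) x\<bar> \<le> C"
proof -
  have "AE x in lebesgue. x \<in> G \<longrightarrow> rep_L1 f x \<le> C" using le by eventually_elim auto
  then have 1: "AE x in lebesgue. x \<in> G \<longrightarrow> rep_L1 (J l f) x \<le> C" by (rule J_le_const[OF l f C])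
  have "AE x in lebesgue. x \<in> G \<longrightarrow> rep_L1 ((-1) *\<^sub>R f) x \<le> C"
    using le AE_rep_scaleR[of "-1" f] by eventually_elim auto
  then have "AE x in lebesgue. x \<in> G \<longrightarrow> rep_L1 (J l ((-1) *\<^sub>R f)) x \<le> C"
    by (rule J_le_const[OF l X_scale[OF f] C])
  with AE_rep_scaleR[of "-1" "J l f"] 1 show ?thesis
    unfolding J_scale[OF l f] by eventually_elim auto
qed

lemma X_zero_outside: "f \<in> X \<Longrightarrow> AE x in lebesgue. x \<notin> G \<longrightarrow> rep_L1 f x = 0"
  by (simp add: L1_on_def)

text \<open>\<open>(J z)\<^sup>2 \<le> J (z\<^sup>2)\<close> holds because \<open>z\<^sup>2\<close> is the supremum of the affine functions \<open>2 a z - a\<^sup>2\<close>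
  and \<open>J\<close> is positive with \<open>J 1 \<le> 1\<close>; countably many \<open>a\<close> suffice.\<close>

lemma J_square_le:
  assumes l: "l > 0" and z: "z \<in> X" and z2: "z2 \<in> X"
    and eq: "AE x in lebesgue. rep_L1 z2 x = (rep_L1 z x)\<^sup>2"
  shows "AE x in lebesgue. x \<in> G \<longrightarrow> (rep_L1 (J l z) x)\<^sup>2 \<le> rep_L1 (J l z2) x"
proof -
  define one where "one = restrict_L1 G (\<lambda>x. 1)"
  have one: "one \<in> X" "AE x in lebesgue. rep_L1 one x = indicator G x"
    using restrict_L1_in_L1_on[of G "\<lambda>x. 1"] AE_rep_restrict_L1[of G "\<lambda>x. 1"] integrable_indicator_G
    by (auto simp: one_def)
  have J1: "AE x in lebesgue. x \<in> G \<longrightarrow> rep_L1 (J l one) x \<le> 1"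
  proof (rule J_le_const[OF l one(1)])
    show "AE x in lebesgue. x \<in> G \<longrightarrow> rep_L1 one x \<le> 1" using one(2) by eventually_elim simp
  qed simp
  have "AE x in lebesgue. x \<in> G \<longrightarrow> 0 \<le> rep_L1 (J l z2) x - 2 * a * rep_L1 (J l z) x + a\<^sup>2" for a
  proof -
    define w where "w = z2 + ((- 2 * a) *\<^sub>R z + a\<^sup>2 *\<^sub>R one)"
    have wX: "w \<in> X" unfolding w_def by (intro X_add X_scale z z2 one(1))
    have "AE x in lebesgue. x \<in> G \<longrightarrow> 0 \<le> rep_L1 w x"
      unfolding w_def
      using AE_rep_plus[of z2 "(- 2 * a) *\<^sub>R z + a\<^sup>2 *\<^sub>R one"] AE_rep_plus[of "(- 2 * a) *\<^sub>R z" "a\<^sup>2 *\<^sub>R one"]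
        AE_rep_scaleR[of "- 2 * a" z] AE_rep_scaleR[of "a\<^sup>2" one] one(2) eq
    proof eventually_elim
      case (elim x)
      show ?case
      proof
        assume "x \<in> G"
        then have "(rep_L1 z x)\<^sup>2 + (- 2 * a * rep_L1 z x + a\<^sup>2 * indicator G x) = (rep_L1 z x - a)\<^sup>2"
          by (simp add: power2_diff)
        moreover have "rep_L1 (z2 + ((- 2 * a) *\<^sub>R z + a\<^sup>2 *\<^sub>R one)) x
          = (rep_L1 z x)\<^sup>2 + (- 2 * a * rep_L1 z x + a\<^sup>2 * indicator G x)"
          by (simp only: elim)
        ultimately show "0 \<le> rep_L1 (z2 + ((- 2 * a) *\<^sub>R z + a\<^sup>2 *\<^sub>R one)) x"
          by (simp only: zero_le_power2)
      qed
    qed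
    then have "AE x in lebesgue. x \<in> G \<longrightarrow> 0 \<le> rep_L1 (J l w) x"
      by (rule J_nonneg[OF l wX])
    moreover have "J l w = J l z2 + ((- 2 * a) *\<^sub>R J l z + a\<^sup>2 *\<^sub>R J l one)"
      unfolding w_def using l z z2 one(1) by (simp only: J_add J_scale X_add X_scale)
    ultimately have Jw: "AE x in lebesgue. x \<in> G \<longrightarrow> 0 \<le> rep_L1 (J l z2 + ((- 2 * a) *\<^sub>R J l z + a\<^sup>2 *\<^sub>R J l one)) x"
      by (simp only:)
    from AE_rep_plus[of "J l z2" "(- 2 * a) *\<^sub>R J l z + a\<^sup>2 *\<^sub>R J l one"]
      AE_rep_plus[of "(- 2 * a) *\<^sub>R J l z" "a\<^sup>2 *\<^sub>R J l one"]
      AE_rep_scaleR[of "- 2 * a" "J l z"] AE_rep_scaleR[of "a\<^sup>2" "J l one"] J1 Jw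
    show ?thesis
    proof eventually_elim
      case (elim x)
      show ?case
      proof
        assume "x \<in> G"
        then have "a\<^sup>2 * rep_L1 (J l one) x \<le> a\<^sup>2 * 1" using elim(5) by (intro mult_left_mono) auto
        moreover have "0 \<le> rep_L1 (J l z2) x + (- 2 * a * rep_L1 (J l z) x + a\<^sup>2 * rep_L1 (J l one) x)"
          using elim(6) \<open>x \<in> G\<close> by (simp only: elim(1-4))
        ultimately show "0 \<le> rep_L1 (J l z2) x - 2 * a * rep_L1 (J l z) x + a\<^sup>2" by simp
      qed
    qed
  qed
  then have "AE x in lebesgue. \<forall>r. x \<in> G \<longrightarrow>
      0 \<le> rep_L1 (J l z2) x - 2 * of_rat r * rep_L1 (J l z) x + (of_rat r)\<^sup>2"
    by (subst AE_all_countable) blast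
  then show ?thesis
  proof eventually_elim
    case (elim x)
    show ?case
    proof
      assume x: "x \<in> G"
      define q where "q = rep_L1 (J l z) x"
      have "q \<in> closure \<rat>" by (simp add: Rats_closure_real)
      then obtain a where a: "\<And>n. a n \<in> \<rat>" "a \<longlonglongrightarrow> q" unfolding closure_sequential by blast
      have "0 \<le> rep_L1 (J l z2) x - 2 * a n * q + (a n)\<^sup>2" for n
        using a(1)[of n] elim x by (auto simp: q_def elim!: Rats_cases)
      moreover have "(\<lambda>n. rep_L1 (J l z2) x - 2 * a n * q + (a n)\<^sup>2) \<longlonglongrightarrow> rep_L1 (J l z2) x - 2 * q * q + q\<^sup>2"
        by (intro tendsto_intros a(2))
      ultimately have "0 \<le> rep_L1 (J l z2) x - 2 * q * q + q\<^sup>2"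
        by (intro LIMSEQ_le_const) auto
      then show "(rep_L1 (J l z) x)\<^sup>2 \<le> rep_L1 (J l z2) x" by (simp add: q_def power2_eq_square)
    qed
  qed
qed

text \<open>\<open>J l\<close> contracts the L^2 norm of bounded elements: the pointwise bound on
  the square of \<open>J l z\<close> is integrated, and the L^1 contraction is applied to
  \<open>z2\<close>, which represents the square of \<open>z\<close>. So \<open>z - J l z\<close>,
  that is \<open>l\<close> times \<open>J l (A z)\<close>, pairs nonnegatively with
  \<open>z\<close>. Boundedness of \<open>z\<close> lets the pairing follow the L^1 convergence as
  \<open>l\<close> tends to 0.\<close>

lemma pairing_self_A_nonneg:
  assumes z: "z \<in> D" and C: "C \<ge> 0" and le: "AE x in lebesgue. x \<in> G \<longrightarrow> \<bar>rep_L1 z x\<bar> \<le> C"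
  shows "0 \<le> pairing (rep_L1 z) (A z)"
proof -
  have zC: "AE x in lebesgue. \<bar>rep_L1 z x\<bar> \<le> C"
    using le X_zero_outside[OF D_X[OF z]] by eventually_elim (use C in auto)
  note \<alpha> = borel_measurable_rep_L1[of z] zC
  have int: "integrable lebesgue (\<lambda>x. (rep_L1 z x)\<^sup>2)"
    using integrable_pairing[OF \<alpha>, of z] by (simp add: power2_eq_square)
  have ind: "AE x in lebesgue. indicator G x * (rep_L1 z x)\<^sup>2 = (rep_L1 z x)\<^sup>2"
    using X_zero_outside[OF D_X[OF z]] by eventually_elim (auto simp: indicator_def)
  have int': "integrable lebesgue (\<lambda>x. indicator G x * (rep_L1 z x)\<^sup>2)"
    using int by (rule integrable_cong_AE_imp) (use ind in auto)
  define z2 where "z2 = restrict_L1 G (\<lambda>x. (rep_L1 z x)\<^sup>2)"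
  have z2: "z2 \<in> X" unfolding z2_def by (rule restrict_L1_in_L1_on[OF int'])
  have z2eq: "AE x in lebesgue. rep_L1 z2 x = (rep_L1 z x)\<^sup>2"
    using AE_rep_restrict_L1[OF int'] ind unfolding z2_def by eventually_elim simp
  have main: "0 \<le> pairing (rep_L1 z) (J l (A z))" if l: "l > 0" for l
  proof -
    note Jz = J_X[OF l D_X[OF z]]
    have JC: "AE x in lebesgue. \<bar>rep_L1 (J l z) x\<bar> \<le> C"
      using J_abs_le[OF l D_X[OF z] C le] X_zero_outside[OF Jz] by eventually_elim (use C in auto)
    note \<alpha>' = borel_measurable_rep_L1[of "J l z"] JC
    have intJ: "integrable lebesgue (\<lambda>x. (rep_L1 (J l z) x)\<^sup>2)"
      using integrable_pairing[OF \<alpha>', of "J l z"] by (simp add: power2_eq_square)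
    have "(\<integral>x. (rep_L1 (J l z) x)\<^sup>2 \<partial>lebesgue) \<le> (\<integral>x. \<bar>rep_L1 (J l z2) x\<bar> \<partial>lebesgue)"
    proof (rule integral_mono_AE[OF intJ])
      show "AE x in lebesgue. (rep_L1 (J l z) x)\<^sup>2 \<le> \<bar>rep_L1 (J l z2) x\<bar>"
        using J_square_le[OF l D_X[OF z] z2 z2eq] X_zero_outside[OF Jz]
        by eventually_elim auto
    qed auto
    also have "\<dots> \<le> norm z2" unfolding norm_L1_eq[symmetric] by (rule norm_J_le[OF l z2])
    also have "\<dots> = (\<integral>x. (rep_L1 z x)\<^sup>2 \<partial>lebesgue)"
      unfolding norm_L1_eq
    proof (rule integral_cong_AE)
      show "AE x in lebesgue. \<bar>rep_L1 z2 x\<bar> = (rep_L1 z x)\<^sup>2"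
        using z2eq by eventually_elim simp
    qed auto
    finally have *: "(\<integral>x. (rep_L1 (J l z) x)\<^sup>2 \<partial>lebesgue) \<le> (\<integral>x. (rep_L1 z x)\<^sup>2 \<partial>lebesgue)" .
    have "pairing (rep_L1 z) (J l z) \<le> (\<integral>x. ((rep_L1 z x)\<^sup>2 + (rep_L1 (J l z) x)\<^sup>2) / 2 \<partial>lebesgue)"
      unfolding pairing_def
    proof (rule integral_mono[OF integrable_pairing[OF \<alpha>]])
      show "rep_L1 z x * rep_L1 (J l z) x \<le> ((rep_L1 z x)\<^sup>2 + (rep_L1 (J l z) x)\<^sup>2) / 2" for x
        using sum_squares_bound[of "rep_L1 z x" "rep_L1 (J l z) x"] by simp
    qed (use int intJ in auto)
    also have "\<dots> \<le> (\<integral>x. (rep_L1 z x)\<^sup>2 \<partial>lebesgue)" using * int intJ by simp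
    also have "\<dots> = pairing (rep_L1 z) z" by (simp add: pairing_def power2_eq_square)
    finally have "0 \<le> pairing (rep_L1 z) (z - J l z)" by (simp add: pairing_diff[OF \<alpha>])
    then have "0 \<le> l * pairing (rep_L1 z) (J l (A z))" using diff_J[OF l z] by (simp add: pairing_scaleR[OF \<alpha>])
    then show ?thesis using l by (simp add: zero_le_mult_iff)
  qed
  show ?thesis
    by (rule LIMSEQ_le_const[OF tendsto_pairing[OF \<alpha> J_tendsto[OF A_X[OF z]]]]) (use main in auto)
qed

end

section \<open>The range condition for the composed relation\<close>

locale L1_problem = L1_operator G D A for G :: "'a::euclidean_space set" and D A +
  fixes g :: "'a \<Rightarrow> real \<Rightarrow> real"
  assumes potential: "\<And>x. x \<in> G \<Longrightarrow> convex_potential (g x)"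
    and g_meas: "\<And>v. (\<lambda>x. g x v) \<in> borel_measurable (lebesgue_on G)"
    and growth: "\<And>C. C > 0 \<Longrightarrow> in_L2 G (growth_bound (\<lambda>x. real_subgradient (g x)) C)"
    and coercive: "\<exists>c>0. \<forall>v\<in>D. c * norm v \<le> norm (A v)"
begin

definition in_graph :: "'a L1 \<Rightarrow> 'a L1 \<Rightarrow> bool" where
  "in_graph u z \<longleftrightarrow> (AE x in lebesgue. x \<in> G \<longrightarrow> rep_L1 u x \<in> real_subgradient (g x) (rep_L1 z x))"

lemma in_graph_zero: "in_graph 0 0"
  unfolding in_graph_def using AE_rep_zero
  by eventually_elim (simp add: convex_potential.zero_in_real_subgradient potential)

lemma in_graph_closed:
  assumes u: "u \<longlonglongrightarrow> u'" and z: "z \<longlonglongrightarrow> z'" and uz: "\<And>n. in_graph (u n) (z n)"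
  shows "in_graph u' z'"
proof -
  obtain r where r: "strict_mono r" "AE x in lebesgue. (\<lambda>n. rep_L1 (u (r n)) x) \<longlonglongrightarrow> rep_L1 u' x"
    by (rule L1_tendsto_AE_subseq[OF u])
  \<comment> \<open>The second subsequence is taken from the first, so that both sequences of
    representatives converge almost everywhere along the same indices.\<close>
  have "(\<lambda>n. z (r n)) \<longlonglongrightarrow> z'"
    using LIMSEQ_subseq_LIMSEQ[OF z r(1)] by (simp add: o_def)
  from L1_tendsto_AE_subseq[OF this] obtain k where
    k: "strict_mono k" "AE x in lebesgue. (\<lambda>n. rep_L1 (z (r (k n))) x) \<longlonglongrightarrow> rep_L1 z' x" .
  have "AE x in lebesgue. \<forall>n. x \<in> G \<longrightarrow> rep_L1 (u n) x \<in> real_subgradient (g x) (rep_L1 (z n) x)"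
    using uz by (subst AE_all_countable) (simp add: in_graph_def)
  with r(2) k(2) show ?thesis
    unfolding in_graph_def
  proof eventually_elim
    case (elim x)
    show ?case
    proof
      assume x: "x \<in> G"
      have "(\<lambda>n. rep_L1 (u (r (k n))) x) \<longlonglongrightarrow> rep_L1 u' x"
        using LIMSEQ_subseq_LIMSEQ[OF elim(1) k(1)] by (simp add: o_def)
      then show "rep_L1 u' x \<in> real_subgradient (g x) (rep_L1 z' x)"
        by (rule convex_potential.real_subgradient_closed[OF potential[OF x] _ elim(2)]) (use elim(3) x in simp)
    qed
  qed
qed

text \<open>The pairing with \<alpha> turns the first two terms into norms at the same time and is
  nonnegative on the third. \<open>e = 0\<close> gives accretivity; \<open>e > 0\<close> serves the
  equation that still contains a multiple of \<open>z\<close>.\<close>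

lemma accretive_estimate:
  assumes z: "z \<in> D" "z' \<in> D" and u: "u \<in> X" "u' \<in> X" and gr: "in_graph u z" "in_graph u' z'" and e: "e \<ge> 0"
  shows "norm (u - u') + e * norm (z - z') \<le> norm (e *\<^sub>R (z - z') + (u - u') + (A z - A z'))"
proof -
  \<comment> \<open>Where \<open>z\<close> and \<open>z'\<close> agree, every value in [-1, 1] is a
    sign of their difference, so the sign of \<open>u - u'\<close> is allowed; where they differ,
    monotonicity makes the sign of \<open>z - z'\<close> a sign of \<open>u - u'\<close> as
    well.\<close>
  define \<alpha> where "\<alpha> x = (if rep_L1 z x = rep_L1 z' x then sgn (rep_L1 u x - rep_L1 u' x)
    else sgn (rep_L1 z x - rep_L1 z' x))" for x
  have meas: "\<alpha> \<in> borel_measurable lebesgue" unfolding \<alpha>_def by measurable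
  have bd: "AE x in lebesgue. \<bar>\<alpha> x\<bar> \<le> 1" by (rule AE_I2) (simp add: \<alpha>_def abs_sgn_eq)
  have az: "AE x in lebesgue. \<alpha> x * rep_L1 (z - z') x = \<bar>rep_L1 (z - z') x\<bar>"
    using AE_rep_minus[of z z'] by eventually_elim (simp add: \<alpha>_def sgn_mult_self_eq abs_sgn mult.commute)
  have au: "AE x in lebesgue. \<alpha> x * rep_L1 (u - u') x = \<bar>rep_L1 (u - u') x\<bar>"
    using AE_rep_minus[of u u'] gr[unfolded in_graph_def] X_zero_outside[OF u(1)] X_zero_outside[OF u(2)]
  proof eventually_elim
    case (elim x)
    define a where "a = rep_L1 u x - rep_L1 u' x"
    define b where "b = rep_L1 z x - rep_L1 z' x"
    have "0 \<le> a * b"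
    proof (cases "x \<in> G")
      case True
      then show ?thesis using elim(2,3) real_subgradient_mono by (auto simp: a_def b_def)
    next
      case False
      then show ?thesis using elim(4,5) by (simp add: a_def)
    qed
    moreover have "\<alpha> x = (if b = 0 then sgn a else sgn b)" by (simp add: \<alpha>_def a_def b_def)
    ultimately have "\<alpha> x * a = \<bar>a\<bar>"
      by (auto simp: sgn_if zero_le_mult_iff split: if_splits)
    then show ?case by (simp add: elim(1) a_def)
  qed
  have "norm (u - u') + e * norm (z - z') \<le> pairing \<alpha> (u - u') + e * pairing \<alpha> (z - z') + pairing \<alpha> (A (z - z'))"
    using pairing_sgn_A_nonneg[OF D_diff[OF z] meas bd az] norm_eq_pairing[OF meas az] norm_eq_pairing[OF meas au]
    by simp
  also have "\<dots> = pairing \<alpha> (e *\<^sub>R (z - z') + (u - u') + (A z - A z'))"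
    using A_diff[OF z] by (simp add: pairing_add[OF meas bd] pairing_scaleR[OF meas bd])
  also have "\<dots> \<le> norm (e *\<^sub>R (z - z') + (u - u') + (A z - A z'))"
    using abs_pairing_le[OF meas bd, of "e *\<^sub>R (z - z') + (u - u') + (A z - A z')"] by simp
  finally show ?thesis .
qed

section \<open>The equation with the Yosida approximation\<close>

definition P :: "real \<Rightarrow> 'a L1 \<Rightarrow> 'a L1" where
  "P \<mu> z = restrict_L1 G (\<lambda>x. prox \<mu> (g x) (rep_L1 z x))"

context
  fixes \<mu> :: real
  assumes \<mu>: "\<mu> > 0"
begin

lemma integrable_prox: "integrable lebesgue (\<lambda>x. indicator G x * prox \<mu> (g x) (rep_L1 z x))"
proof (rule integrable_indicator_dominated[OF G_sets])
  show "(\<lambda>x. prox \<mu> (g x) (rep_L1 z x)) \<in> borel_measurable (lebesgue_on G)"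
    by (rule borel_measurable_prox[OF _ g_meas _ \<mu>])
       (auto intro: potential measurable_restrict_space1)
  show "AE x in lebesgue. x \<in> G \<longrightarrow> \<bar>prox \<mu> (g x) (rep_L1 z x)\<bar> \<le> \<bar>rep_L1 z x\<bar>"
    by (rule AE_I2) (simp add: convex_potential.abs_prox_le[OF potential \<mu>])
qed simp

lemma AE_rep_P: "AE x in lebesgue. rep_L1 (P \<mu> z) x = indicator G x * prox \<mu> (g x) (rep_L1 z x)"
  unfolding P_def by (rule AE_rep_restrict_L1[OF integrable_prox])

lemma P_X: "P \<mu> z \<in> X"
  unfolding P_def by (rule restrict_L1_in_L1_on[OF integrable_prox])

lemma P_abs_le: "AE x in lebesgue. \<bar>rep_L1 (P \<mu> z) x\<bar> \<le> \<bar>rep_L1 z x\<bar>"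
  using AE_rep_P[of z]
  by eventually_elim (simp add: indicator_def convex_potential.abs_prox_le[OF potential \<mu>])

lemma norm_P_diff_le: "norm (P \<mu> z - P \<mu> z') \<le> norm (z - z')"
proof (rule norm_L1_mono)
  show "AE x in lebesgue. \<bar>rep_L1 (P \<mu> z - P \<mu> z') x\<bar> \<le> \<bar>rep_L1 (z - z') x\<bar>"
    using AE_rep_P[of z] AE_rep_P[of z'] AE_rep_minus[of z z'] AE_rep_minus[of "P \<mu> z" "P \<mu> z'"]
    by eventually_elim (simp add: indicator_def convex_potential.prox_nonexpansive[OF potential \<mu>])
qed

lemma in_graph_P: "in_graph ((1 / \<mu>) *\<^sub>R (z - P \<mu> z)) (P \<mu> z)"
  unfolding in_graph_def
  using AE_rep_P[of z] AE_rep_minus[of z "P \<mu> z"] AE_rep_scaleR[of "1 / \<mu>" "z - P \<mu> z"]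
proof eventually_elim
  case (elim x)
  then show ?case
    using convex_potential.prox_in_real_subgradient[OF potential \<mu>, of x "rep_L1 z x"] by simp
qed

text \<open>Collecting the multiples of \<open>z\<close> gives
  \<open>\<kappa> z + A z = f + P \<mu> z / \<mu>\<close>, so \<open>z\<close> is a fixed point of
  \<open>J (1 / \<kappa>)\<close> after \<open>R\<close>. As \<open>J\<close> and \<open>P\<close>
  are nonexpansive, its Lipschitz constant is \<open>(1 / \<mu>) / \<kappa>\<close>, less than 1
  because of \<epsilon>.\<close>

lemma regularized_solution:
  assumes \<epsilon>: "\<epsilon> > 0" and f: "f \<in> X" and C: "C \<ge> 0" and le: "AE x in lebesgue. x \<in> G \<longrightarrow> \<bar>rep_L1 f x\<bar> \<le> \<epsilon> * C"
  obtains z where "z \<in> D" "AE x in lebesgue. x \<in> G \<longrightarrow> \<bar>rep_L1 z x\<bar> \<le> C"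
    "\<epsilon> *\<^sub>R z + (1 / \<mu>) *\<^sub>R (z - P \<mu> z) + A z = f"
proof -
  define \<kappa> where "\<kappa> = \<epsilon> + 1 / \<mu>"
  have \<kappa>: "\<kappa> > 0" "1 / \<kappa> > 0" using \<epsilon> \<mu> by (auto simp: \<kappa>_def add_pos_pos)
  define R where "R z = (1 / \<kappa>) *\<^sub>R (f + (1 / \<mu>) *\<^sub>R P \<mu> z)" for z
  \<comment> \<open>Iterating inside this L^1-closed set yields the sup bound together with the
    solution; it is invariant because \<open>\<epsilon> * C + C / \<mu> = \<kappa> * C\<close> and
    both \<open>P\<close> and \<open>J\<close> respect symmetric bounds.\<close>
  define S where "S = {z \<in> X. AE x in lebesgue. x \<in> G \<longrightarrow> rep_L1 z x \<in> {-C..C}}"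
  have RX: "R z \<in> X" for z unfolding R_def by (intro X_scale X_add f P_X)
  have "closed S"
    unfolding closed_sequential_limits
  proof (intro allI impI, elim conjE)
    fix y l assume y: "\<forall>n. y n \<in> S" and lim: "y \<longlonglongrightarrow> l"
    have "l \<in> X" by (rule closed_sequentially[OF closed_L1_on _ lim]) (use y in \<open>simp add: S_def\<close>)
    moreover have "AE x in lebesgue. x \<in> G \<longrightarrow> rep_L1 l x \<in> {-C..C}"
      by (rule AE_closed_L1[OF lim]) (use y in \<open>simp_all add: S_def\<close>)
    ultimately show "l \<in> S" by (simp add: S_def)
  qed
  then have "complete S" by (simp add: complete_eq_closed)
  moreover have "0 \<in> S"
  proof -
    have "AE x in lebesgue. x \<in> G \<longrightarrow> rep_L1 (0::'a L1) x \<in> {-C..C}"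
      using AE_rep_zero by eventually_elim (simp add: C)
    then show ?thesis by (simp add: S_def X_zero)
  qed
  moreover have "0 \<le> (1 / \<mu>) / \<kappa>" using \<mu> \<kappa> by simp
  moreover have "(1 / \<mu>) / \<kappa> < 1"
    unfolding pos_divide_less_eq[OF \<kappa>(1)] using \<epsilon> by (simp add: \<kappa>_def)
  moreover have "(\<lambda>z. J (1 / \<kappa>) (R z)) ` S \<subseteq> S"
  proof (rule image_subsetI)
    fix z assume "z \<in> S"
    then have z: "AE x in lebesgue. x \<in> G \<longrightarrow> rep_L1 z x \<in> {-C..C}" by (simp add: S_def)
    have "AE x in lebesgue. x \<in> G \<longrightarrow> \<bar>rep_L1 (R z) x\<bar> \<le> C"
      using z le P_abs_le[of z] AE_rep_scaleR[of "1 / \<kappa>" "f + (1 / \<mu>) *\<^sub>R P \<mu> z"]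
        AE_rep_plus[of f "(1 / \<mu>) *\<^sub>R P \<mu> z"] AE_rep_scaleR[of "1 / \<mu>" "P \<mu> z"]
    proof eventually_elim
      case (elim x)
      show ?case
      proof
        assume x: "x \<in> G"
        have "\<bar>rep_L1 f x + 1 / \<mu> * rep_L1 (P \<mu> z) x\<bar> \<le> \<bar>rep_L1 f x\<bar> + 1 / \<mu> * \<bar>rep_L1 (P \<mu> z) x\<bar>"
          using abs_triangle_ineq[of "rep_L1 f x" "1 / \<mu> * rep_L1 (P \<mu> z) x"] \<mu> by (simp add: abs_mult)
        also have "\<dots> \<le> \<epsilon> * C + 1 / \<mu> * C"
          using elim(1-3) x \<mu> by (intro add_mono mult_left_mono) auto
        also have "\<dots> = \<kappa> * C" by (simp add: \<kappa>_def distrib_right)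
        finally have "1 / \<kappa> * \<bar>rep_L1 f x + 1 / \<mu> * rep_L1 (P \<mu> z) x\<bar> \<le> 1 / \<kappa> * (\<kappa> * C)"
          using \<kappa> by (intro mult_left_mono) auto
        moreover have "rep_L1 (R z) x = 1 / \<kappa> * (rep_L1 f x + 1 / \<mu> * rep_L1 (P \<mu> z) x)"
          unfolding R_def by (simp only: elim(4-6))
        ultimately show "\<bar>rep_L1 (R z) x\<bar> \<le> C" using \<kappa> by (simp add: abs_mult)
      qed
    qed
    then have "AE x in lebesgue. x \<in> G \<longrightarrow> \<bar>rep_L1 (J (1 / \<kappa>) (R z)) x\<bar> \<le> C"
      by (rule J_abs_le[OF \<kappa>(2) RX C])
    then have "AE x in lebesgue. x \<in> G \<longrightarrow> rep_L1 (J (1 / \<kappa>) (R z)) x \<in> {-C..C}"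
      by eventually_elim auto
    then show "J (1 / \<kappa>) (R z) \<in> S" by (simp add: S_def J_X[OF \<kappa>(2) RX])
  qed
  moreover have "\<forall>x\<in>S. \<forall>y\<in>S. dist (J (1 / \<kappa>) (R x)) (J (1 / \<kappa>) (R y)) \<le> (1 / \<mu>) / \<kappa> * dist x y"
  proof (intro ballI)
    fix x y
    have "dist (J (1 / \<kappa>) (R x)) (J (1 / \<kappa>) (R y)) = norm (J (1 / \<kappa>) (R x - R y))"
      using J_diff[OF \<kappa>(2) RX RX] by (simp add: dist_norm)
    also have "\<dots> \<le> norm (R x - R y)" by (rule norm_J_le[OF \<kappa>(2) X_diff[OF RX RX]])
    also have "R x - R y = ((1 / \<mu>) / \<kappa>) *\<^sub>R (P \<mu> x - P \<mu> y)"
      by (simp add: R_def scaleR_diff_right[symmetric])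
    also have "norm \<dots> = (1 / \<mu>) / \<kappa> * norm (P \<mu> x - P \<mu> y)"
      using \<mu> \<kappa> by simp
    also have "\<dots> \<le> (1 / \<mu>) / \<kappa> * dist x y"
      using \<mu> \<kappa> norm_P_diff_le[of x y] by (intro mult_left_mono) (auto simp: dist_norm)
    finally show "dist (J (1 / \<kappa>) (R x)) (J (1 / \<kappa>) (R y)) \<le> (1 / \<mu>) / \<kappa> * dist x y" .
  qed
  ultimately have "\<exists>!z. z \<in> S \<and> J (1 / \<kappa>) (R z) = z"
    by (intro Banach_fix[of S "(1 / \<mu>) / \<kappa>"]) auto
  then obtain z where z: "z \<in> S" "J (1 / \<kappa>) (R z) = z" by auto
  have zD: "z \<in> D" and "z + (1 / \<kappa>) *\<^sub>R A z = R z"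
    using J_props[OF \<kappa>(2) RX, of z] unfolding z(2) .
  then have "\<kappa> *\<^sub>R (z + (1 / \<kappa>) *\<^sub>R A z) = f + (1 / \<mu>) *\<^sub>R P \<mu> z"
    using \<kappa> by (simp add: R_def)
  then have "\<kappa> *\<^sub>R z + A z = f + (1 / \<mu>) *\<^sub>R P \<mu> z"
    using \<kappa> by (simp add: scaleR_add_right)
  then have "\<epsilon> *\<^sub>R z + (1 / \<mu>) *\<^sub>R (z - P \<mu> z) + A z = f"
    by (simp add: \<kappa>_def algebra_simps)
  moreover have "AE x in lebesgue. x \<in> G \<longrightarrow> rep_L1 z x \<in> {-C..C}" using z(1) by (simp add: S_def)
  then have "AE x in lebesgue. x \<in> G \<longrightarrow> \<bar>rep_L1 z x\<bar> \<le> C" by eventually_elim auto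
  ultimately show thesis using that zD by blast
qed

end

text \<open>\<open>B\<close> depends on \<open>C\<close> only, which makes the bound uniform in the
  Yosida parameter.\<close>

lemma growth_square_bound:
  assumes C: "C \<ge> 0"
  obtains B where "\<And>u z. u \<in> X \<Longrightarrow> in_graph u z \<Longrightarrow> AE x in lebesgue. x \<in> G \<longrightarrow> \<bar>rep_L1 z x\<bar> \<le> C \<Longrightarrow>
     integrable lebesgue (\<lambda>x. (rep_L1 u x)\<^sup>2) \<and> (\<integral>x. (rep_L1 u x)\<^sup>2 \<partial>lebesgue) \<le> B"
proof -
  \<comment> \<open>The growth hypothesis speaks of positive constants and \<open>C\<close> may be
    0, hence \<open>C + 1\<close>.\<close>
  define M where "M = growth_bound (\<lambda>x. real_subgradient (g x)) (C + 1)"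
  have M: "M \<in> borel_measurable (lebesgue_on G)" "(\<integral>\<^sup>+x. (M x)\<^sup>2 \<partial>lebesgue_on G) < \<infinity>"
    using growth[of "C + 1"] C by (auto simp: in_L2_def M_def)
  define B where "B = enn2real (\<integral>\<^sup>+x. (M x)\<^sup>2 \<partial>lebesgue_on G)"
  have B: "(\<integral>\<^sup>+x. (M x)\<^sup>2 \<partial>lebesgue_on G) = ennreal B" "B \<ge> 0"
    using M(2) by (simp_all add: B_def)
  show thesis
  proof (rule that)
    fix u z assume u: "u \<in> X" and uz: "in_graph u z" and zC: "AE x in lebesgue. x \<in> G \<longrightarrow> \<bar>rep_L1 z x\<bar> \<le> C"
    have "(\<integral>\<^sup>+x. ennreal ((rep_L1 u x)\<^sup>2) \<partial>lebesgue) \<le> (\<integral>\<^sup>+x. (M x)\<^sup>2 * indicator G x \<partial>lebesgue)"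
    proof (rule nn_integral_mono_AE)
      show "AE x in lebesgue. ennreal ((rep_L1 u x)\<^sup>2) \<le> (M x)\<^sup>2 * indicator G x"
        using uz[unfolded in_graph_def] zC X_zero_outside[OF u]
      proof eventually_elim
        case (elim x)
        show ?case
        proof (cases "x \<in> G")
          case True
          have "ennreal \<bar>rep_L1 u x\<bar> \<le> M x"
            unfolding M_def growth_bound_def by (rule Sup_upper) (use elim True in force)
          then have "(ennreal \<bar>rep_L1 u x\<bar>)\<^sup>2 \<le> (M x)\<^sup>2" by (rule power_mono) simp
          then show ?thesis using True by (simp add: ennreal_power)
        qed (use elim in simp)
      qed
    qed
    also have "\<dots> = ennreal B" using B(1) by (simp add: nn_integral_restrict_space)
    finally have le: "(\<integral>\<^sup>+x. ennreal ((rep_L1 u x)\<^sup>2) \<partial>lebesgue) \<le> ennreal B" .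
    have int: "integrable lebesgue (\<lambda>x. (rep_L1 u x)\<^sup>2)"
    proof (rule integrableI_bounded)
      show "(\<integral>\<^sup>+x. ennreal (norm ((rep_L1 u x)\<^sup>2)) \<partial>lebesgue) < \<infinity>"
        using le_less_trans[OF le ennreal_less_top] by simp
    qed measurable
    then have "ennreal (\<integral>x. (rep_L1 u x)\<^sup>2 \<partial>lebesgue) \<le> ennreal B"
      using le by (subst nn_integral_eq_integral[symmetric]) auto
    with int show "integrable lebesgue (\<lambda>x. (rep_L1 u x)\<^sup>2) \<and> (\<integral>x. (rep_L1 u x)\<^sup>2 \<partial>lebesgue) \<le> B"
      using B(2) by (simp add: ennreal_le_iff)
  qed
qed

text \<open>Pointwise \<open>\<bar>y\<bar> \<le> d + y\<^sup>2 / d\<close>, by comparing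
  \<open>\<bar>y\<bar>\<close> with \<open>d\<close>. With \<open>d\<close> free and
  \<open>G\<close> of finite measure, smallness of the square integral becomes smallness in
  L^1.\<close>

lemma norm_le_square:
  assumes u: "u \<in> X" and int: "integrable lebesgue (\<lambda>x. (rep_L1 u x)\<^sup>2)" and d: "d > 0"
  shows "norm u \<le> d * measure lebesgue G + (\<integral>x. (rep_L1 u x)\<^sup>2 \<partial>lebesgue) / d"
proof -
  have "norm u \<le> (\<integral>x. d * indicator G x + (rep_L1 u x)\<^sup>2 / d \<partial>lebesgue)"
  proof (rule norm_L1_le)
    show "integrable lebesgue (\<lambda>x. d * indicator G x + (rep_L1 u x)\<^sup>2 / d)"
      using int integrable_indicator_G by simp
    show "AE x in lebesgue. \<bar>rep_L1 u x\<bar> \<le> d * indicator G x + (rep_L1 u x)\<^sup>2 / d"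
      using X_zero_outside[OF u]
    proof eventually_elim
      case (elim x)
      have "\<bar>y\<bar> \<le> d + y\<^sup>2 / d" for y :: real
      proof (cases "\<bar>y\<bar> \<le> d")
        case True
        then show ?thesis using d by (simp add: add_increasing2)
      next
        case False
        then have "\<bar>y\<bar> * d \<le> \<bar>y\<bar> * \<bar>y\<bar>" by (intro mult_left_mono) auto
        then have "\<bar>y\<bar> \<le> y\<^sup>2 / d" using d by (simp add: pos_le_divide_eq power2_eq_square)
        then show ?thesis using d by simp
      qed
      then show ?case using elim by (cases "x \<in> G") auto
    qed
  qed
  also have "\<dots> = d * measure lebesgue G + (\<integral>x. (rep_L1 u x)\<^sup>2 \<partial>lebesgue) / d"
    using int integrable_indicator_G by simp
  finally show ?thesis .
qed

end

text \<open>For \<open>\<mu> \<le> \<nu>\<close> the hypothesis is \<open>\<langle>a - b, \<mu> a - \<nu> b\<rangle> \<le> 0\<close>; since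
  \<open>2 \<langle>a - b, \<mu> a - \<nu> b\<rangle> = (\<mu> + \<nu>) |a - b|\<^sup>2 + (\<mu> - \<nu>) (|a|\<^sup>2 - |b|\<^sup>2)\<close>, the norm
  grows as the parameter decreases and controls the distance.\<close>

lemma square_diff_le_diff_squares:
  fixes a b :: "'a \<Rightarrow> real"
  assumes int: "integrable M (\<lambda>x. (a x)\<^sup>2)" "integrable M (\<lambda>x. (b x)\<^sup>2)" "integrable M (\<lambda>x. a x * b x)"
    and \<mu>: "0 < \<mu>" "\<mu> < \<nu>"
    and le: "(\<integral>x. (a x - b x) * (\<mu> * a x - \<nu> * b x) \<partial>M) \<le> 0"
  shows "(\<integral>x. (a x - b x)\<^sup>2 \<partial>M) \<le> (\<integral>x. (a x)\<^sup>2 \<partial>M) - (\<integral>x. (b x)\<^sup>2 \<partial>M)"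
proof -
  define I where "I = (\<integral>x. (a x)\<^sup>2 \<partial>M)"
  define K where "K = (\<integral>x. (b x)\<^sup>2 \<partial>M)"
  define L where "L = (\<integral>x. a x * b x \<partial>M)"
  have "(\<integral>x. (a x - b x) * (\<mu> * a x - \<nu> * b x) \<partial>M) = (\<integral>x. \<mu> * (a x)\<^sup>2 - (\<mu> + \<nu>) * (a x * b x) + \<nu> * (b x)\<^sup>2 \<partial>M)"
    by (intro Bochner_Integration.integral_cong) (auto simp: power2_eq_square algebra_simps)
  also have "\<dots> = \<mu> * I - (\<mu> + \<nu>) * L + \<nu> * K" using int by (simp add: I_def K_def L_def)
  finally have 1: "\<mu> * I - (\<mu> + \<nu>) * L + \<nu> * K \<le> 0" using le by simp
  have "(\<integral>x. (a x - b x)\<^sup>2 \<partial>M) = (\<integral>x. (a x)\<^sup>2 - 2 * (a x * b x) + (b x)\<^sup>2 \<partial>M)"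
    by (intro Bochner_Integration.integral_cong) (auto simp: power2_eq_square algebra_simps)
  also have "\<dots> = I - 2 * L + K" using int by (simp add: I_def K_def L_def)
  finally have 2: "(\<integral>x. (a x - b x)\<^sup>2 \<partial>M) = I - 2 * L + K" .
  have 0: "0 \<le> I - 2 * L + K" unfolding 2[symmetric] by simp
  have "(\<mu> + \<nu>) * (I - 2 * L + K) \<le> (\<nu> - \<mu>) * (I - K)" using 1 by (simp add: algebra_simps)
  \<comment> \<open>Since \<open>\<nu> - \<mu> \<le> \<mu> + \<nu>\<close>, the parameters cancel
    and do not occur in the final estimate.\<close>
  moreover have "(\<nu> - \<mu>) * (I - 2 * L + K) \<le> (\<mu> + \<nu>) * (I - 2 * L + K)" using \<mu> 0 by (intro mult_right_mono) auto
  ultimately have "(\<nu> - \<mu>) * (I - 2 * L + K) \<le> (\<nu> - \<mu>) * (I - K)" by simp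
  then have "I - 2 * L + K \<le> I - K" using \<mu> by (simp add: mult_le_cancel_left)
  then show ?thesis unfolding 2 by (simp add: I_def K_def)
qed

section \<open>Removing the two regularizations\<close>

context L1_problem
begin

text \<open>Convergence of the \<open>u n\<close> is enough: the equation then gives
  \<open>z n\<close> through the resolvent of \<open>A\<close>, hence also \<open>A (z n)\<close>,
  and \<open>A\<close> is closed. The sup bound \<open>C\<close> makes both the square bound and the
  quadratic test available.\<close>

lemma bounded_data_solution:
  assumes \<epsilon>: "\<epsilon> > 0" and f: "f \<in> X" and C: "C \<ge> 0" and le: "AE x in lebesgue. x \<in> G \<longrightarrow> \<bar>rep_L1 f x\<bar> \<le> \<epsilon> * C"
  shows "\<exists>z\<in>D. \<exists>u\<in>X. in_graph u z \<and> \<epsilon> *\<^sub>R z + u + A z = f"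
proof -
  define \<mu> where "\<mu> n = inverse (real (Suc n))" for n
  have \<mu>: "\<mu> n > 0" for n by (simp add: \<mu>_def)
  have "\<exists>z. z \<in> D \<and> (AE x in lebesgue. x \<in> G \<longrightarrow> \<bar>rep_L1 z x\<bar> \<le> C) \<and>
    \<epsilon> *\<^sub>R z + (1 / \<mu> n) *\<^sub>R (z - P (\<mu> n) z) + A z = f" for n
    by (rule regularized_solution[OF \<mu> \<epsilon> f C le, of n]) (intro exI conjI)
  then have "\<exists>z. \<forall>n. z n \<in> D \<and> (AE x in lebesgue. x \<in> G \<longrightarrow> \<bar>rep_L1 (z n) x\<bar> \<le> C) \<and>
    \<epsilon> *\<^sub>R z n + (1 / \<mu> n) *\<^sub>R (z n - P (\<mu> n) (z n)) + A (z n) = f"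
    by (intro choice allI)
  then obtain z where z: "\<And>n. z n \<in> D" "\<And>n. AE x in lebesgue. x \<in> G \<longrightarrow> \<bar>rep_L1 (z n) x\<bar> \<le> C"
    "\<And>n. \<epsilon> *\<^sub>R z n + (1 / \<mu> n) *\<^sub>R (z n - P (\<mu> n) (z n)) + A (z n) = f"
    by blast
  define p where "p n = P (\<mu> n) (z n)" for n
  define u where "u n = (1 / \<mu> n) *\<^sub>R (z n - p n)" for n
  have eq: "\<epsilon> *\<^sub>R z n + u n + A (z n) = f" for n using z(3)[of n] by (simp add: u_def p_def)
  have pX: "p n \<in> X" for n unfolding p_def by (rule P_X[OF \<mu>])
  have uX: "u n \<in> X" for n unfolding u_def by (intro X_scale X_diff D_X z(1) pX)
  have gr: "in_graph (u n) (p n)" for n unfolding u_def p_def by (rule in_graph_P[OF \<mu>])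
  have pC: "AE x in lebesgue. x \<in> G \<longrightarrow> \<bar>rep_L1 (p n) x\<bar> \<le> C" for n
    using z(2)[of n] P_abs_le[OF \<mu>, of n "z n"] unfolding p_def[symmetric] by eventually_elim auto
  obtain B where B: "\<And>u z. u \<in> X \<Longrightarrow> in_graph u z \<Longrightarrow> AE x in lebesgue. x \<in> G \<longrightarrow> \<bar>rep_L1 z x\<bar> \<le> C \<Longrightarrow>
     integrable lebesgue (\<lambda>x. (rep_L1 u x)\<^sup>2) \<and> (\<integral>x. (rep_L1 u x)\<^sup>2 \<partial>lebesgue) \<le> B"
    by (rule growth_square_bound[OF C]) (rule that, assumption)
  define N where "N n = (\<integral>x. (rep_L1 (u n) x)\<^sup>2 \<partial>lebesgue)" for n
  have int2: "integrable lebesgue (\<lambda>x. (rep_L1 (u n) x)\<^sup>2)" and NB: "N n \<le> B" for n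
    using B[OF uX gr pC, of n] by (auto simp: N_def)
  have intm: "integrable lebesgue (\<lambda>x. rep_L1 (u n) x * rep_L1 (u m) x)" for n m
  proof (rule Bochner_Integration.integrable_bound[OF Bochner_Integration.integrable_add[OF int2[of n] int2[of m]]])
    show "AE x in lebesgue. norm (rep_L1 (u n) x * rep_L1 (u m) x) \<le> norm ((rep_L1 (u n) x)\<^sup>2 + (rep_L1 (u m) x)\<^sup>2)"
    proof (rule AE_I2)
      fix x
      have "\<bar>a * b\<bar> \<le> a\<^sup>2 + b\<^sup>2" for a b :: real
        using sum_squares_bound[of "\<bar>a\<bar>" "\<bar>b\<bar>"] zero_le_power2[of a] zero_le_power2[of b]
          abs_ge_zero[of "a * b"] unfolding abs_mult power2_abs by linarith
      then show "norm (rep_L1 (u n) x * rep_L1 (u m) x) \<le> norm ((rep_L1 (u n) x)\<^sup>2 + (rep_L1 (u m) x)\<^sup>2)"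
        by simp
    qed
  qed measurable
  \<comment> \<open>Tested with \<open>w = z n - z m\<close>, the difference of the two equations
    loses two nonnegative terms and leaves a nonpositive pairing of \<open>w\<close> with
    \<open>u n - u m\<close>. Since \<open>z k = p k + \<mu> k *\<^sub>R u k\<close>, monotonicity
    of the graph at the points \<open>p k\<close> removes their part, and the hypothesis of
    \<open>square_diff_le_diff_squares\<close> remains.\<close>
  have key: "(\<integral>x. (rep_L1 (u n) x - rep_L1 (u m) x)\<^sup>2 \<partial>lebesgue) \<le> N n - N m" if nm: "m < n" for n m
    unfolding N_def
  proof (rule square_diff_le_diff_squares[OF int2 int2 intm \<mu>])
    show "\<mu> n < \<mu> m" unfolding \<mu>_def using nm by (intro less_imp_inverse_less) auto
    define w where "w = z n - z m"
    have wD: "w \<in> D" unfolding w_def by (rule D_diff[OF z(1) z(1)])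
    have wC: "AE x in lebesgue. x \<in> G \<longrightarrow> \<bar>rep_L1 w x\<bar> \<le> 2 * C"
      using z(2)[of n] z(2)[of m] AE_rep_minus[of "z n" "z m"] unfolding w_def by eventually_elim auto
    have wC': "AE x in lebesgue. \<bar>rep_L1 w x\<bar> \<le> 2 * C"
      using wC X_zero_outside[OF D_X[OF wD]] by eventually_elim (use C in auto)
    note \<alpha> = borel_measurable_rep_L1[of w] wC'
    have "\<epsilon> *\<^sub>R w + ((u n - u m) + A w) = (\<epsilon> *\<^sub>R z n + u n + A (z n)) - (\<epsilon> *\<^sub>R z m + u m + A (z m))"
      unfolding w_def by (simp add: A_diff[OF z(1) z(1)] algebra_simps)
    also have "\<dots> = 0" by (simp add: eq)
    finally have "pairing (rep_L1 w) (\<epsilon> *\<^sub>R w + ((u n - u m) + A w)) = 0"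
      using pairing_scaleR[OF \<alpha>, of 0 0] by simp
    then have "\<epsilon> * pairing (rep_L1 w) w + pairing (rep_L1 w) (u n - u m) + pairing (rep_L1 w) (A w) = 0"
      by (simp add: pairing_add[OF \<alpha>] pairing_scaleR[OF \<alpha>])
    moreover have "0 \<le> pairing (rep_L1 w) (A w)"
      by (rule pairing_self_A_nonneg[OF wD _ wC]) (use C in simp)
    moreover have "0 \<le> pairing (rep_L1 w) w" unfolding pairing_def by (rule integral_nonneg_AE) simp
    then have "0 \<le> \<epsilon> * pairing (rep_L1 w) w" using \<epsilon> by simp
    ultimately have neg: "pairing (rep_L1 w) (u n - u m) \<le> 0" by linarith
    have "(\<integral>x. (rep_L1 (u n) x - rep_L1 (u m) x) * (\<mu> n * rep_L1 (u n) x - \<mu> m * rep_L1 (u m) x) \<partial>lebesgue)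
       \<le> pairing (rep_L1 w) (u n - u m)"
      unfolding pairing_def
    proof (rule integral_mono_AE)
      have "integrable lebesgue (\<lambda>x. \<mu> n * (rep_L1 (u n) x)\<^sup>2 - (\<mu> n + \<mu> m) * (rep_L1 (u n) x * rep_L1 (u m) x) + \<mu> m * (rep_L1 (u m) x)\<^sup>2)"
        using int2 intm by simp
      then show "integrable lebesgue (\<lambda>x. (rep_L1 (u n) x - rep_L1 (u m) x) * (\<mu> n * rep_L1 (u n) x - \<mu> m * rep_L1 (u m) x))"
        by (rule Bochner_Integration.integrable_cong[THEN iffD1, rotated -1]) (auto simp: power2_eq_square algebra_simps)
      show "integrable lebesgue (\<lambda>x. rep_L1 w x * rep_L1 (u n - u m) x)" by (rule integrable_pairing[OF \<alpha>])
      have un: "AE x in lebesgue. \<mu> k * rep_L1 (u k) x = rep_L1 (z k) x - rep_L1 (p k) x" for k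
        using AE_rep_scaleR[of "1 / \<mu> k" "z k - p k"] AE_rep_minus[of "z k" "p k"] unfolding u_def[symmetric]
        by eventually_elim (use \<mu>[of k] in simp)
      show "AE x in lebesgue. (rep_L1 (u n) x - rep_L1 (u m) x) * (\<mu> n * rep_L1 (u n) x - \<mu> m * rep_L1 (u m) x)
         \<le> rep_L1 w x * rep_L1 (u n - u m) x"
        using un[of n] un[of m] AE_rep_minus[of "z n" "z m", folded w_def] AE_rep_minus[of "u n" "u m"]
          gr[of n, unfolded in_graph_def] gr[of m, unfolded in_graph_def] X_zero_outside[OF uX[of n]] X_zero_outside[OF uX[of m]]
      proof eventually_elim
        case (elim x)
        have mono: "0 \<le> (rep_L1 (u n) x - rep_L1 (u m) x) * (rep_L1 (p n) x - rep_L1 (p m) x)"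
        proof (cases "x \<in> G")
          case True
          then show ?thesis using elim(5,6) by (intro real_subgradient_mono) auto
        next
          case False
          then show ?thesis using elim(7,8) by simp
        qed
        have "rep_L1 w x * rep_L1 (u n - u m) x = (rep_L1 (u n) x - rep_L1 (u m) x) * (rep_L1 (z n) x - rep_L1 (z m) x)"
          by (simp add: elim(3,4) mult.commute)
        then show ?case using mono unfolding elim(1,2) by (simp add: algebra_simps)
      qed
    qed
    then show "(\<integral>x. (rep_L1 (u n) x - rep_L1 (u m) x) * (\<mu> n * rep_L1 (u n) x - \<mu> m * rep_L1 (u m) x) \<partial>lebesgue) \<le> 0"
      using neg by simp
  qed
  have "incseq N"
  proof (rule incseq_SucI)
    fix n
    have "0 \<le> (\<integral>x. (rep_L1 (u (Suc n)) x - rep_L1 (u n) x)\<^sup>2 \<partial>lebesgue)" by simp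
    then show "N n \<le> N (Suc n)" using key[of n "Suc n"] by linarith
  qed
  obtain L where "N \<longlonglongrightarrow> L" 
    by (rule incseq_convergent[OF \<open>incseq N\<close>, of B]) (simp add: NB, rule that)
  then have CN: "Cauchy N" by (rule LIMSEQ_imp_Cauchy)
  \<comment> \<open>\<open>d\<close> stays free: it is later chosen against the measure of
    \<open>G\<close>, and then the indices against \<open>d\<close>.\<close>
  have normu: "norm (u n - u m) \<le> d * measure lebesgue G + \<bar>N n - N m\<bar> / d" if d: "d > 0" for n m d
  proof -
    have *: "norm (u n - u m) \<le> d * measure lebesgue G + (N n - N m) / d" if nm: "m < n" for n m
    proof -
      have ae: "AE x in lebesgue. (rep_L1 (u n - u m) x)\<^sup>2 = (rep_L1 (u n) x - rep_L1 (u m) x)\<^sup>2"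
        using AE_rep_minus[of "u n" "u m"] by eventually_elim simp
      have "integrable lebesgue (\<lambda>x. (rep_L1 (u n) x)\<^sup>2 - 2 * (rep_L1 (u n) x * rep_L1 (u m) x) + (rep_L1 (u m) x)\<^sup>2)"
        using int2 intm by simp
      then have i: "integrable lebesgue (\<lambda>x. (rep_L1 (u n) x - rep_L1 (u m) x)\<^sup>2)"
        by (rule Bochner_Integration.integrable_cong[THEN iffD1, rotated -1]) (auto simp: power2_eq_square algebra_simps)
      have m: "(\<lambda>x. (rep_L1 (u n - u m) x)\<^sup>2) \<in> borel_measurable lebesgue"
        "(\<lambda>x. (rep_L1 (u n) x - rep_L1 (u m) x)\<^sup>2) \<in> borel_measurable lebesgue" by measurable
      have i': "integrable lebesgue (\<lambda>x. (rep_L1 (u n - u m) x)\<^sup>2)"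
        using integrable_cong_AE[OF m ae] i by simp
      have "norm (u n - u m) \<le> d * measure lebesgue G + (\<integral>x. (rep_L1 (u n - u m) x)\<^sup>2 \<partial>lebesgue) / d"
        by (rule norm_le_square[OF X_diff[OF uX uX] i' d])
      also have "(\<integral>x. (rep_L1 (u n - u m) x)\<^sup>2 \<partial>lebesgue) = (\<integral>x. (rep_L1 (u n) x - rep_L1 (u m) x)\<^sup>2 \<partial>lebesgue)"
        by (rule integral_cong_AE[OF m ae])
      finally have 1: "norm (u n - u m) \<le> d * measure lebesgue G + (\<integral>x. (rep_L1 (u n) x - rep_L1 (u m) x)\<^sup>2 \<partial>lebesgue) / d" .
      have "(\<integral>x. (rep_L1 (u n) x - rep_L1 (u m) x)\<^sup>2 \<partial>lebesgue) / d \<le> (N n - N m) / d"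
        using key[OF nm] d by (intro divide_right_mono) auto
      with 1 show ?thesis by linarith
    qed
    have abs: "a / d \<le> \<bar>a\<bar> / d" for a using d by (intro divide_right_mono) auto
    consider "m < n" | "n < m" | "n = m" by linarith
    then show ?thesis
    proof cases
      case 1
      then show ?thesis using *[OF 1] abs[of "N n - N m"] by linarith
    next
      case 2
      then show ?thesis using *[OF 2] abs[of "N m - N n"] by (simp add: norm_minus_commute abs_minus_commute)
    next
      case 3
      then show ?thesis using d by simp
    qed
  qed
  have Cu: "Cauchy u"
  proof (rule CauchyI)
    fix e :: real assume e: "e > 0"
    define d where "d = e / 2 / (measure lebesgue G + 1)"
    have mG: "measure lebesgue G + 1 > 0" by (simp add: add_nonneg_pos)
    then have d: "d > 0" using e by (simp add: d_def)
    have "d * measure lebesgue G \<le> d * (measure lebesgue G + 1)" using d by simp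
    also have "\<dots> = e / 2" using mG by (simp add: d_def field_simps)
    finally have dG: "d * measure lebesgue G \<le> e / 2" .
    have "e / 2 * d > 0" using e d by simp
    from CauchyD[OF CN this] obtain M where M: "\<And>n m. n \<ge> M \<Longrightarrow> m \<ge> M \<Longrightarrow> norm (N n - N m) < e / 2 * d" by auto
    have "norm (u n - u m) < e" if "n \<ge> M" "m \<ge> M" for n m
    proof -
      have "\<bar>N n - N m\<bar> / d < e / 2" using M[OF that] d by (simp add: pos_divide_less_eq)
      then show ?thesis using normu[OF d, of n m] dG by linarith
    qed
    then show "\<exists>M. \<forall>n\<ge>M. \<forall>m\<ge>M. norm (u n - u m) < e" by blast
  qed
  \<comment> \<open>The difference of the equations reads
    \<open>\<epsilon> w + A w = u m - u n\<close> for \<open>w = z n - z m\<close>, a resolvent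
    equation with parameter \<open>1 / \<epsilon>\<close>.\<close>
  have normz: "norm (z n - z m) \<le> 1 / \<epsilon> * norm (u n - u m)" for n m
  proof -
    have l: "1 / \<epsilon> > 0" using \<epsilon> by simp
    have wD: "z n - z m \<in> D" by (rule D_diff[OF z(1) z(1)])
    have "\<epsilon> *\<^sub>R (z n - z m) + A (z n - z m) - (u m - u n)
      = (\<epsilon> *\<^sub>R z n + u n + A (z n)) - (\<epsilon> *\<^sub>R z m + u m + A (z m))"
      by (simp add: A_diff[OF z(1) z(1)] algebra_simps)
    then have "\<epsilon> *\<^sub>R (z n - z m) + A (z n - z m) = u m - u n" by (simp add: eq)
    then have "(1 / \<epsilon>) *\<^sub>R (\<epsilon> *\<^sub>R (z n - z m) + A (z n - z m)) = (1 / \<epsilon>) *\<^sub>R (u m - u n)" by simp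
    then have "(z n - z m) + (1 / \<epsilon>) *\<^sub>R A (z n - z m) = (1 / \<epsilon>) *\<^sub>R (u m - u n)"
      using \<epsilon> by (simp add: scaleR_add_right)
    then have "z n - z m = J (1 / \<epsilon>) ((1 / \<epsilon>) *\<^sub>R (u m - u n))" using J_unique[OF l wD] by simp
    then have "norm (z n - z m) \<le> norm ((1 / \<epsilon>) *\<^sub>R (u m - u n))"
      using norm_J_le[OF l X_scale[OF X_diff[OF uX uX]], of "1 / \<epsilon>" m n] by simp
    then show ?thesis using \<epsilon> by (simp add: norm_minus_commute)
  qed
  have Cz: "Cauchy z"
  proof (rule CauchyI)
    fix e :: real assume e: "e > 0"
    then have "\<epsilon> * e > 0" using \<epsilon> by simp
    from CauchyD[OF Cu this] obtain M where M: "\<And>n m. n \<ge> M \<Longrightarrow> m \<ge> M \<Longrightarrow> norm (u n - u m) < \<epsilon> * e" by auto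
    have "norm (z n - z m) < e" if "n \<ge> M" "m \<ge> M" for n m
    proof -
      have "1 / \<epsilon> * norm (u n - u m) < e" using M[OF that] \<epsilon> by (simp add: pos_divide_less_eq mult.commute)
      then show ?thesis using normz[of n m] by linarith
    qed
    then show "\<exists>M. \<forall>n\<ge>M. \<forall>m\<ge>M. norm (z n - z m) < e" by blast
  qed
  obtain u' where u': "u \<longlonglongrightarrow> u'" using Cauchy_convergent[OF Cu] unfolding convergent_def by blast
  obtain z' where z': "z \<longlonglongrightarrow> z'" using Cauchy_convergent[OF Cz] unfolding convergent_def by blast
  have "(\<lambda>n. f - \<epsilon> *\<^sub>R z n - u n) \<longlonglongrightarrow> f - \<epsilon> *\<^sub>R z' - u'" by (intro tendsto_intros u' z')
  moreover have "f - \<epsilon> *\<^sub>R z n - u n = A (z n)" for n using eq[of n] by (simp add: algebra_simps)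
  ultimately have "(\<lambda>n. A (z n)) \<longlonglongrightarrow> f - \<epsilon> *\<^sub>R z' - u'" by simp
  note zA = A_closed[OF z(1) z' this]
  have "\<mu> \<longlonglongrightarrow> 0" unfolding \<mu>_def by (rule LIMSEQ_inverse_real_of_nat)
  \<comment> \<open>The graph relation holds at \<open>p n\<close>; as
    \<open>z n - p n = \<mu> n *\<^sub>R u n\<close> tends to 0, it passes to the limit at
    \<open>z'\<close>.\<close>
  then have "(\<lambda>n. z n - \<mu> n *\<^sub>R u n) \<longlonglongrightarrow> z' - 0 *\<^sub>R u'" by (intro tendsto_intros z' u')
  moreover have "z n - \<mu> n *\<^sub>R u n = p n" for n using \<mu>[of n] by (simp add: u_def)
  ultimately have "p \<longlonglongrightarrow> z'" by simp
  then have "in_graph u' z'" by (rule in_graph_closed[OF u' _ gr])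
  moreover have "u' \<in> X" by (rule closed_sequentially[OF closed_L1_on _ u']) (rule uX)
  moreover have "\<epsilon> *\<^sub>R z' + u' + A z' = f" using zA(2) by simp
  ultimately show ?thesis using zA(1) by blast
qed

text \<open>The sup bounds \<open>n / \<epsilon> n\<close> of the solutions are not uniform, so only
  L^1 estimates are used: differences of \<open>u n\<close> are bounded by those of
  \<open>y n = fn n - \<epsilon> n *\<^sub>R z n\<close>, hence so are those of
  \<open>A (z n)\<close>, and by coercivity those of \<open>z n\<close>.\<close>

lemma range_sum:
  assumes f: "f \<in> X"
  shows "\<exists>z\<in>D. \<exists>u\<in>X. in_graph u z \<and> u + A z = f"
proof -
  define tr where "tr n x = max (- real n) (min (real n) (rep_L1 f x))" for n x
  have tr: "\<bar>tr n x\<bar> \<le> real n" "\<bar>tr n x\<bar> \<le> \<bar>rep_L1 f x\<bar>" for n x by (auto simp: tr_def)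
  have trm: "tr n \<in> borel_measurable lebesgue" for n unfolding tr_def by measurable
  have tri: "integrable lebesgue (\<lambda>x. indicator G x * tr n x)" for n
    by (rule integrable_indicator_dominated[OF G_sets measurable_restrict_space1[OF trm] integrable_rep_L1[of f]])
       (simp add: tr)
  define fn where "fn n = restrict_L1 G (tr n)" for n
  have fnX: "fn n \<in> X" for n unfolding fn_def by (rule restrict_L1_in_L1_on[OF tri])
  have fnrep: "AE x in lebesgue. rep_L1 (fn n) x = indicator G x * tr n x" for n
    unfolding fn_def by (rule AE_rep_restrict_L1[OF tri])
  have fn_norm: "norm (fn n) \<le> norm f" for n
  proof (rule norm_L1_mono)
    show "AE x in lebesgue. \<bar>rep_L1 (fn n) x\<bar> \<le> \<bar>rep_L1 f x\<bar>"
      using fnrep[of n] by eventually_elim (simp add: indicator_def tr)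
  qed
  have fnlim: "fn \<longlonglongrightarrow> f"
  proof -
    have "(\<lambda>n. abs_L1 (\<lambda>x. indicator G x * tr n x)) \<longlonglongrightarrow> abs_L1 (rep_L1 f)"
    proof (rule tendsto_abs_L1_dominated[where w = "\<lambda>x. \<bar>rep_L1 f x\<bar>"])
      show "AE x in lebesgue. (\<lambda>n. indicator G x * tr n x) \<longlonglongrightarrow> rep_L1 f x"
        using X_zero_outside[OF f]
      proof eventually_elim
        case (elim x)
        obtain N where N: "\<bar>rep_L1 f x\<bar> \<le> real N" using real_arch_simple by blast
        have "indicator G x * tr n x = rep_L1 f x" if "n \<ge> N" for n
        proof -
          have "\<bar>rep_L1 f x\<bar> \<le> real n" using N that by linarith
          then have "tr n x = rep_L1 f x" by (auto simp: tr_def)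
          then show ?thesis using elim by (cases "x \<in> G") auto
        qed
        then show ?case by (intro tendsto_eventually eventually_sequentiallyI)
      qed
      show "AE x in lebesgue. \<bar>indicator G x * tr n x\<bar> \<le> \<bar>rep_L1 f x\<bar>" for n
        by (rule AE_I2) (simp add: indicator_def tr)
    qed (use tri in auto)
    then show ?thesis by (simp add: fn_def[abs_def] restrict_L1_def)
  qed
  define \<epsilon> where "\<epsilon> n = inverse (real (Suc n))" for n
  have \<epsilon>: "\<epsilon> n > 0" for n by (simp add: \<epsilon>_def)
  have "\<exists>z\<in>D. \<exists>u\<in>X. in_graph u z \<and> \<epsilon> n *\<^sub>R z + u + A z = fn n" for n
  proof (rule bounded_data_solution[OF \<epsilon> fnX, of "real n / \<epsilon> n"])
    show "AE x in lebesgue. x \<in> G \<longrightarrow> \<bar>rep_L1 (fn n) x\<bar> \<le> \<epsilon> n * (real n / \<epsilon> n)"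
      using fnrep[of n]
    proof eventually_elim
      case (elim x)
      have "\<epsilon> n * (real n / \<epsilon> n) = real n" using \<epsilon>[of n] by simp
      then show ?case using tr(1)[of n x] elim by (simp add: indicator_def)
    qed
  qed (use \<epsilon>[of n] in simp)
  then obtain z u where z: "\<And>n. z n \<in> D" and u: "\<And>n. u n \<in> X" and gr: "\<And>n. in_graph (u n) (z n)"
    and eq: "\<And>n. \<epsilon> n *\<^sub>R z n + u n + A (z n) = fn n"
    unfolding Bex_def by metis
  obtain c where c: "c > 0" "\<And>v. v \<in> D \<Longrightarrow> c * norm v \<le> norm (A v)" using coercive by blast
  define y where "y n = fn n - \<epsilon> n *\<^sub>R z n" for n
  have eqy: "u n + A (z n) = y n" for n using eq[of n] by (simp add: y_def algebra_simps)
  \<comment> \<open>Comparison with the trivial pair of zeros bounds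
    \<open>norm (u n) + \<epsilon> n * norm (z n)\<close> by \<open>norm f\<close>; the equation
    then bounds \<open>A (z n)\<close> by \<open>2 * norm f\<close>, and coercivity bounds
    \<open>z n\<close> itself, so that \<open>\<epsilon> n *\<^sub>R z n\<close> vanishes in the
    limit.\<close>
  have zb: "norm (z n) \<le> 2 * norm f / c" for n
  proof -
    have 1: "norm (u n) + \<epsilon> n * norm (z n) \<le> norm (fn n)"
      using accretive_estimate[OF z[of n] D_zero u[of n] X_zero gr[of n] in_graph_zero less_imp_le[OF \<epsilon>[of n]]]
      by (simp add: A_zero eq)
    have "A (z n) = fn n - (\<epsilon> n *\<^sub>R z n + u n)" using eq[of n] by (simp add: algebra_simps)
    then have "norm (A (z n)) \<le> norm (fn n) + norm (\<epsilon> n *\<^sub>R z n + u n)" by (simp add: norm_triangle_ineq4)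
    also have "norm (\<epsilon> n *\<^sub>R z n + u n) \<le> \<epsilon> n * norm (z n) + norm (u n)"
      using norm_triangle_ineq[of "\<epsilon> n *\<^sub>R z n" "u n"] \<epsilon>[of n] by simp
    finally have "c * norm (z n) \<le> 2 * norm f" using 1 c(2)[OF z[of n]] fn_norm[of n] by linarith
    then show ?thesis using c(1) by (simp add: pos_le_divide_eq mult.commute)
  qed
  have "\<epsilon> \<longlonglongrightarrow> 0" unfolding \<epsilon>_def by (rule LIMSEQ_inverse_real_of_nat)
  then have "(\<lambda>n. \<epsilon> n * (2 * norm f / c)) \<longlonglongrightarrow> 0 * (2 * norm f / c)" by (intro tendsto_intros)
  then have b: "(\<lambda>n. \<epsilon> n * (2 * norm f / c)) \<longlonglongrightarrow> 0" by simp
  have "(\<lambda>n. \<epsilon> n *\<^sub>R z n) \<longlonglongrightarrow> 0"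
  proof (rule Lim_null_comparison[OF always_eventually b], rule allI)
    show "norm (\<epsilon> n *\<^sub>R z n) \<le> \<epsilon> n * (2 * norm f / c)" for n
      using zb[of n] \<epsilon>[of n] by (simp add: mult_left_mono del: times_divide_eq_right)
  qed
  from tendsto_diff[OF fnlim this] have ylim: "y \<longlonglongrightarrow> f" by (simp add: y_def[abs_def])
  have Cy: "Cauchy y" by (rule LIMSEQ_imp_Cauchy[OF ylim])
  have nu: "norm (u n - u m) \<le> norm (y n - y m)" for n m
  proof -
    have "norm (u n - u m) \<le> norm ((u n - u m) + (A (z n) - A (z m)))"
      using accretive_estimate[OF z[of n] z[of m] u[of n] u[of m] gr[of n] gr[of m] order_refl] by simp
    also have "(u n - u m) + (A (z n) - A (z m)) = y n - y m" by (simp add: eqy[symmetric])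
    finally show ?thesis .
  qed
  have nz: "norm (z n - z m) \<le> 2 / c * norm (y n - y m)" for n m
  proof -
    have "A (z n - z m) = (y n - y m) - (u n - u m)"
      by (simp add: A_diff[OF z z] eqy[symmetric])
    then have "norm (A (z n - z m)) \<le> norm (y n - y m) + norm (u n - u m)" by (simp only: norm_triangle_ineq4)
    then have "c * norm (z n - z m) \<le> 2 * norm (y n - y m)"
      using c(2)[OF D_diff[OF z z], of n m] nu[of n m] by linarith
    then show ?thesis using c(1) by (simp add: pos_le_divide_eq mult.commute)
  qed
  have lipC: "Cauchy x" if K: "K > 0" "\<And>n m. norm (x n - x m) \<le> K * norm (y n - y m)" for x :: "nat \<Rightarrow> 'a L1" and K
  proof (rule CauchyI)
    fix e :: real assume "e > 0"
    then have "e / K > 0" using K by simp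
    from CauchyD[OF Cy this] obtain M where M: "\<And>n m. n \<ge> M \<Longrightarrow> m \<ge> M \<Longrightarrow> norm (y n - y m) < e / K" by auto
    have "norm (x n - x m) < e" if "n \<ge> M" "m \<ge> M" for n m
    proof -
      have "K * norm (y n - y m) < e" using M[OF that] K(1) by (simp add: pos_less_divide_eq mult.commute)
      then show ?thesis using K(2)[of n m] by linarith
    qed
    then show "\<exists>M. \<forall>n\<ge>M. \<forall>m\<ge>M. norm (x n - x m) < e" by blast
  qed
  have "Cauchy u" by (rule lipC[of 1]) (use nu in auto)
  then obtain u' where u': "u \<longlonglongrightarrow> u'" using Cauchy_convergent unfolding convergent_def by blast
  have "Cauchy z" by (rule lipC[OF _ nz]) (use c(1) in simp)
  then obtain z' where z': "z \<longlonglongrightarrow> z'" using Cauchy_convergent unfolding convergent_def by blast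
  have "(\<lambda>n. y n - u n) \<longlonglongrightarrow> f - u'" by (intro tendsto_intros ylim u')
  then have "(\<lambda>n. A (z n)) \<longlonglongrightarrow> f - u'" by (simp add: eqy[symmetric])
  note zA = A_closed[OF z z' this]
  have "in_graph u' z'" by (rule in_graph_closed[OF u' z' gr])
  moreover have "u' \<in> X" by (rule closed_sequentially[OF closed_L1_on _ u']) (rule u)
  moreover have "u' + A z' = f" using zA(2) by simp
  ultimately show ?thesis using zA(1) by blast
qed

text \<open>The resolvent of \<open>l A\<close> at \<open>k\<close> is that of \<open>A\<close> at
  \<open>k * l\<close>, and the coercivity constant becomes \<open>l * c\<close>, so all hypotheses
  persist. Range and accretivity for general \<open>l\<close> thus reduce to the factor 1.\<close>

lemma L1_problem_scale:
  assumes l: "l > 0"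
  shows "L1_problem G D (\<lambda>v. l *\<^sub>R A v) g"
proof (intro L1_problem.intro L1_operator.intro L1_problem_axioms.intro)
  have res: "resolvent D (\<lambda>v. l *\<^sub>R A v) k = resolvent D A (k * l)" for k
    by (simp add: resolvent_def)
  show "linear_operator X D (\<lambda>v. l *\<^sub>R A v)"
    unfolding linear_operator_def
  proof (intro conjI ballI allI)
    show "subspace D" using lin by (simp add: linear_operator_def)
    show "D \<subseteq> X" using D_X by blast
    show "(\<lambda>v. l *\<^sub>R A v) ` D \<subseteq> X" using A_X X_scale by blast
    show "l *\<^sub>R A (u + v) = l *\<^sub>R A u + l *\<^sub>R A v" if "u \<in> D" "v \<in> D" for u v
      using that by (simp add: A_add scaleR_add_right)
    show "l *\<^sub>R A (c *\<^sub>R u) = c *\<^sub>R l *\<^sub>R A u" if "u \<in> D" for u c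
      using that by (simp add: A_scale mult.commute)
  qed
  show "bij_betw (\<lambda>v. v + k *\<^sub>R l *\<^sub>R A v) D X" if "k > 0" for k
    using bij[of "k * l"] that l by simp
  show "1-lipschitz_on X (resolvent D (\<lambda>v. l *\<^sub>R A v) k)" if "k > 0" for k
    unfolding res using contr[of "k * l"] that l by simp
  show "sup_on G (resolvent D (\<lambda>v. l *\<^sub>R A v) k f) \<le> max (sup_on G f) 0" if "f \<in> X" "k > 0" for f k
    unfolding res using sup[of f "k * l"] that l by simp
  obtain c where c: "c > 0" "\<forall>v\<in>D. c * norm v \<le> norm (A v)" using coercive by blast
  then have "l * c * norm v \<le> norm (l *\<^sub>R A v)" if "v \<in> D" for v
    using that l by (simp add: mult.assoc mult_left_mono)
  then show "\<exists>c>0. \<forall>v\<in>D. c * norm v \<le> norm (l *\<^sub>R A v)"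
    using c(1) l by (intro exI[of _ "l * c"]) auto
qed (fact G dense potential g_meas growth)+

end

section \<open>Well-posedness for the given integrand\<close>

theorem proposition4p9:
  fixes G :: "(real^'n) set" and T :: real
    and \<phi> :: "real^'n \<Rightarrow> real \<Rightarrow> ereal"
    and D :: "(real^'n) L1 set" and A :: "(real^'n) L1 \<Rightarrow> (real^'n) L1"
  defines "\<beta> \<equiv> subgradient \<phi>"
  defines "\<A> \<equiv> composed_relation G \<beta> D A"
  assumes "open G" "bounded G" "G \<noteq> {}" and "T > 0"
    and "measurable_convex_integrand G \<phi>"
    and "\<And>x \<xi>. x \<in> G \<Longrightarrow> 0 \<le> \<phi> x \<xi> \<and> \<phi> x \<xi> < \<infinity>"
    and "\<And>x. x \<in> G \<Longrightarrow> \<phi> x 0 = 0"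
    and "\<And>C. C > 0 \<Longrightarrow> in_L2 G (growth_bound \<beta> C)"
    and "linear_operator (L1_on G) D A"
    and "L1_on G \<subseteq> closure D"
    and "\<And>l. l > 0 \<Longrightarrow> bij_betw (\<lambda>v. v + l *\<^sub>R A v) D (L1_on G)"
    and "\<And>l. l > 0 \<Longrightarrow> 1-lipschitz_on (L1_on G) (resolvent D A l)"
    and "\<exists>c>0. \<forall>v\<in>D. c * norm v \<le> norm (A v)"
    and "\<And>f l. f \<in> L1_on G \<Longrightarrow> l > 0 \<Longrightarrow> sup_on G (resolvent D A l f) \<le> max (sup_on G f) 0"
  shows "\<forall>u0\<in>closure (Dom \<A>). \<forall>F.
    integrable (lebesgue_on {0<..<T}) F \<and> (\<forall>t\<in>{0<..<T}. F t \<in> L1_on G) \<longrightarrow>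
    (\<exists>u. C0_solution (L1_on G) \<A> F T u0 u \<and>
       (\<forall>v. C0_solution (L1_on G) \<A> F T u0 v \<longrightarrow> (\<forall>t\<in>{0..T}. v t = u t)))"
proof -
  \<comment> \<open>On \<open>G\<close> the integrand is finite, so it is recovered from its real
    version.\<close>
  define g where "g x v = real_of_ereal (\<phi> x v)" for x v
  have G: "G \<in> sets lebesgue" using \<open>open G\<close> by auto
  have \<beta>: "\<beta> x v = real_subgradient (g x) v" if "x \<in> G" for x v
    unfolding \<beta>_def g_def using assms(8)[OF that] by (rule subgradient_eq_real_subgradient)
  \<comment> \<open>Agreement on \<open>G\<close> is enough, this being the whole space of
    \<open>lebesgue_on G\<close>.\<close>
  have gb: "growth_bound (\<lambda>x. real_subgradient (g x)) C x = growth_bound \<beta> C x" if "x \<in> G" for x C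
    using \<beta>[OF that] by (simp add: growth_bound_def)
  interpret L1_problem G D A g
  proof (intro L1_problem.intro L1_operator.intro L1_problem_axioms.intro)
    fix x assume x: "x \<in> G"
    show "convex_potential (g x)"
      unfolding g_def
      by (rule convex_potential_integrand)
        (use x assms(7) assms(8,9)[OF x] in \<open>auto simp: measurable_convex_integrand_def\<close>)
  next
    fix v
    have "(\<lambda>x. \<phi> x v) \<in> borel_measurable (lebesgue_on G)"
      using assms(7) by (simp add: measurable_convex_integrand_def)
    then show "(\<lambda>x. g x v) \<in> borel_measurable (lebesgue_on G)"
      unfolding g_def by (rule borel_measurable_real_of_ereal)
  next
    fix C :: real assume "C > 0"
    then have "in_L2 G (growth_bound \<beta> C)" by (rule assms(10))
    moreover have "growth_bound (\<lambda>x. real_subgradient (g x)) C \<in> borel_measurable (lebesgue_on G) \<longleftrightarrow>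
       growth_bound \<beta> C \<in> borel_measurable (lebesgue_on G)"
      by (rule measurable_cong) (simp add: gb)
    moreover have "(\<integral>\<^sup>+x. (growth_bound (\<lambda>x. real_subgradient (g x)) C x)\<^sup>2 \<partial>lebesgue_on G) =
       (\<integral>\<^sup>+x. (growth_bound \<beta> C x)\<^sup>2 \<partial>lebesgue_on G)"
      by (rule nn_integral_cong) (simp add: gb)
    ultimately show "in_L2 G (growth_bound (\<lambda>x. real_subgradient (g x)) C)"
      by (simp add: in_L2_def)
  qed (fact assms)+
  have \<A>: "f \<in> \<A> u \<longleftrightarrow> u \<in> L1_on G \<and> f \<in> L1_on G \<and> (\<exists>z\<in>D. A z = f \<and> in_graph u z)" for f u
  proof -
    have "(AE x in lebesgue. x \<in> G \<longrightarrow> rep_L1 u x \<in> \<beta> x (rep_L1 z x)) \<longleftrightarrow> in_graph u z" for z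
      unfolding in_graph_def by (rule AE_cong) (auto simp: \<beta>)
    then show ?thesis by (simp add: \<A>_def composed_relation_def AE_on_G)
  qed
  have acc: "accretive \<A>"
    unfolding accretive_def
  proof (intro allI impI)
    fix x y f h and l :: real assume *: "f \<in> \<A> x" "h \<in> \<A> y" "l > 0"
    \<comment> \<open>For \<open>l A\<close> in place of \<open>A\<close>, the estimate with
      \<open>e = 0\<close> is accretivity with parameter \<open>l\<close>.\<close>
    interpret S: L1_problem G D "\<lambda>v. l *\<^sub>R A v" g by (rule L1_problem_scale[OF \<open>l > 0\<close>])
    obtain z z' where "z \<in> D" "A z = f" "in_graph x z" "z' \<in> D" "A z' = h" "in_graph y z'"
      using * \<A> by blast
    then show "norm (x - y) \<le> norm (x - y + l *\<^sub>R (f - h))"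
      using S.accretive_estimate[of z z' x y 0] * \<A> by (simp add: scaleR_diff_right)
  qed
  have range: "\<exists>x\<in>L1_on G. \<exists>y\<in>\<A> x. x + l *\<^sub>R y = f" if l: "l > 0" and f: "f \<in> L1_on G" for l f
  proof -
    interpret S: L1_problem G D "\<lambda>v. l *\<^sub>R A v" g by (rule L1_problem_scale[OF l])
    obtain z u where "z \<in> D" "u \<in> L1_on G" "in_graph u z" "u + l *\<^sub>R A z = f"
      using S.range_sum[OF f] by blast
    then show ?thesis using A_X by (intro bexI[of _ u] bexI[of _ "A z"]) (auto simp: \<A>)
  qed
  have DomX: "Dom \<A> \<subseteq> L1_on G" using \<A> by (auto simp: Dom_def)
  show ?thesis
  proof (intro ballI allI impI, elim conjE)
    fix u0 F assume u0: "u0 \<in> closure (Dom \<A>)" and F: "integrable (lebesgue_on {0<..<T}) F"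
      and FX: "\<forall>t\<in>{0<..<T}. F t \<in> L1_on G"
    obtain u where u: "C0_solution (L1_on G) \<A> F T u0 u"
      using C0_solution_exists[OF acc subspace_L1_on closed_L1_on DomX range \<open>T > 0\<close> F _ u0] FX by blast
    show "\<exists>u. C0_solution (L1_on G) \<A> F T u0 u \<and>
       (\<forall>v. C0_solution (L1_on G) \<A> F T u0 v \<longrightarrow> (\<forall>t\<in>{0..T}. v t = u t))"
      using u C0_solution_unique[OF acc \<open>T > 0\<close> F u0 u] by blast
  qed
qed

end
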